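(* Let $n\ge 1$ be an integer, let $\mathcal{H}=L^2(\mathbb{R}^n)$, and let $1\le p\le \frac{4n}{2n-1}$. Let $A\in S^p(\mathcal{H})$ be a non-zero operator and let $(x_1,y_1),\dots,(x_k,y_k)$ be distinct elements of $\mathbb{R}^{2n}$ (with $x_j,y_j\in\mathbb{R}^n$). Then $\{(x_1,y_1)\cdot A,\dots,(x_k,y_k)\cdot A\}$ is a linearly independent set over $\mathbb{C}$; that is, if $c_1,\dots,c_k\in\mathbb{C}$ satisfy $\sum_{j=1}^k c_j\,(x_j,y_j)\cdot A=0$, then $c_1=\dots=c_k=0$.
   Context: $\mathcal{H}=L^2(\mathbb{R}^n)$ is the complex Hilbert space of square-integrable functions, and $S^p(\mathcal{H})$ denotes the $p$-Schatten class of operators on $\mathcal{H}$. For $x,y\in\mathbb{R}^n$ and $z\in\mathbb{C}$ with $|z|=1$, $\rho(x,y,z)$ is the unitary operator on $\mathcal{H}$ given by $$(\rho(x,y,z)\varphi)(t)=z\,e^{\pi i(x\cdot y+2y\cdot t)}\varphi(t+x),\qquad \varphi\in\mathcal{H},\ t\in\mathbb{R}^n$$ (the Schrödinger representation of the reduced Heisenberg group, whose multiplication is $(x,y,z)(x',y',z')=(x+x',y+y',zz'e^{\pi i(x\cdot y'-y\cdot x')})$). The quantum translate of an operator $X\in S^p(\mathcal{H})$ by $(x,y)\in\mathbb{R}^{2n}$ is $$(x,y)\cdot X=\rho(x,y,1)\,X\,\rho(x,y,1)^{-1}.$$ *)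

theory Defs
  imports "HOL-Analysis.Analysis"
begin

section \<open>The complex Hilbert space $L^2(\mathbb{R}^n)$\<close>

definition square_integrable :: "('a::euclidean_space \<Rightarrow> complex) \<Rightarrow> bool" where
  "square_integrable f \<longleftrightarrow> f \<in> borel_measurable lborel \<and> integrable lborel (\<lambda>t. (cmod (f t))\<^sup>2)"

definition ae_eq_sq :: "('a::euclidean_space \<Rightarrow> complex) \<Rightarrow> ('a \<Rightarrow> complex) \<Rightarrow> bool" where
  "ae_eq_sq f g \<longleftrightarrow> square_integrable f \<and> square_integrable g \<and> (AE t in lborel. f t = g t)"

lemma square_integrable_zero: "square_integrable (\<lambda>_. 0)"
  by (simp add: square_integrable_def)

lemma square_integrable_scale:
  assumes "square_integrable f" shows "square_integrable (\<lambda>t. c * f t)"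
  using assms by (auto simp: square_integrable_def norm_mult power_mult_distrib)

lemma square_integrable_add:
  assumes "square_integrable f" "square_integrable g"
  shows "square_integrable (\<lambda>t. f t + g t)"
proof -
  have [measurable]: "f \<in> borel_measurable lborel" "g \<in> borel_measurable lborel"
    using assms by (auto simp: square_integrable_def)
  have int: "integrable lborel (\<lambda>t. 2 * (cmod (f t))\<^sup>2 + 2 * (cmod (g t))\<^sup>2)"
    using assms by (auto simp: square_integrable_def)
  have le: "(cmod (f t + g t))\<^sup>2 \<le> 2 * (cmod (f t))\<^sup>2 + 2 * (cmod (g t))\<^sup>2" for t
  proof -
    have "(cmod (f t + g t))\<^sup>2 \<le> (cmod (f t) + cmod (g t))\<^sup>2"
      by (intro power_mono norm_triangle_ineq) auto
    also have "\<dots> \<le> 2 * (cmod (f t))\<^sup>2 + 2 * (cmod (g t))\<^sup>2"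
      using sum_squares_bound[of "cmod (f t)" "cmod (g t)"] by (simp add: power2_sum)
    finally show ?thesis .
  qed
  show ?thesis
    unfolding square_integrable_def
    by (intro conjI Bochner_Integration.integrable_bound[OF int]) (use le in auto)
qed

lemma borel_measurable_cnj [measurable (raw)]:
  assumes "f \<in> borel_measurable M" shows "(\<lambda>t. cnj (f t)) \<in> borel_measurable M"
  by (rule borel_measurable_continuous_on[OF _ assms]) (intro continuous_intros)

lemma square_integrable_mult_cnj:
  assumes "square_integrable f" "square_integrable g"
  shows "integrable lborel (\<lambda>t. f t * cnj (g t))"
proof -
  have [measurable]: "f \<in> borel_measurable lborel" "g \<in> borel_measurable lborel"
    using assms by (auto simp: square_integrable_def)
  have int: "integrable lborel (\<lambda>t. (cmod (f t))\<^sup>2 + (cmod (g t))\<^sup>2)"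
    using assms by (auto simp: square_integrable_def)
  have le: "cmod (f t) * cmod (g t) \<le> (cmod (f t))\<^sup>2 + (cmod (g t))\<^sup>2" for t
    using sum_squares_bound[of "cmod (f t)" "cmod (g t)"] zero_le_power2[of "cmod (f t)"] zero_le_power2[of "cmod (g t)"]
      mult_nonneg_nonneg[OF norm_ge_zero[of "f t"] norm_ge_zero[of "g t"]] by linarith
  show ?thesis
  proof (rule Bochner_Integration.integrable_bound[OF int])
    show "(\<lambda>t. f t * cnj (g t)) \<in> borel_measurable lborel" by measurable
    show "AE t in lborel. norm (f t * cnj (g t)) \<le> norm ((cmod (f t))\<^sup>2 + (cmod (g t))\<^sup>2)"
      using le by (simp add: norm_mult)
  qed
qed

text \<open>Elements are classes of Borel functions modulo a.e. equality. As every Lebesgue measurable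
  function agrees a.e. with a Borel one, this is the usual space of Lebesgue square-integrable
  functions on a Euclidean space.\<close>

quotient_type (overloaded) 'a L2 = "'a::euclidean_space \<Rightarrow> complex" / partial: ae_eq_sq
proof (rule part_equivpI)
  show "\<exists>f::'a \<Rightarrow> complex. ae_eq_sq f f"
    by (rule exI[of _ "\<lambda>_. 0"]) (simp add: ae_eq_sq_def square_integrable_zero)
  show "symp (ae_eq_sq :: ('a \<Rightarrow> complex) \<Rightarrow> _)"
    by (auto simp: symp_def ae_eq_sq_def)
  show "transp (ae_eq_sq :: ('a \<Rightarrow> complex) \<Rightarrow> _)"
    by (auto simp: transp_def ae_eq_sq_def)
qed

lift_definition cscale :: "complex \<Rightarrow> 'a::euclidean_space L2 \<Rightarrow> 'a L2" (infixr "*\<^sub>C" 75)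
  is "\<lambda>c f t. c * f t"
  by (auto simp: ae_eq_sq_def intro: square_integrable_scale)

lift_definition cinner :: "'a::euclidean_space L2 \<Rightarrow> 'a L2 \<Rightarrow> complex"
  is "\<lambda>f g. LINT t|lborel. f t * cnj (g t)"
  by (rule integral_cong_AE)
     (auto simp: ae_eq_sq_def square_integrable_def intro!: borel_measurable_times borel_measurable_cnj)

instantiation L2 :: (euclidean_space) real_inner
begin

lift_definition zero_L2 :: "'a L2" is "\<lambda>_. 0"
  by (simp add: ae_eq_sq_def square_integrable_zero)

lift_definition plus_L2 :: "'a L2 \<Rightarrow> 'a L2 \<Rightarrow> 'a L2" is "\<lambda>f g t. f t + g t"
  by (auto simp: ae_eq_sq_def intro: square_integrable_add)

definition uminus_L2 :: "'a L2 \<Rightarrow> 'a L2" where "uminus_L2 f = (-1) *\<^sub>C f"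
definition minus_L2 :: "'a L2 \<Rightarrow> 'a L2 \<Rightarrow> 'a L2" where "minus_L2 f g = f + - g"
definition scaleR_L2 :: "real \<Rightarrow> 'a L2 \<Rightarrow> 'a L2" where "scaleR_L2 r f = complex_of_real r *\<^sub>C f"
definition inner_L2 :: "'a L2 \<Rightarrow> 'a L2 \<Rightarrow> real" where "inner_L2 f g = Re (cinner f g)"
definition norm_L2 :: "'a L2 \<Rightarrow> real" where "norm_L2 f = sqrt (inner f f)"
definition sgn_L2 :: "'a L2 \<Rightarrow> 'a L2" where "sgn_L2 f = inverse (norm f) *\<^sub>R f"
definition dist_L2 :: "'a L2 \<Rightarrow> 'a L2 \<Rightarrow> real" where "dist_L2 f g = norm (f - g)"
definition uniformity_L2 :: "('a L2 \<times> 'a L2) filter"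
  where "uniformity_L2 = (INF e\<in>{0 <..}. principal {(f, g). dist f g < e})"
definition open_L2 :: "'a L2 set \<Rightarrow> bool"
  where "open_L2 S = (\<forall>f\<in>S. \<forall>\<^sub>F (f', g) in uniformity. f' = f \<longrightarrow> g \<in> S)"

instance
proof
  fix a b c :: "'a L2" and r s :: real
  show "dist a b = norm (a - b)" "a - b = a + - b" "sgn a = inverse (norm a) *\<^sub>R a"
    "norm a = sqrt (inner a a)"
    by (simp_all add: dist_L2_def sgn_L2_def minus_L2_def norm_L2_def)
  show "a + b + c = a + (b + c)"
    by transfer (auto simp: ae_eq_sq_def add.assoc intro!: square_integrable_add)
  show "a + b = b + a"
    by transfer (auto simp: ae_eq_sq_def add.commute intro!: square_integrable_add)
  show "0 + a = a"
    by transfer (auto simp: ae_eq_sq_def)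
  show "- a + a = 0"
    unfolding uminus_L2_def
    by transfer (auto simp: ae_eq_sq_def square_integrable_zero)
  show "r *\<^sub>R (a + b) = r *\<^sub>R a + r *\<^sub>R b"
    unfolding scaleR_L2_def
    by transfer (auto simp: ae_eq_sq_def distrib_left intro!: square_integrable_add square_integrable_scale)
  show "(r + s) *\<^sub>R a = r *\<^sub>R a + s *\<^sub>R a"
    unfolding scaleR_L2_def
    by transfer (auto simp: ae_eq_sq_def distrib_right intro!: square_integrable_add square_integrable_scale)
  show "r *\<^sub>R s *\<^sub>R a = (r * s) *\<^sub>R a"
    unfolding scaleR_L2_def
    by transfer (auto simp: ae_eq_sq_def mult.assoc intro!: square_integrable_scale[of "\<lambda>t. _ * _ t"] square_integrable_scale)
  show "1 *\<^sub>R a = a"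
    unfolding scaleR_L2_def
    by transfer (auto simp: ae_eq_sq_def)
  show "inner a b = inner b a"
  proof -
    have "cinner a b = cnj (cinner b a)"
      proof transfer
      fix f g :: "'a \<Rightarrow> complex"
      have "(\<lambda>t. f t * cnj (g t)) = (\<lambda>t. cnj (g t * cnj (f t)))" by (simp add: mult.commute)
      then show "(LINT t|lborel. f t * cnj (g t)) = cnj (LINT t|lborel. g t * cnj (f t))"
        by (simp only: Bochner_Integration.integral_cnj)
    qed
    then show ?thesis by (simp add: inner_L2_def)
  qed
  show "inner (a + b) c = inner a c + inner b c"
  proof -
    have "cinner (a + b) c = cinner a c + cinner b c"
      by transfer (simp add: distrib_right ae_eq_sq_def square_integrable_mult_cnj)
    then show ?thesis by (simp add: inner_L2_def)
  qed
  show "inner (r *\<^sub>R a) b = r * inner a b"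
  proof -
    have "cinner (r *\<^sub>R a) b = r * cinner a b"
      unfolding scaleR_L2_def by transfer (simp add: mult.assoc)
    then show ?thesis by (simp add: inner_L2_def)
  qed
  have sq: "inner a a \<ge> 0 \<and> (inner a a = 0 \<longleftrightarrow> a = 0)"
    unfolding inner_L2_def
  proof transfer
    fix f :: "'a \<Rightarrow> complex" assume "ae_eq_sq f f"
    then have f: "square_integrable f" by (simp add: ae_eq_sq_def)
    then have [measurable]: "f \<in> borel_measurable lborel"
      and int: "integrable lborel (\<lambda>t. (cmod (f t))\<^sup>2)" by (auto simp: square_integrable_def)
    have eq: "Re (LINT t|lborel. f t * cnj (f t)) = (LINT t|lborel. (cmod (f t))\<^sup>2)"
      by (simp add: complex_norm_square[symmetric] del: of_real_power)
    show "0 \<le> Re (LINT t|lborel. f t * cnj (f t)) \<and>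
      (Re (LINT t|lborel. f t * cnj (f t)) = 0 \<longleftrightarrow> ae_eq_sq f (\<lambda>_. 0))"
      unfolding eq using integral_nonneg_eq_0_iff_AE[OF int] f
      by (auto simp: ae_eq_sq_def square_integrable_zero)
  qed
  show "0 \<le> inner a a" "inner a a = 0 \<longleftrightarrow> a = 0" using sq by auto
qed (rule uniformity_L2_def open_L2_def)+

end

interpretation L2: vector_space "(*\<^sub>C) :: complex \<Rightarrow> 'a::euclidean_space L2 \<Rightarrow> 'a L2"
proof
  fix a b :: complex and x y :: "'a L2"
  show "a *\<^sub>C (x + y) = a *\<^sub>C x + a *\<^sub>C y"
    by transfer (auto simp: ae_eq_sq_def distrib_left intro!: square_integrable_add square_integrable_scale)
  show "(a + b) *\<^sub>C x = a *\<^sub>C x + b *\<^sub>C x"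
    by transfer (auto simp: ae_eq_sq_def distrib_right intro!: square_integrable_add square_integrable_scale)
  show "a *\<^sub>C b *\<^sub>C x = (a * b) *\<^sub>C x"
    by transfer (auto simp: ae_eq_sq_def mult.assoc intro!: square_integrable_scale[of "\<lambda>t. _ * _ t"] square_integrable_scale)
  show "1 *\<^sub>C x = x"
    by transfer (auto simp: ae_eq_sq_def)
qed

section \<open>Schatten classes\<close>

definition bounded_clinear :: "('a::euclidean_space L2 \<Rightarrow> 'a L2) \<Rightarrow> bool" where
  "bounded_clinear A \<longleftrightarrow> bounded_linear A \<and> (\<forall>c f. A (c *\<^sub>C f) = c *\<^sub>C A f)"

definition compact_operator :: "('a::euclidean_space L2 \<Rightarrow> 'a L2) \<Rightarrow> bool" where
  "compact_operator A \<longleftrightarrow> bounded_clinear A \<and> compact (closure (A ` cball 0 1))"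

text \<open>For bounded \<open>A\<close> the adjoint exists by completeness of $L^2$ and is unique.\<close>

definition adjoint_op :: "('a::euclidean_space L2 \<Rightarrow> 'a L2) \<Rightarrow> 'a L2 \<Rightarrow> 'a L2" where
  "adjoint_op A = (THE B. \<forall>f g. cinner (A f) g = cinner f (B g))"

definition ceigenspace :: "('a::euclidean_space L2 \<Rightarrow> 'a L2) \<Rightarrow> complex \<Rightarrow> 'a L2 set" where
  "ceigenspace T \<mu> = {f. T f = \<mu> *\<^sub>C f}"

text \<open>The singular values of \<open>A\<close> are the square roots of the eigenvalues of \<open>A\<^sup>*A\<close>.\<close>

definition singular_values :: "('a::euclidean_space L2 \<Rightarrow> 'a L2) \<Rightarrow> real set" where
  "singular_values A = {s. s > 0 \<and> ceigenspace (adjoint_op A \<circ> A) (of_real (s\<^sup>2)) \<noteq> {0}}"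

text \<open>Complex dimension of the eigenspace; it is finite when \<open>A\<close> is compact, so that the convention
  of \<open>dim\<close> being 0 on infinite-dimensional spaces plays no role below.\<close>

definition singular_mult :: "('a::euclidean_space L2 \<Rightarrow> 'a L2) \<Rightarrow> real \<Rightarrow> nat" where
  "singular_mult A s = L2.dim (ceigenspace (adjoint_op A \<circ> A) (of_real (s\<^sup>2)))"

definition schatten_class :: "real \<Rightarrow> ('a::euclidean_space L2 \<Rightarrow> 'a L2) set" where
  "schatten_class p = {A. compact_operator A \<and>
     (\<lambda>s. real (singular_mult A s) * s powr p) summable_on singular_values A}"

section \<open>The Schroedinger representation and quantum translation\<close>

lemma AE_lborel_translate:
  fixes x :: "'a::euclidean_space"
  assumes "AE t in lborel. P t" shows "AE t in lborel. P (t + x)"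
proof -
  have "AE t in distr lborel borel ((+) x). P t" using assms by (simp only: lborel_distr_plus)
  from AE_distrD[OF _ this] show ?thesis by (simp add: add.commute)
qed

lemma square_integrable_translate:
  fixes x :: "'a::euclidean_space"
  assumes "square_integrable f" shows "square_integrable (\<lambda>t. f (t + x))"
proof -
  have f [measurable]: "f \<in> borel_measurable borel"
    and int: "integrable lborel (\<lambda>t. (cmod (f t))\<^sup>2)"
    using assms by (auto simp: square_integrable_def)
  have "integrable (distr lborel borel ((+) x)) (\<lambda>t. (cmod (f t))\<^sup>2)"
    using int by (simp add: lborel_distr_plus)
  then have "integrable lborel (\<lambda>t. (cmod (f (x + t)))\<^sup>2)"
    by (subst (asm) integrable_distr_eq) auto
  then show ?thesis by (simp add: square_integrable_def add.commute)
qed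

lemma square_integrable_phase:
  fixes \<theta> :: "'a::euclidean_space \<Rightarrow> real"
  assumes "square_integrable f" and [measurable]: "\<theta> \<in> borel_measurable borel"
  shows "square_integrable (\<lambda>t. z * exp (\<i> * of_real (\<theta> t)) * f t)"
proof -
  have [measurable]: "f \<in> borel_measurable borel"
    using assms by (simp add: square_integrable_def)
  have "cmod (exp (\<i> * of_real r)) = 1" for r :: real
    by (simp add: norm_exp_i_times)
  then show ?thesis
    using assms by (auto simp: square_integrable_def norm_mult power_mult_distrib)
qed

text \<open>\<open>rho x y z\<close> represents the element \<open>(x, y, z)\<close> of the reduced Heisenberg group when
  \<open>cmod z = 1\<close>, and only then is it unitary.\<close>

lift_definition rho :: "'a::euclidean_space \<Rightarrow> 'a \<Rightarrow> complex \<Rightarrow> 'a L2 \<Rightarrow> 'a L2"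
  is "\<lambda>x y z f t. z * exp (\<i> * of_real (pi * (x \<bullet> y + 2 * (y \<bullet> t)))) * f (t + x)"
proof -
  fix x y :: 'a and z :: complex and f g :: "'a \<Rightarrow> complex"
  assume "ae_eq_sq f g"
  then have sf: "square_integrable f" "square_integrable g" and ae: "AE t in lborel. f t = g t"
    by (auto simp: ae_eq_sq_def)
  show "ae_eq_sq (\<lambda>t. z * exp (\<i> * of_real (pi * (x \<bullet> y + 2 * (y \<bullet> t)))) * f (t + x))
        (\<lambda>t. z * exp (\<i> * of_real (pi * (x \<bullet> y + 2 * (y \<bullet> t)))) * g (t + x))"
    unfolding ae_eq_sq_def using AE_lborel_translate[OF ae, of x]
    by (intro conjI square_integrable_phase square_integrable_translate sf) auto
qed

lemma rho_mult:
  "rho x y z (rho x' y' z' f) =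
     rho (x + x') (y + y') (z * z' * exp (\<i> * of_real (pi * (x \<bullet> y' - y \<bullet> x')))) f"
proof transfer
  fix x y x' y' :: 'a and z z' :: complex and f :: "'a \<Rightarrow> complex"
  assume "ae_eq_sq f f"
  then have sf: "square_integrable f" by (simp add: ae_eq_sq_def)
  define \<theta> where "\<theta> = (\<lambda>(x::'a) (y::'a) t. pi * (x \<bullet> y + 2 * (y \<bullet> t)))"
  have [measurable]: "\<theta> a b \<in> borel_measurable borel" for a b by (auto simp: \<theta>_def)
  have "\<theta> x y t + \<theta> x' y' (t + x) =
      pi * (x \<bullet> y' - y \<bullet> x') + \<theta> (x + x') (y + y') t" for t
    by (simp add: \<theta>_def algebra_simps inner_commute)
  then have e: "exp (\<i> * of_real (\<theta> x y t)) * exp (\<i> * of_real (\<theta> x' y' (t + x))) =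
      exp (\<i> * of_real (pi * (x \<bullet> y' - y \<bullet> x'))) * exp (\<i> * of_real (\<theta> (x + x') (y + y') t))" for t
    by (metis (no_types) distrib_left exp_add of_real_add)
  have "z * exp (\<i> * of_real (\<theta> x y t)) * (z' * exp (\<i> * of_real (\<theta> x' y' (t + x))) * f (t + x + x')) =
     z * z' * (exp (\<i> * of_real (\<theta> x y t)) * exp (\<i> * of_real (\<theta> x' y' (t + x)))) * f (t + x + x')" for t
    by (simp only: mult_ac)
  also have "\<dots> t = z * z' * exp (\<i> * of_real (pi * (x \<bullet> y' - y \<bullet> x'))) *
        exp (\<i> * of_real (\<theta> (x + x') (y + y') t)) * f (t + (x + x'))" for t
    unfolding e by (simp only: mult.assoc add.assoc)
  finally have eq: "z * exp (\<i> * of_real (\<theta> x y t)) *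
       (z' * exp (\<i> * of_real (\<theta> x' y' (t + x))) * f (t + x + x')) =
     z * z' * exp (\<i> * of_real (pi * (x \<bullet> y' - y \<bullet> x'))) *
        exp (\<i> * of_real (\<theta> (x + x') (y + y') t)) * f (t + (x + x'))" for t .
  show "ae_eq_sq
     (\<lambda>t. z * exp (\<i> * of_real (pi * (x \<bullet> y + 2 * (y \<bullet> t)))) *
       (z' * exp (\<i> * of_real (pi * (x' \<bullet> y' + 2 * (y' \<bullet> (t + x))))) * f (t + x + x')))
     (\<lambda>t. z * z' * exp (\<i> * of_real (pi * (x \<bullet> y' - y \<bullet> x'))) *
        exp (\<i> * of_real (pi * ((x + x') \<bullet> (y + y') + 2 * ((y + y') \<bullet> t)))) * f (t + (x + x')))"
    unfolding eq[unfolded \<theta>_def] unfolding ae_eq_sq_def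
    by (intro conjI square_integrable_phase square_integrable_translate sf AE_I2 refl) auto
qed

lemma rho_one: "rho 0 0 1 f = f"
  by transfer (simp add: ae_eq_sq_def)

lemma rho_inverse: "inv (rho x y 1) = rho (- x) (- y) 1" and bij_rho: "bij (rho x y 1)"
proof -
  have *: "rho (- x) (- y) 1 (rho x y 1 f) = f" "rho x y 1 (rho (- x) (- y) 1 f) = f" for f
    by (simp_all add: rho_mult rho_one inner_commute)
  show "inv (rho x y 1) = rho (- x) (- y) 1"
    by (rule inv_equality) (rule *)+
  show "bij (rho x y 1)"
    by (rule o_bij[of "rho (- x) (- y) 1"]) (auto simp: fun_eq_iff *)
qed

definition quantum_translate ::
  "'a::euclidean_space \<Rightarrow> 'a \<Rightarrow> ('a L2 \<Rightarrow> 'a L2) \<Rightarrow> 'a L2 \<Rightarrow> 'a L2" where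
  "quantum_translate x y X = rho x y 1 \<circ> X \<circ> inv (rho x y 1)"

end

theory Submission
  imports Defs "HOL-Probability.Characteristic_Functions"
begin

text \<open>For vectors \<open>g, h\<close> let \<open>u v\<close> be the inner product of \<open>A (\<rho>\<^sub>v g)\<close> and \<open>\<rho>\<^sub>v h\<close>, where \<open>v = (x, y)\<close>.
  The phases of the Heisenberg group cancel, so a linear relation between translates of \<open>A\<close> becomes a
  relation \<open>\<Sum>j. c\<^sub>j u (v - v\<^sub>j) = 0\<close> in dimension \<open>d = 2n\<close>. Moyal's inequality and
  \<open>p \<le> 2d / (d - 1)\<close> show that the integral of \<open>|u|\<^sup>2\<close> over the ball of radius \<open>R\<close> is \<open>o(R)\<close>, and such
  a \<open>u\<close> has independent translates. To see this, pass to a relation \<open>Q u = \<Sum>a. c\<^sub>a u (x + a) = 0\<close> with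
  \<open>Q\<close> self-adjoint and let \<open>Q\<^sub>e\<close> have the coefficients \<open>c\<^sub>a (a \<bullet> e)\<close>. Then \<open>[Q, f] u\<close> is orthogonal
  to \<open>Q\<^sub>e u\<close> for every cut-off function \<open>f\<close>. For \<open>f\<close> running through the components of a vector field
  of the type \<open>L x / sqrt (L\<^sup>2 + |x|\<^sup>2)\<close>, this bounds the integral of \<open>|Q\<^sub>e u|\<^sup>2\<close> over a fixed ball by
  quantities that vanish as \<open>L\<close> grows, so \<open>Q\<^sub>e u = 0\<close>. Hence \<open>c\<^sub>a\<close> may be multiplied by any polynomial
  in \<open>a\<close>, and interpolation isolates \<open>u\<close>.\<close>

section \<open>A virial estimate for translation invariant relations\<close>

text \<open>The obstacle is that \<open>u\<close> need not be square integrable. For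
  \<open>p \<le> 2\<close> Moyal's inequality makes it so, and the Fourier transform would settle
  independence, since a nonzero trigonometric polynomial vanishes only on a null set. Beyond that
  only the growth o(R) of the mass of \<open>|u|^2\<close> remains, and it is a natural border: the
  Fourier transform of a smooth measure on a hypersurface of zeros of such a polynomial satisfies a
  relation and has mass of order R. A positive commutator turns this growth into a proof. The
  differential of the field \<open>L x / bracket L x\<close> is at least
  \<open>(L / bracket L x) ^ 3\<close>, hence bounded below on the ball of radius \<open>L\<close>,
  while its second derivatives are of size \<open>L / (bracket L x)^2\<close>. Against a mass of at
  most \<eta> R in each large ball this weight sums over dyadic shells to a multiple of \<eta> that
  is independent of \<open>L\<close> and of the dimension. The dimension enters only through the
  exponent \<open>p\<close>, when the growth of \<open>u\<close> is derived from the singular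
  values.\<close>

definition bracket :: "real \<Rightarrow> 'a::euclidean_space \<Rightarrow> real" where
  "bracket L x = sqrt (L^2 + (norm x)^2)"

text \<open>Inside the ball of radius \<open>R\<close> the vector field \<open>pot L R x *\<^sub>R x\<close> is \<open>L x / sqrt (L\<^sup>2 + |x|\<^sup>2)\<close>,
  which has a positive definite differential, minus a small multiple of \<open>x\<close> that makes it
  continuous when extended by 0.\<close>

definition pot :: "real \<Rightarrow> real \<Rightarrow> 'a::euclidean_space \<Rightarrow> real" where
  "pot L R x = max 0 (L / bracket L x - L / sqrt (L^2 + R^2))"

lemma bracket_ge:
  assumes "0 < L"
  shows "L \<le> bracket L x" "norm x \<le> bracket L x" "0 < bracket L x"
proof -
  show *: "L \<le> bracket L x" and "norm x \<le> bracket L x"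
    unfolding bracket_def using assms by (auto intro!: real_le_rsqrt)
  show "0 < bracket L x" using * assms by linarith
qed

lemma bracket_sq: "(bracket L x)^2 = L^2 + (norm x)^2"
  unfolding bracket_def by simp

lemma bracket_lipschitz: "\<bar>bracket L (x + a) - bracket L x\<bar> \<le> norm a"
proof -
  have *: "bracket L z = norm (L, z)" for z :: 'a
    by (simp add: bracket_def norm_Pair)
  have "\<bar>norm (L, x + a) - norm (L, x)\<bar> \<le> norm ((L, x + a) - (L, x))"
    by (rule norm_triangle_ineq3)
  then show ?thesis unfolding * by (simp add: norm_Pair)
qed

lemma bracket_diff_sq: "(bracket L (x + a))^2 - (bracket L x)^2 = 2 * (x \<bullet> a) + (norm a)^2"
  by (simp add: bracket_sq power2_norm_eq_inner inner_add_left inner_add_right inner_commute)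

lemma continuous_on_bracket [continuous_intros]:
  "continuous_on X f \<Longrightarrow> continuous_on X (\<lambda>x. bracket L (f x))"
  unfolding bracket_def by (intro continuous_intros)

lemma continuous_on_bracket_weight:
  assumes "0 < L" "continuous_on X w" shows "continuous_on X (\<lambda>x. L / (bracket L x)^2 * w x)"
  using less_imp_neq[OF bracket_ge(3)[OF assms(1)]]
  by (intro continuous_intros assms(2)) (auto simp: eq_commute[of 0])

section \<open>Taylor estimates for the truncated vector field\<close>

text \<open>First-order expansion of the reciprocal of \<open>bracket\<close>, with \<open>m\<close>
  and \<open>n\<close> its values at \<open>x + a\<close> and \<open>x\<close>, and
  \<open>s = x \<bullet> a\<close>. As \<open>s\<close> is half of \<open>m^2 - n^2\<close> up to
  \<open>\<alpha>\<close>, the remainder is an exact expression in \<open>(m - n)^2\<close> and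
  \<open>\<alpha>\<close>, so no derivative has to be taken.\<close>

lemma inverse_taylor:
  fixes m n s \<alpha> A :: real
  assumes "\<bar>m - n\<bar> \<le> A" "2 * A \<le> n" "0 < n" "m^2 - n^2 = 2 * s + \<alpha>" "0 \<le> \<alpha>" "\<alpha> \<le> A^2"
  shows "\<bar>1 / m - 1 / n + s / n ^ 3\<bar> \<le> 3 * A^2 / n ^ 3"
proof -
  have A: "0 \<le> A" using assms(1) by linarith
  have m: "n / 2 \<le> m" "0 < m" using assms by linarith+
  have s: "s = (m^2 - n^2 - \<alpha>) / 2" using assms(4) by simp
  have d: "(m - n)^2 \<le> A^2" using assms(1) A by (metis abs_le_square_iff abs_of_nonneg)
  have eq: "1 / m - 1 / n + s / n ^ 3
      = (m - n)^2 / (2 * n ^ 3) + (m - n)^2 / (n^2 * m) - \<alpha> / (2 * n ^ 3)"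
    unfolding s using m assms(3) by (simp add: field_simps power2_eq_square power3_eq_cube)
  have "(m - n)^2 / (2 * n ^ 3) \<le> A^2 / (2 * n ^ 3)"
    using d assms(3) by (intro divide_right_mono) auto
  moreover have "(m - n)^2 / (n^2 * m) \<le> A^2 / (n^2 * (n / 2))"
    using d assms(3) m by (intro frac_le mult_left_mono) auto
  moreover have "A^2 / (n^2 * (n / 2)) = 2 * A^2 / n ^ 3"
    by (simp add: power2_eq_square power3_eq_cube)
  moreover have "\<alpha> / (2 * n ^ 3) \<le> A^2 / (2 * n ^ 3)"
    using assms by (intro divide_right_mono) auto
  moreover have "0 \<le> \<alpha> / (2 * n ^ 3)" "0 \<le> (m - n)^2 / (2 * n ^ 3)" "0 \<le> (m - n)^2 / (n^2 * m)"
    using assms m by auto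
  moreover have "A^2 / (2 * n ^ 3) + A^2 / (2 * n ^ 3) = A^2 / n ^ 3" by simp
  moreover have "2 * A^2 / n ^ 3 + A^2 / n ^ 3 = 3 * A^2 / n ^ 3" "0 \<le> A^2 / n ^ 3" using assms(3) by (auto simp: field_simps)
  ultimately show ?thesis unfolding eq by linarith
qed

lemma pot_nonneg: "0 \<le> pot L R x"
  by (simp add: pot_def)

lemma continuous_on_pot [continuous_intros]:
  assumes "0 < L" shows "continuous_on X (pot L R)"
proof -
  have "bracket L x \<noteq> 0" for x :: 'a using bracket_ge(3)[OF assms, of x] by simp
  moreover have "sqrt (L^2 + R^2) \<noteq> 0" using assms by (simp add: sum_power2_eq_zero_iff)
  ultimately show ?thesis unfolding pot_def by (intro continuous_intros) auto
qed

lemma pot_eq_0: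
  assumes "0 < L" "0 \<le> R" "R \<le> norm x" shows "pot L R x = 0"
proof -
  have "sqrt (L^2 + R^2) \<le> bracket L x"
    unfolding bracket_def using assms by (simp add: power_mono)
  moreover have "0 < sqrt (L^2 + R^2)" using assms by (simp add: add_pos_nonneg)
  ultimately have "L / bracket L x \<le> L / sqrt (L^2 + R^2)" using assms by (intro frac_le) auto
  then show ?thesis by (simp add: pot_def)
qed

lemma pot_eq:
  assumes "0 < L" "norm x \<le> R" shows "pot L R x = L / bracket L x - L / sqrt (L^2 + R^2)"
proof -
  have "bracket L x \<le> sqrt (L^2 + R^2)"
    unfolding bracket_def using assms by (simp add: power_mono)
  then have "L / sqrt (L^2 + R^2) \<le> L / bracket L x"
    using assms bracket_ge(3)[OF assms(1)] by (intro frac_le) auto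
  then show ?thesis by (simp add: pot_def)
qed

text \<open>Besides the expansion of \<open>L / bracket\<close> there is a truncation error:
  \<open>x + a\<close> may leave the ball, where \<open>pot\<close> is cut off at 0 while the
  formula turns negative. As \<open>bracket\<close> changes by at most \<open>A\<close>, the
  overshoot is at most \<open>L * A / M^2\<close>.\<close>

lemma pot_shift_inside:
  assumes L: "0 < L" "2 * A \<le> L" and a: "norm a \<le> A" and x: "norm x \<le> R"
  defines "M \<equiv> sqrt (L^2 + R^2)"
  shows "\<bar>pot L R (x + a) - pot L R x + L * (x \<bullet> a) / bracket L x ^ 3\<bar>
    \<le> 3 * A^2 * L / bracket L x ^ 3 + L * A / M^2"
proof -
  let ?n = "bracket L x" and ?m = "bracket L (x + a)"
  have A: "0 \<le> A" using a norm_ge_zero[of a] by linarith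
  note n = bracket_ge[OF L(1), of x] and m = bracket_ge[OF L(1), of "x + a"]
  have R: "0 \<le> R" using x norm_ge_zero[of x] by linarith
  have nM: "?n \<le> M" unfolding bracket_def M_def using x by (simp add: power_mono)
  have M: "0 < M" using n nM by linarith
  have mn: "\<bar>?m - ?n\<bar> \<le> A" using bracket_lipschitz[of L x a] a by linarith
  have "\<bar>1 / ?m - 1 / ?n + (x \<bullet> a) / ?n ^ 3\<bar> \<le> 3 * A^2 / ?n ^ 3"
    using mn n L bracket_diff_sq[of L x a] a
    by (intro inverse_taylor[where \<alpha> = "(norm a)^2"]) (auto intro: power_mono)
  then have "L * \<bar>1 / ?m - 1 / ?n + (x \<bullet> a) / ?n ^ 3\<bar> \<le> L * (3 * A^2 / ?n ^ 3)"
    using L by (intro mult_left_mono) auto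
  moreover have "L * \<bar>1 / ?m - 1 / ?n + (x \<bullet> a) / ?n ^ 3\<bar> = \<bar>L * (1 / ?m - 1 / ?n + (x \<bullet> a) / ?n ^ 3)\<bar>"
    using L by (simp add: abs_mult)
  moreover have "L * (1 / ?m - 1 / ?n + (x \<bullet> a) / ?n ^ 3) = L / ?m - L / ?n + L * (x \<bullet> a) / ?n ^ 3"
    by (simp add: distrib_left right_diff_distrib)
  ultimately have 1: "\<bar>L / ?m - L / ?n + L * (x \<bullet> a) / ?n ^ 3\<bar> \<le> 3 * A^2 * L / ?n ^ 3"
    by (simp add: mult_ac)
  have 2: "\<bar>pot L R (x + a) - (L / ?m - L / M)\<bar> \<le> L * A / M^2"
  proof (cases "?m \<le> M")
    case True
    then have "L / M \<le> L / ?m" using m L by (intro frac_le) auto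
    then have "pot L R (x + a) = L / ?m - L / M" by (simp add: pot_def M_def)
    then show ?thesis using L A by simp
  next
    case False
    then have "L / ?m \<le> L / M" using M L by (intro frac_le) auto
    then have "\<bar>pot L R (x + a) - (L / ?m - L / M)\<bar> = L / M - L / ?m" by (simp add: pot_def M_def)
    also have "\<dots> = L * (?m - M) / (M * ?m)" using m M by (simp add: field_simps)
    also have "\<dots> \<le> L * A / (M * M)"
      using False L M mn nM by (intro frac_le mult_left_mono) auto
    finally show ?thesis by (simp add: power2_eq_square)
  qed
  have 3: "pot L R x = L / ?n - L / M" using pot_eq[OF L(1) x] by (simp add: M_def)
  show ?thesis using 1 2 unfolding 3 by linarith
qed

text \<open>A shift by \<open>a\<close> can reenter the ball only by \<open>A\<close>, where
  \<open>pot\<close> has risen to at most \<open>2 * L * A / M^2\<close>; the factor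
  \<open>norm (x + a)\<close> is then at most \<open>M\<close>.\<close>

lemma pot_shift_outside:
  assumes L: "0 < L" "2 * A \<le> L" and a: "norm a \<le> A" and x: "R \<le> norm x" "0 \<le> R"
  defines "M \<equiv> sqrt (L^2 + R^2)"
  shows "pot L R (x + a) * norm (x + a) \<le> 2 * L * A / M"
proof -
  let ?n = "bracket L x" and ?m = "bracket L (x + a)"
  have A: "0 \<le> A" using a norm_ge_zero[of a] by linarith
  note n = bracket_ge[OF L(1), of x] and m = bracket_ge[OF L(1), of "x + a"]
  have nM: "M \<le> ?n" unfolding bracket_def M_def using x by (simp add: power_mono)
  have LM: "L \<le> M" unfolding M_def using L by (auto intro!: real_le_rsqrt)
  have M: "0 < M" using L LM by linarith
  have mn: "\<bar>?m - ?n\<bar> \<le> A" using bracket_lipschitz[of L x a] a by linarith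
  have mM: "M / 2 \<le> ?m" using mn nM L LM by linarith
  show ?thesis
  proof (cases "?m \<le> M")
    case True
    then have "L / M \<le> L / ?m" using m L by (intro frac_le) auto
    then have "pot L R (x + a) = L / ?m - L / M" by (simp add: pot_def M_def)
    also have "\<dots> = L * (M - ?m) / (M * ?m)" using m M by (simp add: field_simps)
    also have "\<dots> \<le> L * A / (M * (M / 2))"
      using True L M mn nM mM A by (intro frac_le mult_left_mono mult_mono) auto
    finally have "pot L R (x + a) * norm (x + a) \<le> L * A / (M * (M / 2)) * M"
      using True m L A M by (intro mult_mono) (auto simp: pot_nonneg)
    then show ?thesis using M by (simp add: field_simps)
  next
    case False
    then have "L / ?m \<le> L / M" using M L by (intro frac_le) auto
    then have "pot L R (x + a) = 0" by (simp add: pot_def M_def)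
    then show ?thesis using L A M by simp
  qed
qed

text \<open>Inside the ball the left side is, to first order, the quadratic form of the differential
  of \<open>pot L R x *\<^sub>R x\<close> at the vector \<open>D\<close>. With
  \<open>n = bracket L x\<close> its smallest eigenvalue belongs to the direction \<open>x\<close>
  and is \<open>(L / n) ^ 3 - L / M\<close>. Everything else is an error of size
  \<open>L / n^2\<close> or \<open>L / M\<close>.\<close>

lemma virial_pointwise:
  fixes c U :: "'a::euclidean_space \<Rightarrow> complex" and x :: 'a
  assumes S: "finite S" "\<And>a. a \<in> S \<Longrightarrow> norm a \<le> A" "\<And>a. a \<in> S \<Longrightarrow> cmod (c a) \<le> C"
    and L: "0 < L" "2 * A \<le> L" and R: "0 \<le> R" and A: "1 \<le> A" and C: "0 \<le> C"
  defines "D \<equiv> \<lambda>e. \<Sum>a\<in>S. c a * of_real (a \<bullet> e) * U a"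
    and "W \<equiv> \<Sum>a\<in>S. cmod (U a)" and "M \<equiv> sqrt (L^2 + R^2)"
  shows "Re (\<Sum>i\<in>Basis. (\<Sum>a\<in>S. c a * U a * of_real (pot L R (x + a) * ((x + a) \<bullet> i) - pot L R x * (x \<bullet> i)))
            * cnj (D i))
    \<ge> (if norm x \<le> R then (L / bracket L x) ^ 3 * (\<Sum>i\<in>Basis. (cmod (D i))^2) else 0)
      - 10 * (real DIM('a))^2 * C^2 * A ^ 3 * W^2 * (L / (bracket L x)^2 + L / M)"
    (is "Re (\<Sum>i\<in>Basis. ?Z i * _) \<ge> _")
proof -
  define n where "n = bracket L x"
  note n = bracket_ge[OF L(1), of x, folded n_def]
  have M: "L \<le> M" "R \<le> M" "0 < M" unfolding M_def using L by (auto intro!: real_le_rsqrt real_sqrt_gt_zero add_pos_nonneg)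
  define P where "P = (\<Sum>i\<in>Basis. (cmod (D i))^2)"
  define d where "d = real DIM('a)"
  have d: "1 \<le> d" unfolding d_def using DIM_positive[where 'a='a] by linarith
  have W0: "0 \<le> W" unfolding W_def by (intro sum_nonneg) auto
  have Dle: "cmod (D e) \<le> C * A * W * norm e" for e
  proof -
    have "cmod (D e) \<le> (\<Sum>a\<in>S. cmod (c a * of_real (a \<bullet> e) * U a))" unfolding D_def by (rule norm_sum)
    also have "\<dots> \<le> (\<Sum>a\<in>S. C * (A * norm e) * cmod (U a))"
    proof (rule sum_mono)
      fix a assume a: "a \<in> S"
      have "\<bar>a \<bullet> e\<bar> \<le> A * norm e"
        using Cauchy_Schwarz_ineq2[of a e] S(2)[OF a] mult_right_mono[of "norm a" A "norm e"] by auto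
      then show "cmod (c a * of_real (a \<bullet> e) * U a) \<le> C * (A * norm e) * cmod (U a)"
        using S(3)[OF a] C A unfolding norm_mult by (intro mult_right_mono mult_mono) auto
    qed
    also have "\<dots> = C * A * W * norm e" unfolding W_def by (simp add: sum_distrib_left mult_ac)
    finally show ?thesis .
  qed
  have Di: "cmod (D i) \<le> C * A * W" if "i \<in> Basis" for i using Dle[of i] that by simp
  have CAW: "0 \<le> C * A * W" using C A W0 by simp
  have P0: "0 \<le> P" unfolding P_def by (intro sum_nonneg) auto
  have Ple: "P \<le> d * (C * A * W)^2"
  proof -
    have "P \<le> (\<Sum>i\<in>(Basis :: 'a set). (C * A * W)^2)" unfolding P_def using Di by (intro sum_mono power_mono) auto
    then show ?thesis by (simp add: d_def)
  qed
  have err: "cmod (\<Sum>i\<in>Basis. r i * cnj (D i)) \<le> d * (C^2 * A * W^2 * q)"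
    if "\<And>i. i \<in> Basis \<Longrightarrow> cmod (r i) \<le> C * W * q" for r q
  proof -
    have "cmod (\<Sum>i\<in>Basis. r i * cnj (D i)) \<le> (\<Sum>i\<in>(Basis::'a set). (C * W * q) * (C * A * W))"
    proof (rule order_trans[OF norm_sum sum_mono])
      fix i :: 'a assume i: "i \<in> Basis"
      have "0 \<le> C * W * q" using that[OF i] norm_ge_zero[of "r i"] by linarith
      then show "cmod (r i * cnj (D i)) \<le> (C * W * q) * (C * A * W)"
        unfolding norm_mult using that[OF i] Di[OF i] CAW by (intro mult_mono) auto
    qed
    then show ?thesis by (simp add: d_def power2_eq_square mult_ac)
  qed
  have sum_le: "cmod (\<Sum>a\<in>S. c a * U a * of_real (h a)) \<le> C * W * q" if "\<And>a. a \<in> S \<Longrightarrow> \<bar>h a\<bar> \<le> q" for h q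
  proof -
    have "cmod (\<Sum>a\<in>S. c a * U a * of_real (h a)) \<le> (\<Sum>a\<in>S. C * q * cmod (U a))"
    proof (rule order_trans[OF norm_sum sum_mono])
      fix a assume a: "a \<in> S"
      have "cmod (c a) * cmod (U a) * \<bar>h a\<bar> \<le> C * cmod (U a) * q"
        using S(3)[OF a] that[OF a] C by (intro mult_mono) auto
      then show "cmod (c a * U a * of_real (h a)) \<le> C * q * cmod (U a)" by (simp add: norm_mult mult_ac)
    qed
    then show ?thesis unfolding W_def by (simp add: sum_distrib_left mult_ac)
  qed
  have Ldiv: "0 \<le> L / n^2" "0 \<le> L / M" using L M by auto
  define B where "B = d^2 * C^2 * A ^ 3 * W^2"
  have B0: "0 \<le> B" unfolding B_def using A by simp
  have coef: "d * (C^2 * A * W^2 * (A ^ k)) \<le> B" if "k \<le> 2" for k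
  proof -
    have "d * (A * A ^ k) \<le> d^2 * A ^ 3"
      using d A that power_increasing[of "Suc k" 3 A] by (intro mult_mono) (auto simp: self_le_power)
    then have "d * (A * A ^ k) * (C^2 * W^2) \<le> d^2 * A ^ 3 * (C^2 * W^2)" by (intro mult_right_mono) auto
    then show ?thesis unfolding B_def by (simp add: mult_ac)
  qed
  show ?thesis
  proof (cases "norm x \<le> R")
    case True
    define e where "e a = pot L R (x + a) - pot L R x + L * (x \<bullet> a) / n ^ 3" for a
    have nM: "n \<le> M" unfolding n_def bracket_def M_def using True by (simp add: power_mono)
    have e: "\<bar>e a\<bar> \<le> 3 * A^2 * L / n ^ 3 + L * A / M^2" if "a \<in> S" for a
      using pot_shift_inside[OF L S(2)[OF that] True] by (simp add: e_def n_def M_def)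
    \<comment> \<open>The second-order terms: the linear change of \<open>pot\<close> times the
      shift \<open>a\<close>, and the error \<open>e a\<close> times the whole vector
      \<open>x + a\<close>.\<close>
    define r where "r i = (\<Sum>a\<in>S. c a * U a * of_real (- (L * (x \<bullet> a) / n ^ 3) * (a \<bullet> i) + e a * ((x + a) \<bullet> i)))" for i
    \<comment> \<open>7 = 1 + 6: the linear change of \<open>pot\<close> gives 1, and the constant 3
      in the bound on \<open>e a\<close> is doubled by
      \<open>\<bar>(x + a) \<bullet> i\<bar> \<le> 2 * n\<close>.\<close>
    define q where "q = 7 * A^2 * (L / n^2) + 2 * A * (L / M)"
    have rle: "cmod (r i) \<le> C * W * q" if i: "i \<in> Basis" for i
      unfolding r_def
    proof (rule sum_le)
      fix a assume a: "a \<in> S"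
      have ai: "\<bar>a \<bullet> i\<bar> \<le> A" using Basis_le_norm[OF i, of a] S(2)[OF a] by linarith
      have xa: "\<bar>x \<bullet> a\<bar> \<le> n * A"
        using Cauchy_Schwarz_ineq2[of x a] S(2)[OF a] n by (meson mult_mono norm_ge_zero order_trans less_imp_le)
      have xai: "\<bar>(x + a) \<bullet> i\<bar> \<le> 2 * n"
        using Basis_le_norm[OF i, of "x + a"] norm_triangle_ineq[of x a] S(2)[OF a] n L A by linarith
      have "\<bar>L * (x \<bullet> a) / n ^ 3 * (a \<bullet> i)\<bar> = L * \<bar>x \<bullet> a\<bar> / n ^ 3 * \<bar>a \<bullet> i\<bar>"
        using L n by (simp add: abs_mult)
      also have "\<dots> \<le> L * (n * A) / n ^ 3 * A"
        using xa ai L n A by (intro mult_mono divide_right_mono) auto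
      also have "\<dots> = A^2 * (L / n^2)" using n by (simp add: power2_eq_square power3_eq_cube)
      finally have 1: "\<bar>L * (x \<bullet> a) / n ^ 3 * (a \<bullet> i)\<bar> \<le> A^2 * (L / n^2)" .
      have "\<bar>e a * ((x + a) \<bullet> i)\<bar> \<le> (3 * A^2 * L / n ^ 3 + L * A / M^2) * (2 * n)"
        unfolding abs_mult using e[OF a] xai n by (intro mult_mono) auto
      also have "\<dots> = 6 * A^2 * (L / n^2) + 2 * (L * A / M^2) * n"
        using n M by (simp add: field_simps power2_eq_square power3_eq_cube)
      also have "2 * (L * A / M^2) * n \<le> 2 * (L * A / M^2) * M"
        using nM L A by (intro mult_left_mono) auto
      also have "\<dots> = 2 * A * (L / M)" using M by (simp add: power2_eq_square)
      finally have 2: "\<bar>e a * ((x + a) \<bullet> i)\<bar> \<le> 6 * A^2 * (L / n^2) + 2 * A * (L / M)" by simp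
      show "\<bar>- (L * (x \<bullet> a) / n ^ 3) * (a \<bullet> i) + e a * ((x + a) \<bullet> i)\<bar> \<le> q"
      proof -
        have "q = A^2 * (L / n^2) + (6 * A^2 * (L / n^2) + 2 * A * (L / M))" unfolding q_def by simp
        moreover have "- (L * (x \<bullet> a) / n ^ 3) * (a \<bullet> i) = - (L * (x \<bullet> a) / n ^ 3 * (a \<bullet> i))" by simp
        ultimately show ?thesis using 1 2 by linarith
      qed
    qed
    have Dx: "D x = (\<Sum>i\<in>Basis. of_real (x \<bullet> i) * D i)"
    proof -
      have "D x = (\<Sum>a\<in>S. \<Sum>i\<in>Basis. c a * of_real (a \<bullet> i) * of_real (x \<bullet> i) * U a)"
        unfolding D_def by (intro sum.cong refl, subst euclidean_inner)
          (simp add: sum_distrib_left sum_distrib_right mult_ac)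
      also have "\<dots> = (\<Sum>i\<in>Basis. of_real (x \<bullet> i) * D i)"
        by (subst sum.swap) (simp add: D_def sum_distrib_left mult_ac)
      finally show ?thesis .
    qed
    have DxP: "(cmod (D x))^2 \<le> (norm x)^2 * P"
    proof -
      have "cmod (D x) \<le> (\<Sum>i\<in>Basis. \<bar>x \<bullet> i\<bar> * cmod (D i))"
        unfolding Dx by (rule order_trans[OF norm_sum]) (simp add: norm_mult)
      then have "(cmod (D x))^2 \<le> (\<Sum>i\<in>Basis. \<bar>x \<bullet> i\<bar> * cmod (D i))^2" by (intro power_mono) auto
      also have "\<dots> \<le> (\<Sum>i\<in>Basis. \<bar>x \<bullet> i\<bar>\<^sup>2) * (\<Sum>i\<in>Basis. (cmod (D i))^2)"
        by (rule Cauchy_Schwarz_ineq_sum)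
      also have "(\<Sum>i\<in>Basis. \<bar>x \<bullet> i\<bar>\<^sup>2) = (norm x)^2"
        unfolding power2_norm_eq_inner euclidean_inner[of x x] by (simp add: power2_eq_square)
      finally show ?thesis by (simp add: P_def)
    qed
    \<comment> \<open>The first two terms are the differential of the field applied to the vector
      \<open>D\<close>: a multiple of the identity minus a rank-one part along \<open>x\<close>, in
      which \<open>D x\<close> is the inner product of that vector with \<open>x\<close>.\<close>
    have Z: "?Z i = of_real (pot L R x) * D i - of_real (L / n ^ 3) * of_real (x \<bullet> i) * D x + r i" if "i \<in> Basis" for i
    proof -
      have "c a * U a * of_real (pot L R (x + a) * ((x + a) \<bullet> i) - pot L R x * (x \<bullet> i))
          = of_real (pot L R x) * (c a * of_real (a \<bullet> i) * U a)
            - of_real (L / n ^ 3) * of_real (x \<bullet> i) * (c a * of_real (a \<bullet> x) * U a)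
            + c a * U a * of_real (- (L * (x \<bullet> a) / n ^ 3) * (a \<bullet> i) + e a * ((x + a) \<bullet> i))" for a
      proof -
        have "pot L R (x + a) = pot L R x - L * (x \<bullet> a) / n ^ 3 + e a"
          by (simp add: e_def)
        have *: "pot L R (x + a) * ((x + a) \<bullet> i) - pot L R x * (x \<bullet> i)
           = pot L R x * (a \<bullet> i) - (L / n ^ 3) * (x \<bullet> i) * (a \<bullet> x)
             + (- (L * (x \<bullet> a) / n ^ 3) * (a \<bullet> i) + e a * ((x + a) \<bullet> i))"
          unfolding \<open>pot L R (x + a) = _\<close> by (simp add: inner_add_left inner_commute[of x a] algebra_simps add_divide_distrib)
        show ?thesis unfolding * of_real_add of_real_diff of_real_mult by (simp only: algebra_simps)
      qed
      then show ?thesis unfolding r_def D_def by (simp add: sum.distrib sum_subtractf sum_distrib_left)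
    qed
    have "(\<Sum>i\<in>Basis. ?Z i * cnj (D i)) =
        (\<Sum>i\<in>Basis. of_real (pot L R x) * (D i * cnj (D i)) - of_real (L / n ^ 3) * D x * cnj (of_real (x \<bullet> i) * D i) + r i * cnj (D i))"
      by (intro sum.cong refl) (subst Z, auto simp: algebra_simps)
    also have "\<dots> = of_real (pot L R x) * (\<Sum>i\<in>Basis. D i * cnj (D i))
        - of_real (L / n ^ 3) * D x * cnj (D x) + (\<Sum>i\<in>Basis. r i * cnj (D i))"
      unfolding Dx cnj_sum by (simp add: sum.distrib sum_subtractf sum_distrib_left)
    also have "(\<Sum>i\<in>Basis. D i * cnj (D i)) = of_real P"
      unfolding P_def of_real_sum by (intro sum.cong refl) (simp add: complex_norm_square del: of_real_power)
    finally have T: "(\<Sum>i\<in>Basis. ?Z i * cnj (D i)) =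
      of_real (pot L R x * P - L / n ^ 3 * (cmod (D x))^2) + (\<Sum>i\<in>Basis. r i * cnj (D i))"
      by (simp add: complex_norm_square mult.assoc del: of_real_power)
    have ReT: "Re (\<Sum>i\<in>Basis. ?Z i * cnj (D i)) \<ge> pot L R x * P - L / n ^ 3 * (cmod (D x))^2 - d * (C^2 * A * W^2 * q)"
      using err[of r q, OF rle] abs_Re_le_cmod[of "\<Sum>i\<in>Basis. r i * cnj (D i)"] unfolding T by simp
    have "L / n ^ 3 * (cmod (D x))^2 \<le> L / n ^ 3 * ((norm x)^2 * P)" using DxP L n by (intro mult_left_mono) auto
    \<comment> \<open>The eigenvalue along \<open>x\<close>:
      \<open>L / n - L * (norm x)^2 / n ^ 3\<close> equals \<open>(L / n) ^ 3\<close> because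
      \<open>n^2 - (norm x)^2 = L^2\<close>.\<close>
    moreover have "pot L R x * P - L / n ^ 3 * ((norm x)^2 * P) = (L / n) ^ 3 * P - L / M * P"
    proof -
      have nx: "(norm x)^2 = n^2 - L^2" unfolding n_def bracket_sq by simp
      have "pot L R x - L / n ^ 3 * (norm x)^2 = (L / n) ^ 3 - L / M"
        unfolding pot_eq[OF L(1) True] nx M_def[symmetric] n_def[symmetric]
        using n M by (simp add: field_simps power2_eq_square power3_eq_cube)
      then show ?thesis by (metis left_diff_distrib mult.assoc)
    qed
    moreover have "L / M * P \<le> L / M * B"
    proof (rule mult_left_mono)
      have *: "d * (C * A * W)^2 = d * (C^2 * A * W^2 * A ^ 1)" by (simp add: power2_eq_square mult_ac)
      show "P \<le> B" by (intro order_trans[OF Ple[unfolded *] coef]) simp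
    qed (use Ldiv in auto)
    moreover have "d * (C^2 * A * W^2 * q) \<le> B * (7 * (L / n^2) + 2 * (L / M))"
    proof -
      have "d * (C^2 * A * W^2 * q) = d * (C^2 * A * W^2 * A ^ 2) * (7 * (L / n^2)) + d * (C^2 * A * W^2 * A ^ 1) * (2 * (L / M))"
        unfolding q_def by (simp add: algebra_simps)
      also have "\<dots> \<le> B * (7 * (L / n^2)) + B * (2 * (L / M))"
        using coef[of 2] coef[of 1] Ldiv by (intro add_mono mult_right_mono) auto
      finally show ?thesis by (simp add: distrib_left)
    qed
    \<comment> \<open>The 10 absorbs 7 for \<open>L / n^2\<close> and 2 + 1 for
      \<open>L / M\<close>, the 1 being the price of the subtracted multiple of
      \<open>x\<close>.\<close>
    moreover have "B * (7 * s + 2 * t) + t * B \<le> 10 * B * (s + t)" if "0 \<le> B * s" "0 \<le> B * t" for s t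
      using that by (simp add: algebra_simps)
    note this[OF mult_nonneg_nonneg[OF B0 Ldiv(1)] mult_nonneg_nonneg[OF B0 Ldiv(2)]]
    ultimately have "Re (\<Sum>i\<in>Basis. ?Z i * cnj (D i)) \<ge> (L / n) ^ 3 * P - 10 * B * (L / n^2 + L / M)"
      using ReT by linarith
    then show ?thesis using True unfolding B_def P_def n_def d_def by (simp add: mult_ac)
  next
    case False
    \<comment> \<open>Outside the ball only those points \<open>x + a\<close> contribute that fall
      back into it.\<close>
    have p0: "pot L R x = 0" using pot_eq_0[OF L(1) R, of x] False by simp
    define q where "q = 2 * A * (L / M)"
    have "cmod (?Z i) \<le> C * W * q" if i: "i \<in> Basis" for i
    proof (rule sum_le)
      fix a assume a: "a \<in> S"
      have "\<bar>pot L R (x + a) * ((x + a) \<bullet> i)\<bar> \<le> pot L R (x + a) * norm (x + a)"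
        unfolding abs_mult using Basis_le_norm[OF i, of "x + a"] by (intro mult_mono) (auto simp: pot_nonneg)
      also have "\<dots> \<le> 2 * L * A / M"
        using pot_shift_outside[OF L S(2)[OF a] _ R, of x] False by (simp add: M_def)
      finally show "\<bar>pot L R (x + a) * ((x + a) \<bullet> i) - pot L R x * (x \<bullet> i)\<bar> \<le> q" by (simp add: p0 q_def mult_ac)
    qed
    then have "cmod (\<Sum>i\<in>Basis. ?Z i * cnj (D i)) \<le> d * (C^2 * A * W^2 * q)" by (rule err)
    also have "\<dots> = d * (C^2 * A * W^2 * A ^ 1) * (2 * (L / M))" by (simp add: q_def)
    also have "\<dots> \<le> B * (2 * (L / M))" using coef[of 1] Ldiv by (intro mult_right_mono) auto
    also have "\<dots> \<le> B * (10 * (L / n^2 + L / M))"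
      using B0 Ldiv by (intro mult_left_mono) auto
    also have "\<dots> = 10 * B * (L / n^2 + L / M)" by simp
    finally have "Re (\<Sum>i\<in>Basis. ?Z i * cnj (D i)) \<ge> - (10 * B * (L / n^2 + L / M))"
      using abs_Re_le_cmod[of "\<Sum>i\<in>Basis. ?Z i * cnj (D i)"] by linarith
    then show ?thesis using False unfolding B_def n_def d_def by (simp add: mult_ac)
  qed
qed

section \<open>Integrals over balls and their behaviour under translation\<close>

definition ball_int :: "('a::euclidean_space \<Rightarrow> real) \<Rightarrow> real \<Rightarrow> real" where
  "ball_int h R = (LBINT x. indicator (cball 0 R) x * h x)"

lemma integrable_ball:
  fixes h :: "'a::euclidean_space \<Rightarrow> real"
  assumes "continuous_on UNIV h"
  shows "integrable lborel (\<lambda>x. indicator (cball 0 R) x * h x)"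
  using borel_integrable_compact[OF compact_cball continuous_on_subset[OF assms], of 0 R] by simp

lemma continuous_on_shift:
  fixes f :: "'a::real_normed_vector \<Rightarrow> 'b::topological_space"
  shows "continuous_on UNIV f \<Longrightarrow> continuous_on UNIV (\<lambda>x. f (x + a))"
  by (rule continuous_on_compose2[where t = UNIV]) (auto intro: continuous_intros)

lemma integrable_compact_support:
  fixes h :: "'a::euclidean_space \<Rightarrow> 'b::{banach, second_countable_topology}"
  assumes "continuous_on UNIV h" "\<And>x. R < norm x \<Longrightarrow> h x = 0"
  shows "integrable lborel h"
proof -
  have "(\<lambda>x. indicator (cball 0 R) x *\<^sub>R h x) = h"
    using assms(2) by (force simp: fun_eq_iff indicator_def)
  then show ?thesis
    using borel_integrable_compact[OF compact_cball continuous_on_subset[OF assms(1)], of 0 R] by simp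
qed

lemma lborel_integral_shift:
  fixes h :: "'a::euclidean_space \<Rightarrow> 'b::{banach, second_countable_topology}"
  assumes "h \<in> borel_measurable borel"
  shows "(LBINT x. h (x + a)) = (LBINT x. h x)"
proof -
  have "(LBINT x. h x) = (LINT x|distr lborel borel ((+) a). h x)" by (simp only: lborel_distr_plus)
  also have "\<dots> = (LBINT x. h (a + x))" using assms by (intro integral_distr) auto
  finally show ?thesis by (simp add: add.commute)
qed

lemma lborel_integrable_shift:
  fixes h :: "'a::euclidean_space \<Rightarrow> 'b::{banach, second_countable_topology}"
  assumes "integrable lborel h"
  shows "integrable lborel (\<lambda>x. h (x + a))"
proof -
  have [measurable]: "h \<in> borel_measurable borel" using borel_measurable_integrable[OF assms] by simp
  have "integrable (distr lborel borel ((+) a)) h" using assms by (simp only: lborel_distr_plus)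
  then have "integrable lborel (\<lambda>x. h (a + x))" by (subst (asm) integrable_distr_eq) measurable
  then show ?thesis by (simp add: add.commute)
qed

lemma lborel_nn_integral_shift:
  fixes h :: "'a::euclidean_space \<Rightarrow> ennreal"
  assumes [measurable]: "h \<in> borel_measurable borel"
  shows "(\<integral>\<^sup>+x. h (x + a) \<partial>lborel) = (\<integral>\<^sup>+x. h x \<partial>lborel)"
proof -
  have "(\<integral>\<^sup>+x. h x \<partial>lborel) = (\<integral>\<^sup>+x. h x \<partial>distr lborel borel ((+) a))" by (simp only: lborel_distr_plus)
  also have "\<dots> = (\<integral>\<^sup>+x. h (a + x) \<partial>lborel)" by (intro nn_integral_distr) measurable
  finally show ?thesis by (simp add: add.commute)
qed

lemma ball_int_mono:
  assumes "continuous_on UNIV h" "continuous_on UNIV g" "\<And>x. norm x \<le> R \<Longrightarrow> h x \<le> g x"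
  shows "ball_int h R \<le> ball_int g R"
  unfolding ball_int_def
  by (rule integral_mono[OF integrable_ball[OF assms(1)] integrable_ball[OF assms(2)]])
    (use assms(3) in \<open>auto simp: indicator_def\<close>)

lemma ball_int_mono_radius:
  assumes "continuous_on UNIV h" "\<And>x. 0 \<le> h x" "R \<le> R'"
  shows "ball_int h R \<le> ball_int h R'"
  unfolding ball_int_def
  by (rule integral_mono[OF integrable_ball[OF assms(1)] integrable_ball[OF assms(1)]])
    (use assms(2,3) in \<open>auto simp: indicator_def\<close>)

lemma ball_int_nonneg: "(\<And>x. 0 \<le> h x) \<Longrightarrow> 0 \<le> ball_int h R"
  unfolding ball_int_def by (intro integral_nonneg_AE) auto

lemma ball_int_sum:
  assumes "\<And>a. a \<in> S \<Longrightarrow> continuous_on UNIV (h a)"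
  shows "ball_int (\<lambda>x. \<Sum>a\<in>S. h a x) R = (\<Sum>a\<in>S. ball_int (h a) R)"
  unfolding ball_int_def sum_distrib_left
  by (rule Bochner_Integration.integral_sum) (rule integrable_ball[OF assms])

lemma ball_int_cmult: "ball_int (\<lambda>x. k * h x) R = k * ball_int h R"
proof -
  have "(\<lambda>x. indicator (cball 0 R) x * (k * h x)) = (\<lambda>x. k * (indicator (cball 0 R) x * h x))"
    by (simp add: fun_eq_iff mult_ac)
  then show ?thesis unfolding ball_int_def by simp
qed

lemma ball_int_add:
  assumes "continuous_on UNIV h" "continuous_on UNIV g"
  shows "ball_int (\<lambda>x. h x + g x) R = ball_int h R + ball_int g R"
  unfolding ball_int_def distrib_left
  by (rule Bochner_Integration.integral_add) (rule integrable_ball[OF assms(1)], rule integrable_ball[OF assms(2)])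

lemma ball_int_shift:
  fixes h :: "'a::euclidean_space \<Rightarrow> real"
  assumes h: "continuous_on UNIV h" "\<And>x. 0 \<le> h x"
  shows "ball_int (\<lambda>x. h (x + a)) R \<le> ball_int h (R + norm a)"
proof -
  have h': "continuous_on UNIV (\<lambda>x. h (x + a))"
    using h(1) by (rule continuous_on_shift)
  note i = integrable_ball[OF h(1), of "R + norm a"]
  have le: "norm (x + a) \<le> R + norm a" if "norm x \<le> R" for x using norm_triangle_ineq[of x a] that by linarith
  have "ball_int (\<lambda>x. h (x + a)) R \<le> (LBINT x. (\<lambda>x. indicator (cball 0 (R + norm a)) x * h x) (x + a))"
    unfolding ball_int_def
  proof (rule integral_mono[OF integrable_ball[OF h']])
    show "integrable lborel (\<lambda>x. indicator (cball 0 (R + norm a)) (x + a) * h (x + a))"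
      using i by (rule lborel_integrable_shift)
  qed (use h(2) le in \<open>auto simp: indicator_def\<close>)
  also have "\<dots> = ball_int h (R + norm a)"
    unfolding ball_int_def by (rule lborel_integral_shift) (use borel_measurable_integrable[OF i] in simp)
  finally show ?thesis .
qed

lemma ball_int_zero_imp:
  fixes h :: "'a::euclidean_space \<Rightarrow> real"
  assumes h: "continuous_on UNIV h" "\<And>x. 0 \<le> h x" and 0: "ball_int h R \<le> 0" and x: "norm x < R"
  shows "h x = 0"
proof (rule ccontr)
  assume "h x \<noteq> 0"
  then have pos: "0 < h x" using h(2)[of x] by linarith
  have "isCont h x" using h(1) by (simp add: continuous_on_eq_continuous_at)
  then obtain \<delta> where \<delta>: "\<delta> > 0" "\<And>y. dist y x < \<delta> \<Longrightarrow> dist (h y) (h x) < h x / 2"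
    using pos unfolding continuous_at_eps_delta by (metis half_gt_zero)
  define r where "r = min \<delta> (R - norm x)"
  have r: "r > 0" using \<delta> x by (simp add: r_def)
  have "h x / 2 * measure lborel (ball x r) = (LBINT y. indicator (ball x r) y * (h x / 2))"
    by simp
  also have "\<dots> \<le> ball_int h R"
    unfolding ball_int_def
  proof (rule integral_mono[OF _ integrable_ball[OF h(1)]])
    show "integrable lborel (\<lambda>y. indicator (ball x r) y * (h x / 2))"
      using emeasure_bounded_finite[OF bounded_ball, of x r] by simp
    fix y
    show "indicator (ball x r) y * (h x / 2) \<le> indicator (cball 0 R) y * h y"
    proof (cases "y \<in> ball x r")
      case True
      then have "dist y x < \<delta>" "norm y \<le> R"
        using norm_triangle_ineq[of x "y - x"] by (auto simp: r_def dist_norm norm_minus_commute)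
      then have "h x / 2 \<le> h y" using \<delta>(2)[of y] unfolding dist_real_def by linarith
      then show ?thesis using \<open>norm y \<le> R\<close> True by simp
    qed (use h(2) in \<open>auto simp: indicator_def\<close>)
  qed
  finally have "h x / 2 * measure lborel (ball x r) \<le> 0" using 0 by linarith
  moreover have "0 < measure lborel (ball x r)" using content_ball_pos[OF r] by simp
  ultimately show False using pos by (simp add: mult_le_0_iff)
qed

section \<open>The virial identity and the limit of large radii\<close>

text \<open>Since \<open>Q u = 0\<close>, the commutator \<open>[Q, f] u\<close> is
  \<open>Q (f u)\<close>. Self-adjointness moves \<open>Q\<close> onto \<open>Q\<^sub>e u\<close>,
  and \<open>Q Q\<^sub>e u = Q\<^sub>e Q u = 0\<close> because translations commute. The compact
  support of \<open>f\<close> makes these pairings integrable without any decay of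
  \<open>u\<close>.\<close>

lemma virial_identity:
  fixes u c :: "'a::euclidean_space \<Rightarrow> complex" and f :: "'a \<Rightarrow> real" and e :: 'a
  assumes u: "continuous_on UNIV u" and f: "continuous_on UNIV f" "\<And>x. R < norm x \<Longrightarrow> f x = 0"
    and S: "finite S" "\<And>a. a \<in> S \<Longrightarrow> -a \<in> S" "\<And>a. a \<in> S \<Longrightarrow> c (-a) = cnj (c a)"
    and z: "\<And>x. (\<Sum>a\<in>S. c a * u (x + a)) = 0"
  defines "G \<equiv> \<lambda>x. \<Sum>a\<in>S. c a * of_real (a \<bullet> e) * u (x + a)"
  defines "T \<equiv> \<lambda>x. (\<Sum>a\<in>S. c a * u (x + a) * of_real (f (x + a) - f x)) * cnj (G x)"
  shows "integrable lborel T" "(LBINT x. T x) = 0"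
proof -
  have cu: "continuous_on UNIV (\<lambda>x. u (x + a))" for a
    using u by (rule continuous_on_shift)
  have cf: "continuous_on UNIV (\<lambda>x. f (x + a))" for a
    using f(1) by (rule continuous_on_shift)
  have G: "continuous_on UNIV G" unfolding G_def by (intro continuous_intros cu)
  have cG: "continuous_on UNIV (\<lambda>x. G (x + a))" for a
    using G by (rule continuous_on_shift)
  \<comment> \<open>Moving the summand for \<open>a\<close> back by \<open>a\<close> takes the shift
    off \<open>f\<close> and \<open>u\<close> and puts it on \<open>G\<close>.\<close>
  define H where "H a x = c a * of_real (f x) * u x * cnj (G (x + - a))" for a x
  have cH: "continuous_on UNIV (H a)" for a unfolding H_def by (intro continuous_intros f u cG)
  have iH: "integrable lborel (H a)" for a
    by (rule integrable_compact_support[OF cH, of R]) (simp add: H_def f)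
  have mH: "H a \<in> borel_measurable borel" for a using cH by (rule borel_measurable_continuous_onI)
  have T: "T x = (\<Sum>a\<in>S. H a (x + a))" for x
  proof -
    have "(\<Sum>a\<in>S. c a * u (x + a) * of_real (f (x + a) - f x))
        = (\<Sum>a\<in>S. c a * u (x + a) * of_real (f (x + a))) - (\<Sum>a\<in>S. c a * u (x + a)) * of_real (f x)"
      by (simp add: algebra_simps sum_subtractf sum_distrib_left)
    then have "(\<Sum>a\<in>S. c a * u (x + a) * of_real (f (x + a) - f x)) = (\<Sum>a\<in>S. c a * u (x + a) * of_real (f (x + a)))"
      by (simp only: z) simp
    then show ?thesis unfolding T_def H_def by (simp add: sum_distrib_left sum_distrib_right mult_ac)
  qed
  have iHs: "integrable lborel (\<lambda>x. H a (x + a))" for a by (rule lborel_integrable_shift[OF iH])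
  show "integrable lborel T" unfolding T by (rule Bochner_Integration.integrable_sum) (rule iHs)
  have "(LBINT x. T x) = (\<Sum>a\<in>S. (LBINT x. H a (x + a)))"
    unfolding T by (rule Bochner_Integration.integral_sum) (rule iHs)
  also have "\<dots> = (\<Sum>a\<in>S. (LBINT x. H a x))" by (simp add: lborel_integral_shift[OF mH])
  also have "\<dots> = (LBINT x. (\<Sum>a\<in>S. H a x))" by (rule Bochner_Integration.integral_sum[symmetric]) (rule iH)
  also have "(\<lambda>x. \<Sum>a\<in>S. H a x) = (\<lambda>x. 0)"
  proof
    fix x
    \<comment> \<open>Hermitian symmetry turns the adjoint of \<open>Q\<close> into
      \<open>Q\<close>; the exchange of sums further down is the commutation of \<open>Q\<close>
      with \<open>Q\<^sub>e\<close>.\<close>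
    have "(\<Sum>a\<in>S. cnj (c a) * G (x + - a)) = (\<Sum>a\<in>S. c a * G (x + a))"
      by (rule sum.reindex_bij_witness[of _ uminus uminus]) (use S in auto)
    also have "\<dots> = (\<Sum>a\<in>S. \<Sum>b\<in>S. (c b * of_real (b \<bullet> e)) * (c a * u (x + b + a)))"
      unfolding G_def by (simp add: sum_distrib_left mult_ac add_ac)
    also have "\<dots> = (\<Sum>b\<in>S. (c b * of_real (b \<bullet> e)) * (\<Sum>a\<in>S. c a * u (x + b + a)))"
      by (subst sum.swap) (simp add: sum_distrib_left)
    also have "\<dots> = 0" by (simp add: z)
    finally have "cnj (\<Sum>a\<in>S. cnj (c a) * G (x + - a)) = 0" by simp
    then have "of_real (f x) * u x * (\<Sum>a\<in>S. c a * cnj (G (x + - a))) = 0" by simp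
    then show "(\<Sum>a\<in>S. H a x) = 0" unfolding H_def by (simp add: sum_distrib_left mult_ac)
  qed
  finally show "(LBINT x. T x) = 0" by simp
qed

text \<open>On the shell between \<open>2 ^ k * L\<close> and \<open>2 ^ (k + 1) * L\<close> the
  weight is at most \<open>1 / (4 ^ k * L)\<close>. If the mass of \<open>w\<close> in balls of
  radius \<open>R \<ge> L\<close> is at most \<open>\<eta> * R\<close>, the sum is geometric and
  \<open>L\<close> cancels, leaving a multiple of \<open>\<eta>\<close>.\<close>

lemma ball_int_dyadic:
  fixes w :: "'a::euclidean_space \<Rightarrow> real"
  assumes L: "0 < L" and w: "continuous_on UNIV w" "\<And>x. 0 \<le> w x"
  shows "ball_int (\<lambda>x. L / (bracket L x)^2 * w x) (2 ^ m * L)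
    \<le> (ball_int w L + (\<Sum>k<m. ball_int w (2 ^ (k + 1) * L) / 4 ^ k)) / L"
proof (induction m)
  have c: "continuous_on UNIV (\<lambda>x. L / (bracket L x)^2 * w x)"
    by (rule continuous_on_bracket_weight[OF L w(1)])
  have nn: "0 \<le> L / (bracket L x)^2 * w x" for x using L w by simp
  {
    case 0
    have "ball_int (\<lambda>x. L / (bracket L x)^2 * w x) L \<le> ball_int (\<lambda>x. 1 / L * w x) L"
    proof (rule ball_int_mono[OF c])
      fix x :: 'a
      have "L^2 \<le> (bracket L x)^2" using bracket_ge[OF L, of x] L by (intro power_mono) auto
      then have "L / (bracket L x)^2 \<le> L / L^2" using L by (intro frac_le) auto
      then show "L / (bracket L x)^2 * w x \<le> 1 / L * w x"
        using L w(2)[of x] by (intro mult_right_mono) (auto simp: power2_eq_square)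
    qed (intro continuous_intros w)
    then show ?case by (simp only: ball_int_cmult) simp
  next
    case (Suc m)
    let ?R = "2 ^ m * L"
    have R: "0 < ?R" using L by simp
    have "ball_int (\<lambda>x. L / (bracket L x)^2 * w x) (2 ^ Suc m * L) \<le>
        ball_int (\<lambda>x. L / (bracket L x)^2 * w x) ?R + L / ?R^2 * ball_int w (2 ^ Suc m * L)"
    proof -
      have "ball_int (\<lambda>x. L / (bracket L x)^2 * w x) (2 ^ Suc m * L) \<le>
        (LBINT x. indicator (cball 0 ?R) x * (L / (bracket L x)^2 * w x)
           + indicator (cball 0 (2 ^ Suc m * L)) x * (L / ?R^2 * w x))"
        unfolding ball_int_def
      proof (rule integral_mono[OF integrable_ball[OF c]])
        show "integrable lborel (\<lambda>x. indicator (cball 0 ?R) x * (L / (bracket L x)^2 * w x)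
           + indicator (cball 0 (2 ^ Suc m * L)) x * (L / ?R^2 * w x))"
          by (intro Bochner_Integration.integrable_add integrable_ball[OF c] integrable_ball continuous_intros w)
        fix x :: 'a
        show "indicator (cball 0 (2 ^ Suc m * L)) x * (L / (bracket L x)^2 * w x)
          \<le> indicator (cball 0 ?R) x * (L / (bracket L x)^2 * w x)
           + indicator (cball 0 (2 ^ Suc m * L)) x * (L / ?R^2 * w x)"
        proof (cases "norm x \<le> ?R")
          case True
          then show ?thesis using nn[of x] L w(2)[of x] by (auto simp: indicator_def)
        next
          case False
          then have "?R \<le> bracket L x" using bracket_ge[OF L, of x] by linarith
          then have "?R^2 \<le> (bracket L x)^2" using R by (intro power_mono) auto
          then have "L / (bracket L x)^2 * w x \<le> L / ?R^2 * w x"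
            using L R w(2)[of x] by (intro mult_right_mono frac_le zero_less_power) auto
          then show ?thesis using False by (auto simp: indicator_def)
        qed
      qed
      also have "\<dots> = ball_int (\<lambda>x. L / (bracket L x)^2 * w x) ?R + ball_int (\<lambda>x. L / ?R^2 * w x) (2 ^ Suc m * L)"
        unfolding ball_int_def
        by (intro Bochner_Integration.integral_add integrable_ball[OF c] integrable_ball continuous_intros w)
      finally show ?thesis by (simp only: ball_int_cmult)
    qed
    also have "L / ?R^2 = 1 / 4 ^ m / L"
      using L by (simp add: power2_eq_square power_mult_distrib[symmetric])
    finally show ?case using Suc by (simp add: add_divide_distrib)
  }
qed

text \<open>The parameters are chosen in the order \<open>\<eta>\<close>, \<open>L\<close>,
  \<open>R\<close>: \<open>L\<close> such that the mass is at most \<open>\<eta> * R\<close> in all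
  balls of radius \<open>R \<ge> L\<close>, then \<open>R\<close> such that \<open>L / R\<close>
  times the mass is at most \<open>\<eta>\<close>. The ball of radius \<open>r0\<close> on which
  \<open>Q\<^sub>e u\<close> is tested stays fixed.\<close>

lemma virial_derivative:
  fixes u c :: "'a::euclidean_space \<Rightarrow> complex"
  assumes u: "continuous_on UNIV u"
    and growth: "((\<lambda>R. ball_int (\<lambda>x. (cmod (u x))^2) R / R) \<longlongrightarrow> 0) at_top"
    and S: "finite S" "\<And>a. a \<in> S \<Longrightarrow> -a \<in> S" "\<And>a. a \<in> S \<Longrightarrow> c (-a) = cnj (c a)"
    and z: "\<And>x. (\<Sum>a\<in>S. c a * u (x + a)) = 0"
  shows "(\<Sum>a\<in>S. c a * of_real (a \<bullet> e) * u (x + a)) = 0"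
proof -
  define D where "D x e = (\<Sum>a\<in>S. c a * of_real (a \<bullet> e) * u (x + a))" for x e
  define A where "A = (\<Sum>a\<in>S. norm a) + 1"
  define C where "C = (\<Sum>a\<in>S. cmod (c a))"
  have A: "1 \<le> A" unfolding A_def by (simp add: sum_nonneg)
  have C: "0 \<le> C" unfolding C_def by (simp add: sum_nonneg)
  have aA: "norm a \<le> A" if "a \<in> S" for a
    unfolding A_def using member_le_sum[OF that _ S(1), of norm] by simp
  have cC: "cmod (c a) \<le> C" if "a \<in> S" for a
    unfolding C_def using member_le_sum[OF that _ S(1), of "\<lambda>a. cmod (c a)"] by simp
  \<comment> \<open>The \<open>W^2\<close> of the pointwise bound. Its mass is compared with that of
    \<open>|u|^2\<close> in the doubled ball, so the growth o(R) survives.\<close>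
  define w where "w x = (\<Sum>a\<in>S. cmod (u (x + a)))^2" for x
  define P where "P x = (\<Sum>i\<in>Basis. (cmod (D x i))^2)" for x
  have w: "continuous_on UNIV w" unfolding w_def by (intro continuous_intros continuous_on_shift u)
  have w0: "0 \<le> w x" for x unfolding w_def by simp
  have P: "continuous_on UNIV P" unfolding P_def D_def by (intro continuous_intros continuous_on_shift u)
  have P0: "0 \<le> P x" for x unfolding P_def by (intro sum_nonneg) auto
  define K where "K = 10 * (real DIM('a))^2 * C^2 * A ^ 3"
  have K: "0 \<le> K" unfolding K_def using A by simp
  have w_growth: "((\<lambda>R. ball_int w R / R) \<longlongrightarrow> 0) at_top"
  proof (rule real_tendsto_sandwich)
    define m where "m R = ball_int (\<lambda>x. (cmod (u x))^2) R" for R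
    have cu2: "continuous_on UNIV (\<lambda>x. (cmod (u x))^2)" by (intro continuous_intros u)
    show "\<forall>\<^sub>F R in at_top. 0 \<le> ball_int w R / R"
      using eventually_gt_at_top[of 0] by eventually_elim (auto intro!: divide_nonneg_pos ball_int_nonneg w0)
    show "\<forall>\<^sub>F R in at_top. ball_int w R / R \<le> real (card S) * real (card S) * (m (2 * R) / (2 * R)) * 2"
      using eventually_ge_at_top[of A]
    proof eventually_elim
      fix R assume R: "A \<le> R"
      have "ball_int w R \<le> ball_int (\<lambda>x. real (card S) * (\<Sum>a\<in>S. (cmod (u (x + a)))^2)) R"
        unfolding w_def
        by (intro ball_int_mono continuous_intros continuous_on_shift u)
          (metis (no_types) sum_squared_le_sum_of_squares mult.commute)
      also have "\<dots> = real (card S) * (\<Sum>a\<in>S. ball_int (\<lambda>x. (cmod (u (x + a)))^2) R)"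
        by (subst ball_int_cmult, subst ball_int_sum) (auto intro!: continuous_intros continuous_on_shift u)
      also have "\<dots> \<le> real (card S) * (\<Sum>a\<in>S. m (2 * R))"
      proof (intro mult_left_mono sum_mono)
        fix a assume "a \<in> S"
        have "ball_int (\<lambda>x. (cmod (u (x + a)))^2) R \<le> m (R + norm a)"
          unfolding m_def by (rule ball_int_shift[OF cu2]) simp
        also have "\<dots> \<le> m (2 * R)"
          unfolding m_def using aA[OF \<open>a \<in> S\<close>] R by (intro ball_int_mono_radius[OF cu2]) auto
        finally show "ball_int (\<lambda>x. (cmod (u (x + a)))^2) R \<le> m (2 * R)" .
      qed simp
      finally have "ball_int w R / R \<le> real (card S) * real (card S) * m (2 * R) / R"
        using R A by (intro divide_right_mono) auto
      then show "ball_int w R / R \<le> real (card S) * real (card S) * (m (2 * R) / (2 * R)) * 2"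
        using R A by (simp add: field_simps)
    qed
    have "filterlim (\<lambda>R::real. 2 * R) at_top at_top"
      by (rule filterlim_tendsto_pos_mult_at_top[OF tendsto_const _ filterlim_ident]) simp
    from filterlim_compose[OF growth this]
    have "((\<lambda>R. real (card S) * real (card S) * (m (2 * R) / (2 * R)) * 2)
        \<longlongrightarrow> real (card S) * real (card S) * 0 * 2) at_top"
      unfolding m_def by (intro tendsto_mult tendsto_const)
    then show "((\<lambda>R. real (card S) * real (card S) * (m (2 * R) / (2 * R)) * 2) \<longlongrightarrow> 0) at_top" by simp
  qed auto
  \<comment> \<open>The commutator integrates to 0, so its positive part is at most the error.
    Beyond radius \<open>2 * R\<close> there is no error, because
    \<open>2 * A \<le> L \<le> R\<close> keeps all shifted points outside the support of the
    field.\<close>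
  have main: "ball_int P r0 / 8 \<le> K * (ball_int (\<lambda>x. L / (bracket L x)^2 * w x) (2 * R) + L / R * ball_int w (2 * R))"
    if L: "0 < L" "r0 \<le> L" "2 * A \<le> L" and R: "L \<le> R" for L R r0
  proof -
    define T where "T i x = (\<Sum>a\<in>S. c a * u (x + a) * of_real (pot L R (x + a) * ((x + a) \<bullet> i) - pot L R x * (x \<bullet> i))) * cnj (D x i)" for i x
    have Rpos: "0 < R" "0 \<le> R" using L R by auto
    have pc: "continuous_on UNIV (\<lambda>x. pot L R x * (x \<bullet> i))" for i :: 'a
      by (intro continuous_intros L(1))
    have p0: "pot L R x * (x \<bullet> i) = 0" if "R < norm x" for x i :: 'a
      using pot_eq_0[OF L(1) Rpos(2), of x] that by simp
    have T: "integrable lborel (T i)" "(LBINT x. T i x) = 0" for i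
      using virial_identity[OF u pc[of i] p0[where i = i] S z, where e = i] unfolding T_def D_def by simp_all
    have T': "integrable lborel (\<lambda>x. Re (\<Sum>i\<in>Basis. T i x))"
      using T(1) by (intro integrable_Re Bochner_Integration.integrable_sum) auto
    have T0: "(LBINT x. Re (\<Sum>i\<in>Basis. T i x)) = 0"
      using T by (subst integral_Re) (auto simp: Bochner_Integration.integral_sum)
    define V where "V x = L / (bracket L x)^2 * w x + L / R * w x" for x
    have V: "continuous_on UNIV V"
      unfolding V_def by (intro continuous_intros continuous_on_bracket_weight[OF L(1)] w)
    have V0: "0 \<le> V x" for x unfolding V_def using L Rpos w0 by simp
    have "ball_int (\<lambda>x. P x / 8) r0 - ball_int (\<lambda>x. K * V x) (2 * R)
        = (LBINT x. indicator (cball 0 r0) x * (P x / 8) - indicator (cball 0 (2 * R)) x * (K * V x))"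
      unfolding ball_int_def
      by (intro Bochner_Integration.integral_diff[symmetric] integrable_ball continuous_intros P V) auto
    also have "\<dots> \<le> (LBINT x. Re (\<Sum>i\<in>Basis. T i x))"
    proof (rule integral_mono[OF _ T'])
      show "integrable lborel (\<lambda>x. indicator (cball 0 r0) x * (P x / 8) - indicator (cball 0 (2 * R)) x * (K * V x))"
        by (intro Bochner_Integration.integrable_diff integrable_ball continuous_intros P V) auto
      fix x :: 'a
      show "indicator (cball 0 r0) x * (P x / 8) - indicator (cball 0 (2 * R)) x * (K * V x) \<le> Re (\<Sum>i\<in>Basis. T i x)"
      proof (cases "norm x \<le> 2 * R")
        case False
        have "pot L R (x + a) = 0" if "a \<in> S" for a
          using pot_eq_0[OF L(1) Rpos(2), of "x + a"] False aA[OF that] norm_triangle_ineq4[of "x + a" a] L R by auto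
        moreover have "pot L R x = 0" using pot_eq_0[OF L(1) Rpos(2), of x] False Rpos by auto
        ultimately have "T i x = 0" for i unfolding T_def by simp
        then show ?thesis using False L R by (auto simp: indicator_def)
      next
        case True
        have M: "R \<le> sqrt (L^2 + R^2)" using Rpos by (auto intro!: real_le_rsqrt)
        have "K * w x * (L / (bracket L x)^2 + L / sqrt (L^2 + R^2)) \<le> K * V x"
        proof -
          have "L / sqrt (L^2 + R^2) \<le> L / R" using M L Rpos by (intro frac_le) auto
          then have "K * w x * (L / (bracket L x)^2 + L / sqrt (L^2 + R^2)) \<le> K * w x * (L / (bracket L x)^2 + L / R)"
            using K w0[of x] by (intro mult_left_mono) auto
          then show ?thesis unfolding V_def by (simp add: algebra_simps)
        qed
        moreover have "indicator (cball 0 r0) x * (P x / 8) \<le> (if norm x \<le> R then (L / bracket L x) ^ 3 * P x else 0)"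
        proof (cases "norm x \<le> r0")
          case True
          \<comment> \<open>On the ball of radius \<open>L\<close> the crude bound
            \<open>bracket L x \<le> 2 * L\<close> gives \<open>(1 / 2) ^ 3\<close>, the 1/8 of the
            claim.\<close>
          have "(norm x)^2 \<le> L^2" using True L by (intro power_mono) auto
          then have "L^2 + (norm x)^2 \<le> 4 * L^2" using zero_le_power2[of L] by linarith
          then have "(bracket L x)^2 \<le> (2 * L)^2" by (simp add: bracket_sq power_mult_distrib)
          then have "bracket L x \<le> 2 * L" by (rule power2_le_imp_le) (use L in simp)
          then have "(1 / 2) ^ 3 \<le> (L / bracket L x) ^ 3"
            using L bracket_ge[OF L(1), of x] by (intro power_mono) (auto simp: field_simps)
          then have "1 / 8 * P x \<le> (L / bracket L x) ^ 3 * P x"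
            using P0[of x] by (intro mult_right_mono) (auto simp: power3_eq_cube)
          then show ?thesis using True L R by auto
        next
          case False
          then show ?thesis using P0[of x] L bracket_ge(3)[OF L(1), of x] by auto
        qed
        moreover have "Re (\<Sum>i\<in>Basis. T i x) \<ge> (if norm x \<le> R then (L / bracket L x) ^ 3 * P x else 0)
            - K * w x * (L / (bracket L x)^2 + L / sqrt (L^2 + R^2))"
          using virial_pointwise[OF S(1) aA cC L(1,3) Rpos(2) A C, where x = x and U = "\<lambda>a. u (x + a)"]
          unfolding T_def D_def P_def w_def K_def by simp
        ultimately show ?thesis using True by simp
      qed
    qed
    finally have "ball_int (\<lambda>x. 1 / 8 * P x) r0 \<le> ball_int (\<lambda>x. K * V x) (2 * R)" unfolding T0 by simp
    also have "ball_int (\<lambda>x. K * V x) (2 * R) = K * (ball_int (\<lambda>x. L / (bracket L x)^2 * w x) (2 * R) + L / R * ball_int w (2 * R))"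
      by (simp only: V_def ball_int_cmult ball_int_add[OF continuous_on_bracket_weight[OF L(1) w]
        continuous_on_mult[OF continuous_on_const w]])
    finally show ?thesis unfolding ball_int_cmult by simp
  qed
  \<comment> \<open>48 = 8 * (5 + 1): the dyadic sum costs \<open>5 * \<eta>\<close>, of which
    \<open>4 * \<eta>\<close> is the geometric series, and the \<open>L / R\<close> term costs
    \<open>\<eta>\<close>.\<close>
  have small: "ball_int P r0 \<le> 48 * K * \<eta>" if \<eta>: "0 < \<eta>" for r0 \<eta>
  proof -
    have "\<forall>\<^sub>F R in at_top. ball_int w R / R < \<eta>" using order_tendstoD(2)[OF w_growth \<eta>] .
    then obtain R1 where R1: "\<And>R. R1 \<le> R \<Longrightarrow> ball_int w R / R < \<eta>" by (auto simp: eventually_at_top_linorder)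
    define L where "L = max (max 1 R1) (max r0 (2 * A))"
    have L: "0 < L" "r0 \<le> L" "2 * A \<le> L" "R1 \<le> L" "1 \<le> L" unfolding L_def by auto
    have wR: "ball_int w R \<le> \<eta> * R" if "L \<le> R" for R
      using R1[of R] that L by (simp add: pos_divide_less_eq)
    have "\<forall>\<^sub>F R in at_top. ball_int w R / R < \<eta> / (2 * L)"
      using order_tendstoD(2)[OF w_growth, of "\<eta> / (2 * L)"] \<eta> L by simp
    then obtain R2 where R2: "\<And>R. R2 \<le> R \<Longrightarrow> ball_int w R / R < \<eta> / (2 * L)" by (auto simp: eventually_at_top_linorder)
    \<comment> \<open>\<open>R\<close> has to be a dyadic multiple of \<open>L\<close> for the shell
      estimate, and so large that the relative mass at \<open>2 * R\<close> beats the factor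
      \<open>L\<close>.\<close>
    obtain m where m: "R2 < 2 ^ m" using real_arch_pow[of 2 R2] by auto
    define R where "R = 2 ^ m * L"
    have LR: "L \<le> R" unfolding R_def using L by simp
    have "2 ^ m * 1 \<le> 2 ^ m * L" using L by (intro mult_left_mono) auto
    then have "R2 \<le> 2 * R" using m LR L unfolding R_def by linarith
    then have "ball_int w (2 * R) / (2 * R) < \<eta> / (2 * L)" by (rule R2)
    then have 2: "L / R * ball_int w (2 * R) \<le> \<eta>" using LR L by (simp add: field_simps)
    have "ball_int (\<lambda>x. L / (bracket L x)^2 * w x) (2 ^ Suc m * L)
      \<le> (ball_int w L + (\<Sum>k<Suc m. ball_int w (2 ^ (k + 1) * L) / 4 ^ k)) / L"
      by (rule ball_int_dyadic[OF L(1) w w0])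
    also have "\<dots> \<le> (\<eta> * L + (\<Sum>k<Suc m. 2 * \<eta> * L * (1/2) ^ k)) / L"
    proof (intro divide_right_mono add_mono sum_mono)
      fix k
      have "L \<le> 2 ^ (k + 1) * L" using L mult_right_mono[of 1 "2 ^ (k + 1)" L] by (simp add: one_le_power del: power_Suc)
      then have "ball_int w (2 ^ (k + 1) * L) / 4 ^ k \<le> \<eta> * (2 ^ (k + 1) * L) / 4 ^ k"
        by (intro divide_right_mono wR) auto
      also have "\<dots> = 2 * \<eta> * L * (1/2) ^ k"
        by (simp add: power_divide field_simps flip: power_mult_distrib)
      finally show "ball_int w (2 ^ (k + 1) * L) / 4 ^ k \<le> 2 * \<eta> * L * (1/2) ^ k" .
    qed (use wR[of L] L in auto)
    also have "(\<Sum>k<Suc m. 2 * \<eta> * L * (1/2) ^ k) = 2 * \<eta> * L * (2 - (1/2) ^ m)"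
      unfolding sum_distrib_left[symmetric] by (subst sum_gp_strict) (simp add: field_simps)
    also have "\<dots> \<le> 4 * \<eta> * L" using \<eta> L by simp
    also have "(\<eta> * L + 4 * \<eta> * L) / L = 5 * \<eta>" using L by simp
    finally have 1: "ball_int (\<lambda>x. L / (bracket L x)^2 * w x) (2 * R) \<le> 5 * \<eta>"
      using L by (simp add: R_def mult.assoc divide_right_mono)
    have "ball_int P r0 / 8 \<le> K * (5 * \<eta> + \<eta>)"
      using main[OF L(1-3) LR] 1 2 K by (meson add_mono mult_left_mono order_trans)
    then show ?thesis by simp
  qed
  have "ball_int P r0 \<le> 0" for r0
  proof (rule field_le_epsilon)
    fix \<epsilon> :: real assume \<epsilon>: "0 < \<epsilon>"
    have "0 < \<epsilon> / (48 * K + 1)" using \<epsilon> K by (intro divide_pos_pos) auto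
    then have "ball_int P r0 \<le> 48 * K * (\<epsilon> / (48 * K + 1))" by (rule small)
    also have "\<dots> \<le> \<epsilon>" using \<epsilon> K by (simp add: field_simps)
    finally show "ball_int P r0 \<le> 0 + \<epsilon>" by simp
  qed
  then have "P x = 0" for x using ball_int_zero_imp[OF P P0, of "norm x + 1" x] by simp
  then have Di: "D x i = 0" if "i \<in> Basis" for i
    using that unfolding P_def by (simp add: sum_nonneg_eq_0_iff)
  have "D x e = (\<Sum>a\<in>S. \<Sum>i\<in>Basis. c a * of_real (a \<bullet> i) * of_real (e \<bullet> i) * u (x + a))"
    unfolding D_def by (intro sum.cong refl, subst euclidean_inner)
      (simp add: sum_distrib_left sum_distrib_right mult_ac)
  also have "\<dots> = (\<Sum>i\<in>Basis. of_real (e \<bullet> i) * D x i)"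
    by (subst sum.swap) (simp add: D_def sum_distrib_left mult_ac)
  also have "\<dots> = 0" using Di by simp
  finally show ?thesis by (simp add: D_def)
qed

text \<open>The factor \<open>1 - (a \<bullet> b)\<^sup>2 / (b \<bullet> b)\<^sup>2\<close> preserves hermitian symmetry and the coefficient at 0, and
  removes \<open>b\<close> and \<open>-b\<close> from the support.\<close>

lemma hermitian_relation_trivial:
  fixes u c :: "'a::euclidean_space \<Rightarrow> complex"
  assumes u: "continuous_on UNIV u"
    and growth: "((\<lambda>R. ball_int (\<lambda>x. (cmod (u x))^2) R / R) \<longlongrightarrow> 0) at_top"
    and S: "finite S" "\<And>a. a \<in> S \<Longrightarrow> -a \<in> S" "\<And>a. a \<in> S \<Longrightarrow> c (-a) = cnj (c a)"
    and 0: "0 \<in> S" "c 0 \<noteq> 0"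
    and z: "\<And>x. (\<Sum>a\<in>S. c a * u (x + a)) = 0"
  shows "u x = 0"
  using S 0 z
proof (induction "card S" arbitrary: S c rule: less_induct)
  case less
  show ?case
  proof (cases "S = {0}")
    case True
    then show ?thesis using less.prems(5) less.prems(6)[of x] by simp
  next
    case False
    then obtain b where b: "b \<in> S" "b \<noteq> 0" using less.prems(4) by blast
    have bb: "b \<bullet> b \<noteq> 0" using b by simp
    have 1: "(\<Sum>a\<in>S. c a * of_real (a \<bullet> b) * u (x + a)) = 0" for x
      by (rule virial_derivative[OF u growth less.prems(1-3,6)])
    \<comment> \<open>\<open>a \<bullet> b\<close> is odd in \<open>a\<close>, so one application
      makes the coefficients antihermitian; the factor \<open>\<i>\<close> makes them hermitian
      again for the second.\<close>
    have "(\<Sum>a\<in>S. (\<i> * c a * of_real (a \<bullet> b)) * u (x + a)) = 0" for x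
      using 1[of x] by (simp add: sum_distrib_left[symmetric] mult.assoc)
    then have "(\<Sum>a\<in>S. (\<i> * c a * of_real (a \<bullet> b)) * of_real (a \<bullet> b) * u (x + a)) = 0" for x
      by (intro virial_derivative[where c = "\<lambda>a. \<i> * c a * of_real (a \<bullet> b)", OF u growth less.prems(1-2)])
        (use less.prems(3) in auto)
    then have 2: "(\<Sum>a\<in>S. c a * of_real ((a \<bullet> b)^2) * u (x + a)) = 0" for x
      by (simp add: mult.assoc power2_eq_square flip: sum_distrib_left)
    define S' where "S' = S - {b, -b}"
    define c' where "c' a = c a * of_real (1 - (a \<bullet> b)^2 / (b \<bullet> b)^2)" for a
    show ?thesis
    proof (rule less.hyps[of S' c'])
      show "card S' < card S" unfolding S'_def using b less.prems(1) by (intro psubset_card_mono) auto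
      fix x
      have "(\<Sum>a\<in>S'. c' a * u (x + a)) = (\<Sum>a\<in>S. c' a * u (x + a))"
        unfolding S'_def using less.prems(1) bb by (intro sum.mono_neutral_left) (auto simp: c'_def)
      also have "\<dots> = (\<Sum>a\<in>S. c a * u (x + a)) - of_real (1 / (b \<bullet> b)^2) * (\<Sum>a\<in>S. c a * of_real ((a \<bullet> b)^2) * u (x + a))"
        unfolding c'_def by (simp add: sum_distrib_left sum_subtractf algebra_simps)
      finally show "(\<Sum>a\<in>S'. c' a * u (x + a)) = 0" using 2 less.prems(6) by simp
    qed (use less.prems b in \<open>auto simp: S'_def c'_def\<close>)
  qed
qed

text \<open>The relation is composed with its adjoint, giving coefficients \<open>C\<close> on the
  differences \<open>v j - v l\<close> that are hermitian. By injectivity of \<open>v\<close> only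
  diagonal pairs contribute at 0, so \<open>C 0\<close> is the sum of all
  \<open>(cmod (c j))^2\<close> and does not vanish.\<close>

theorem translates_independent:
  fixes u :: "'a::euclidean_space \<Rightarrow> complex" and v :: "'b \<Rightarrow> 'a" and c :: "'b \<Rightarrow> complex"
  assumes u: "continuous_on UNIV u"
    and growth: "((\<lambda>R. ball_int (\<lambda>x. (cmod (u x))^2) R / R) \<longlongrightarrow> 0) at_top"
    and J: "finite J" "inj_on v J" and c: "\<exists>j\<in>J. c j \<noteq> 0"
    and z: "\<And>x. (\<Sum>j\<in>J. c j * u (x + v j)) = 0"
  shows "u x = 0"
proof -
  define S where "S = (\<lambda>(j, l). v j - v l) ` (J \<times> J)"
  define I where "I a = {p \<in> J \<times> J. v (fst p) - v (snd p) = a}" for a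
  define C where "C a = (\<Sum>(j, l)\<in>I a. c j * cnj (c l))" for a
  show ?thesis
  proof (rule hermitian_relation_trivial[OF u growth, of S C])
    show "finite S" unfolding S_def using J by simp
    show "- a \<in> S" if "a \<in> S" for a using that unfolding S_def by force
    show "C (- a) = cnj (C a)" for a
      unfolding C_def cnj_sum
      by (rule sum.reindex_bij_witness[of _ prod.swap prod.swap]) (auto simp: I_def, metis minus_diff_eq minus_minus)
    show "0 \<in> S" using c unfolding S_def by force
    have "C 0 = (\<Sum>j\<in>J. c j * cnj (c j))"
      unfolding C_def by (rule sum.reindex_bij_witness[of _ "\<lambda>j. (j, j)" fst])
        (use J(2) in \<open>auto simp: I_def dest: inj_onD\<close>)
    also have "\<dots> = of_real (\<Sum>j\<in>J. (cmod (c j))^2)"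
      unfolding of_real_sum by (intro sum.cong refl) (simp add: complex_norm_square del: of_real_power)
    finally have C0: "C 0 = of_real (\<Sum>j\<in>J. (cmod (c j))^2)" .
    have "(\<Sum>j\<in>J. (cmod (c j))^2) \<noteq> 0" using c J(1) by (subst sum_nonneg_eq_0_iff) auto
    then show "C 0 \<noteq> 0" unfolding C0 of_real_eq_0_iff .
    fix x
    have "(\<Sum>a\<in>S. C a * u (x + a)) = (\<Sum>a\<in>S. \<Sum>(j, l)\<in>I a. c j * cnj (c l) * u (x + (v j - v l)))"
      unfolding C_def sum_distrib_right by (intro sum.cong refl) (auto simp: I_def)
    also have "\<dots> = (\<Sum>(j, l)\<in>J \<times> J. c j * cnj (c l) * u (x + (v j - v l)))"
      using sum.group[of "J \<times> J" S "\<lambda>p. v (fst p) - v (snd p)"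
        "\<lambda>(j, l). c j * cnj (c l) * u (x + (v j - v l))"] J(1)
      unfolding I_def S_def by (force simp: case_prod_unfold)
    also have "\<dots> = (\<Sum>l\<in>J. cnj (c l) * (\<Sum>j\<in>J. c j * u ((x - v l) + v j)))"
      by (subst sum.cartesian_product[symmetric], subst sum.swap) (simp add: sum_distrib_left mult_ac algebra_simps)
    finally show "(\<Sum>a\<in>S. C a * u (x + a)) = 0" by (simp add: z)
  qed
qed

section \<open>The Hilbert space of square-integrable functions\<close>

lemma cinner_add_left: "cinner (f + g) h = cinner f h + cinner g h"
  by transfer (simp add: distrib_right ae_eq_sq_def square_integrable_mult_cnj)

lemma cinner_scale_left: "cinner (c *\<^sub>C f) g = c * cinner f g"
  by transfer (simp add: mult.assoc)

lemma cinner_commute: "cinner f g = cnj (cinner g f)"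
proof transfer
  fix f g :: "'a \<Rightarrow> complex"
  have "(\<lambda>t. f t * cnj (g t)) = (\<lambda>t. cnj (g t * cnj (f t)))" by (simp add: mult.commute)
  then show "(LBINT t. f t * cnj (g t)) = cnj (LBINT t. g t * cnj (f t))"
    by (simp only: Bochner_Integration.integral_cnj)
qed

lemma cinner_add_right: "cinner h (f + g) = cinner h f + cinner h g"
  by (metis cinner_add_left cinner_commute complex_cnj_add)

lemma cinner_scale_right: "cinner f (c *\<^sub>C g) = cnj c * cinner f g"
  by (metis cinner_scale_left cinner_commute complex_cnj_mult)

lemma scaleR_eq_cscale: "r *\<^sub>R f = of_real r *\<^sub>C (f :: 'a::euclidean_space L2)"
  by (rule scaleR_L2_def)

lemma uminus_eq_cscale: "- f = (-1) *\<^sub>C (f :: 'a::euclidean_space L2)"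
  by (rule uminus_L2_def)

lemma cinner_zero_left [simp]: "cinner 0 f = 0" and cinner_zero_right [simp]: "cinner f 0 = 0"
  using cinner_add_left[of 0 0 f] cinner_add_right[of f 0 0] by auto

lemma cinner_minus_left: "cinner (- f) g = - cinner f g" and cinner_minus_right: "cinner f (- g) = - cinner f g"
  by (simp_all only: uminus_eq_cscale cinner_scale_left cinner_scale_right) simp_all

lemma cinner_diff_left: "cinner (f - g) h = cinner f h - cinner g h"
  and cinner_diff_right: "cinner h (f - g) = cinner h f - cinner h g"
  by (simp_all only: diff_conv_add_uminus cinner_add_left cinner_add_right cinner_minus_left cinner_minus_right)

lemma cinner_sum_left: "cinner (\<Sum>i\<in>I. f i) g = (\<Sum>i\<in>I. cinner (f i) g)"
  by (induction I rule: infinite_finite_induct) (auto simp: cinner_add_left)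

lemma cinner_sum_right: "cinner g (\<Sum>i\<in>I. f i) = (\<Sum>i\<in>I. cinner g (f i))"
  by (induction I rule: infinite_finite_induct) (auto simp: cinner_add_right)

lemma Re_cinner: "Re (cinner f g) = inner f g"
  by (simp add: inner_L2_def)

lemma cinner_self: "cinner f f = of_real ((norm f)^2)"
proof -
  have "Im (cinner f f) = 0" using arg_cong[OF cinner_commute[of f f], of Im] by simp
  then show ?thesis by (simp add: complex_eq_iff Re_cinner power2_norm_eq_inner)
qed

lemma norm_sq_cinner: "(norm f)^2 = Re (cinner f f)"
  by (simp add: cinner_self)

lemma norm_cscale: "norm (c *\<^sub>C f) = cmod c * norm (f :: 'a::euclidean_space L2)"
proof -
  have "cinner (c *\<^sub>C f) (c *\<^sub>C f) = (c * cnj c) * cinner f f"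
    by (simp add: cinner_scale_left cinner_scale_right mult_ac)
  then have "(norm (c *\<^sub>C f))^2 = (cmod c * norm f)^2"
    unfolding norm_sq_cinner complex_norm_square[symmetric] by (simp add: power_mult_distrib norm_sq_cinner)
  then show ?thesis by (simp add: power2_eq_iff_nonneg)
qed

lemma cinner_Cauchy_Schwarz: "cmod (cinner f g) \<le> norm f * norm g"
proof (cases "cinner f g = 0")
  case False
  define u where "u = cnj (sgn (cinner f g))"
  have u: "cmod u = 1" using False by (simp add: u_def norm_sgn)
  have "of_real (cmod (cinner f g)) = u * cinner f g"
    using False by (simp add: u_def sgn_eq complex_norm_square[symmetric] power2_eq_square mult.commute[of "cnj _"])
  also have "\<dots> = cinner (u *\<^sub>C f) g" by (simp add: cinner_scale_left)
  finally have "cmod (cinner f g) = inner (u *\<^sub>C f) g" unfolding Re_cinner[symmetric] by (metis Re_complex_of_real)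
  also have "\<dots> \<le> norm (u *\<^sub>C f) * norm g" by (rule norm_cauchy_schwarz)
  finally show ?thesis by (simp add: norm_cscale u)
qed simp

lemma tendsto_cinner [tendsto_intros]:
  assumes "(f \<longlongrightarrow> a) F" "(g \<longlongrightarrow> b) F"
  shows "((\<lambda>x. cinner (f x) (g x)) \<longlongrightarrow> cinner a b) F"
proof -
  have *: "cinner x y = complex_of_real (inner x y) - \<i> * complex_of_real (inner (\<i> *\<^sub>C x) y)" for x y :: "'b::euclidean_space L2"
    by (simp add: complex_eq_iff Re_cinner[symmetric] cinner_scale_left)
  have "((\<lambda>x. \<i> *\<^sub>C f x) \<longlongrightarrow> \<i> *\<^sub>C a) F"
  proof -
    have "norm (\<i> *\<^sub>C x - \<i> *\<^sub>C y) = norm (x - y)" for x y :: "'b::euclidean_space L2"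
      by (simp flip: L2.scale_right_diff_distrib add: norm_cscale)
    then show ?thesis using assms(1) by (simp add: tendsto_iff dist_norm)
  qed
  then show ?thesis unfolding * by (intro tendsto_intros assms)
qed

lemma cinner_ext: "(\<And>h. cinner h f = cinner h g) \<Longrightarrow> f = g"
proof -
  assume "\<And>h. cinner h f = cinner h g"
  then have "cinner (f - g) (f - g) = 0" by (simp add: cinner_diff_right)
  then show "f = g" by (simp add: cinner_self)
qed

lemma L2_exhaust:
  obtains \<phi> where "square_integrable \<phi>" "f = abs_L2 \<phi>"
proof (rule that)
  show "square_integrable (rep_L2 f)" using Quotient_rep_reflp[OF Quotient_L2, of f] by (simp add: ae_eq_sq_def)
  show "f = abs_L2 (rep_L2 f)" using Quotient_abs_rep[OF Quotient_L2, of f] by simp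
qed

lemma ae_eq_sq_refl: "square_integrable f \<Longrightarrow> ae_eq_sq f f"
  by (simp add: ae_eq_sq_def)

lemma cinner_abs_L2:
  "square_integrable \<phi> \<Longrightarrow> square_integrable \<psi> \<Longrightarrow> cinner (abs_L2 \<phi>) (abs_L2 \<psi>) = (LBINT t. \<phi> t * cnj (\<psi> t))"
  by (intro cinner.abs_eq ae_eq_sq_refl)

lemma norm_abs_L2:
  assumes "square_integrable \<phi>" shows "(norm (abs_L2 \<phi>))^2 = (LBINT t. (cmod (\<phi> t))^2)"
proof -
  have "cinner (abs_L2 \<phi>) (abs_L2 \<phi>) = of_real (LBINT t. (cmod (\<phi> t))^2)"
    unfolding cinner_abs_L2[OF assms assms] integral_complex_of_real[symmetric] complex_norm_square ..
  then show ?thesis by (simp add: norm_sq_cinner)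
qed

lemma nn_norm_abs_L2:
  assumes "square_integrable \<phi>" shows "(\<integral>\<^sup>+t. (cmod (\<phi> t))^2 \<partial>lborel) = ennreal ((norm (abs_L2 \<phi>))^2)"
  using assms unfolding norm_abs_L2[OF assms] square_integrable_def
  by (intro nn_integral_eq_integral) auto

lemma square_integrable_diff:
  assumes "square_integrable f" "square_integrable g" shows "square_integrable (\<lambda>t. f t - g t)"
  using square_integrable_add[OF assms(1) square_integrable_scale[OF assms(2), of "-1"]] by simp

lemma abs_L2_diff:
  assumes "square_integrable \<phi>" "square_integrable \<psi>"
  shows "abs_L2 \<phi> - abs_L2 \<psi> = abs_L2 (\<lambda>t. \<phi> t - \<psi> t)"
proof -
  have "(-1) *\<^sub>C abs_L2 \<psi> = abs_L2 (\<lambda>t. (-1) * \<psi> t)"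
    using assms(2) by (intro cscale.abs_eq ae_eq_sq_refl)
  moreover have "abs_L2 \<phi> + abs_L2 (\<lambda>t. (-1) * \<psi> t) = abs_L2 (\<lambda>t. \<phi> t + (-1) * \<psi> t)"
    using assms by (intro plus_L2.abs_eq ae_eq_sq_refl square_integrable_scale)
  ultimately have "abs_L2 \<phi> + (-1) *\<^sub>C abs_L2 \<psi> = abs_L2 (\<lambda>t. \<phi> t + (-1) * \<psi> t)" by metis
  then show ?thesis by simp
qed

section \<open>Completeness, Riesz representation and adjoints\<close>

text \<open>The theorem of Riesz and Fischer: a fast subsequence converges almost everywhere, and
  Fatou's lemma upgrades the pointwise limit to a limit in norm.\<close>

lemma L2_complete:
  fixes X :: "nat \<Rightarrow> 'a::euclidean_space L2"
  assumes "Cauchy X" shows "convergent X"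
proof -
  have "\<exists>N. \<forall>m\<ge>N. \<forall>n\<ge>N. norm (X m - X n) < (1 / 4) ^ k" for k
    using CauchyD[OF assms, of "(1/4) ^ k"] by auto
  then obtain N where N: "\<And>k m n. N k \<le> m \<Longrightarrow> N k \<le> n \<Longrightarrow> norm (X m - X n) < (1 / 4) ^ k" by metis
  define r where "r k = k + (\<Sum>j\<le>k. N j)" for k
  have rN: "N k \<le> r k" "N k \<le> r (Suc k)" "k \<le> r k" for k
    using member_le_sum[of k "{..k}" N] by (auto simp: r_def)
  have "\<exists>\<psi>. square_integrable \<psi> \<and> X n = abs_L2 \<psi>" for n by (metis L2_exhaust)
  then obtain \<psi> where \<psi>: "\<And>n. square_integrable (\<psi> n)" "\<And>n. X n = abs_L2 (\<psi> n)" by metis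
  have \<psi>m [measurable]: "\<psi> n \<in> borel_measurable borel" for n using \<psi>(1)[of n] by (simp add: square_integrable_def)
  define \<phi> where "\<phi> k = \<psi> (r k)" for k
  have \<phi>m [measurable]: "\<phi> k \<in> borel_measurable borel" for k by (simp add: \<phi>_def)
  have dist: "(\<integral>\<^sup>+t. ennreal ((cmod (\<psi> m t - \<psi> n t))^2) \<partial>lborel) = ennreal ((norm (X m - X n))^2)" for m n
    unfolding \<psi>(2) abs_L2_diff[OF \<psi>(1) \<psi>(1)] by (rule nn_norm_abs_L2[OF square_integrable_diff[OF \<psi>(1) \<psi>(1)]])
  \<comment> \<open>The steps of the subsequence have norm below \<open>(1/4) ^ k\<close>, so even
    with the weight \<open>4 ^ k\<close> their squares have integrals summing to a finite value.
    Where the sum of the \<open>g k t\<close> is finite, the weight makes the steps at most a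
    constant times \<open>(1/2) ^ k\<close>.\<close>
  define g where "g k t = 4 ^ k * (cmod (\<phi> (Suc k) t - \<phi> k t))^2" for k t
  have gm [measurable]: "g k \<in> borel_measurable borel" for k unfolding g_def by measurable
  have g0: "0 \<le> g k t" for k t by (simp add: g_def)
  have "(\<integral>\<^sup>+t. (\<Sum>k. ennreal (g k t)) \<partial>lborel) = (\<Sum>k. \<integral>\<^sup>+t. ennreal (g k t) \<partial>lborel)"
    by (rule nn_integral_suminf) measurable
  also have "\<dots> \<le> (\<Sum>k. ennreal ((1/4) ^ k))"
  proof (rule suminf_le)
    fix k
    have "(\<integral>\<^sup>+t. ennreal (g k t) \<partial>lborel) = ennreal (4 ^ k) * ennreal ((norm (X (r (Suc k)) - X (r k)))^2)"
      unfolding g_def by (subst ennreal_mult, simp, simp, subst nn_integral_cmult, simp) (simp only: \<phi>_def dist)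
    also have "\<dots> \<le> ennreal (4 ^ k) * ennreal (((1/4) ^ k)^2)"
      using N[OF rN(2) rN(1), of k] by (intro mult_left_mono ennreal_leI power_mono) auto
    also have "\<dots> = ennreal ((1/4) ^ k)"
      by (simp add: ennreal_mult[symmetric] power2_eq_square power_mult_distrib[symmetric] flip: mult.assoc)
    finally show "(\<integral>\<^sup>+t. ennreal (g k t) \<partial>lborel) \<le> ennreal ((1/4) ^ k)" .
  qed auto
  also have "\<dots> = ennreal (\<Sum>k. (1/4) ^ k)" by (rule suminf_ennreal2) (auto intro: summable_geometric)
  also have "\<dots> < \<infinity>" by simp
  finally have "AE t in lborel. (\<Sum>k. ennreal (g k t)) \<noteq> \<infinity>" by (intro nn_integral_PInf_AE) auto
  then have conv: "AE t in lborel. convergent (\<lambda>k. \<phi> k t)"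
  proof eventually_elim
    case (elim t)
    define C where "C = enn2real (\<Sum>k. ennreal (g k t))"
    have C0: "0 \<le> C" by (simp add: C_def)
    have C: "g k t \<le> C" for k
    proof -
      have "ennreal (g k t) \<le> (\<Sum>k. ennreal (g k t))" using sum_le_suminf[of "\<lambda>k. ennreal (g k t)" "{k}"] by auto
      also have "\<dots> = ennreal C" using elim by (simp add: C_def ennreal_enn2real_if)
      finally show ?thesis using C0 by simp
    qed
    have le: "norm (\<phi> (Suc k) t - \<phi> k t) \<le> sqrt C * (1/2) ^ k" for k
    proof (rule power2_le_imp_le)
      have "4 ^ k * (norm (\<phi> (Suc k) t - \<phi> k t))^2 \<le> C" using C[of k] by (simp add: g_def)
      then have "(norm (\<phi> (Suc k) t - \<phi> k t))^2 \<le> C / 4 ^ k" by (simp add: field_simps)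
      also have "\<dots> = (sqrt C * (1/2) ^ k)^2" 
        using C0 by (simp add: power_mult_distrib power_divide power2_eq_square[of "2 ^ k"] flip: power_mult_distrib)
      finally show "(norm (\<phi> (Suc k) t - \<phi> k t))^2 \<le> (sqrt C * (1/2) ^ k)^2" .
    qed (use C0 in simp)
    have "summable (\<lambda>k. \<phi> (Suc k) t - \<phi> k t)"
      by (rule summable_comparison_test[of _ "\<lambda>k. sqrt C * (1/2) ^ k"])
        (use le in \<open>auto intro!: summable_mult summable_geometric\<close>)
    then have "convergent (\<lambda>n. \<Sum>k<n. \<phi> (Suc k) t - \<phi> k t)" by (simp add: summable_iff_convergent)
    then have "convergent (\<lambda>n. (\<phi> n t - \<phi> 0 t) + \<phi> 0 t)"
      unfolding sum_lessThan_telescope[of "\<lambda>k. \<phi> k t"] by (intro convergent_add convergent_const)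
    then show ?case by simp
  qed
  define \<Phi> where "\<Phi> t = lim (\<lambda>k. \<phi> k t)" for t
  have [measurable]: "\<Phi> \<in> borel_measurable borel" unfolding \<Phi>_def by measurable
  have fatou: "(\<integral>\<^sup>+t. ennreal ((cmod (\<Phi> t - \<psi> n t))^2) \<partial>lborel) \<le> ennreal (\<epsilon>^2)"
    if \<epsilon>: "0 \<le> \<epsilon>" "\<And>m. n0 \<le> m \<Longrightarrow> norm (X m - X n) \<le> \<epsilon>" for n n0 \<epsilon>
  proof -
    have "(\<integral>\<^sup>+t. ennreal ((cmod (\<Phi> t - \<psi> n t))^2) \<partial>lborel)
        \<le> (\<integral>\<^sup>+t. liminf (\<lambda>k. ennreal ((cmod (\<phi> k t - \<psi> n t))^2)) \<partial>lborel)"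
    proof (rule nn_integral_mono_AE, use conv in eventually_elim)
      case (elim t)
      then have "(\<lambda>k. \<phi> k t) \<longlonglongrightarrow> \<Phi> t" unfolding \<Phi>_def by (simp add: convergent_LIMSEQ_iff)
      then have "(\<lambda>k. ennreal ((cmod (\<phi> k t - \<psi> n t))^2)) \<longlonglongrightarrow> ennreal ((cmod (\<Phi> t - \<psi> n t))^2)"
        by (intro tendsto_intros)
      from lim_imp_Liminf[OF _ this] show ?case by simp
    qed
    also have "\<dots> \<le> liminf (\<lambda>k. \<integral>\<^sup>+t. ennreal ((cmod (\<phi> k t - \<psi> n t))^2) \<partial>lborel)"
      by (rule nn_integral_liminf) measurable
    also have "\<dots> \<le> liminf (\<lambda>k::nat. ennreal (\<epsilon>^2))"
    proof (rule Liminf_mono)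
      show "\<forall>\<^sub>F k in sequentially. (\<integral>\<^sup>+t. ennreal ((cmod (\<phi> k t - \<psi> n t))^2) \<partial>lborel) \<le> ennreal (\<epsilon>^2)"
        using eventually_ge_at_top[of n0]
      proof eventually_elim
        case (elim k)
        then have "norm (X (r k) - X n) \<le> \<epsilon>" using rN(3)[of k] by (intro \<epsilon>) simp
        then show ?case unfolding \<phi>_def dist by (intro ennreal_leI power_mono) auto
      qed
    qed
    also have "\<dots> = ennreal (\<epsilon>^2)" by (simp add: Liminf_const)
    finally show ?thesis .
  qed
  \<comment> \<open>\<open>N 0\<close> belongs to the tolerance \<open>(1/4) ^ 0 = 1\<close>: one
    member of the sequence lies within distance 1 of \<open>\<Phi>\<close>.\<close>
  have sq: "square_integrable (\<lambda>t. \<Phi> t - \<psi> (N 0) t)"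
  proof -
    have "(\<integral>\<^sup>+t. ennreal ((cmod (\<Phi> t - \<psi> (N 0) t))^2) \<partial>lborel) \<le> ennreal (1^2)"
      using N[of 0] by (intro fatou[of _ "N 0"]) (auto intro: less_imp_le)
    then have "(\<integral>\<^sup>+t. ennreal ((cmod (\<Phi> t - \<psi> (N 0) t))^2) \<partial>lborel) < \<infinity>" by (simp add: order_le_less_trans)
    then show ?thesis unfolding square_integrable_def by (auto simp: integrable_iff_bounded)
  qed
  have \<Phi>: "square_integrable \<Phi>" using square_integrable_add[OF sq \<psi>(1)[of "N 0"]] by simp
  have "X \<longlonglongrightarrow> abs_L2 \<Phi>"
  proof (rule LIMSEQ_I)
    fix \<epsilon> :: real assume \<epsilon>: "0 < \<epsilon>"
    then obtain n0 where n0: "\<And>m n. n0 \<le> m \<Longrightarrow> n0 \<le> n \<Longrightarrow> norm (X m - X n) < \<epsilon> / 2"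
      using CauchyD[OF assms, of "\<epsilon> / 2"] by auto
    have "norm (X n - abs_L2 \<Phi>) < \<epsilon>" if "n0 \<le> n" for n
    proof -
      have "ennreal ((norm (abs_L2 \<Phi> - X n))^2) \<le> ennreal ((\<epsilon> / 2)^2)"
        unfolding \<psi>(2) abs_L2_diff[OF \<Phi> \<psi>(1)]
        unfolding nn_norm_abs_L2[OF square_integrable_diff[OF \<Phi> \<psi>(1)], symmetric]
        using n0 that \<epsilon> by (intro fatou[of _ n0]) (auto intro: less_imp_le)
      then have "(norm (abs_L2 \<Phi> - X n))^2 \<le> (\<epsilon> / 2)^2" by (subst (asm) ennreal_le_iff) simp_all
      then have "norm (abs_L2 \<Phi> - X n) \<le> \<epsilon> / 2" by (rule power2_le_imp_le) (use \<epsilon> in simp)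
      then show ?thesis using \<epsilon> by (simp add: norm_minus_commute)
    qed
    then show "\<exists>n0. \<forall>n\<ge>n0. norm (X n - abs_L2 \<Phi>) < \<epsilon>" by blast
  qed
  then show ?thesis by (rule convergentI)
qed

text \<open>The representing vector minimises \<open>(norm f)^2 - 2 * Re (\<phi> f)\<close>. By the
  parallelogram law a minimising sequence is Cauchy, and stationarity at the minimum is the
  representation of the real part.\<close>

lemma Riesz_representation:
  fixes \<phi> :: "'a::euclidean_space L2 \<Rightarrow> complex"
  assumes \<phi>: "bounded_linear \<phi>" "\<And>c f. \<phi> (c *\<^sub>C f) = c * \<phi> f"
  shows "\<exists>h. \<forall>f. \<phi> f = cinner f h"
proof -
  interpret bounded_linear \<phi> by (rule \<phi>)
  obtain K where K: "0 \<le> K" "\<And>f. norm (\<phi> f) \<le> norm f * K" using nonneg_bounded by blast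
  define J where "J f = (norm f)^2 - 2 * Re (\<phi> f)" for f
  have bound: "- K\<^sup>2 \<le> J f" for f
  proof -
    have "Re (\<phi> f) \<le> norm f * K" using K(2)[of f] complex_Re_le_cmod[of "\<phi> f"] by linarith
    then show ?thesis unfolding J_def using zero_le_power2[of "norm f - K"] by (simp add: power2_diff)
  qed
  have bdd: "bdd_below (range J)" using bound by (auto intro!: bdd_belowI)
  define I where "I = Inf (range J)"
  have I: "I \<le> J f" for f unfolding I_def using bdd by (rule cINF_lower) simp
  have "\<exists>f. J f < I + 1 / real (Suc n)" for n
    using cInf_lessD[of "range J" "I + 1 / real (Suc n)"] unfolding I_def by auto
  then obtain F where F: "\<And>n. J (F n) < I + 1 / real (Suc n)" by metis
  have par: "(norm (f - g))^2 = 2 * J f + 2 * J g - 4 * J ((1/2) *\<^sub>R (f + g))" for f g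
  proof -
    have n: "(norm ((1/2) *\<^sub>R (f + g)))^2 = (norm f)^2 / 4 + (norm g)^2 / 4 + inner f g / 2"
      unfolding power2_norm_eq_inner inner_scaleR_left inner_scaleR_right inner_add_left inner_add_right
      by (simp add: inner_commute field_simps)
    have m: "(norm (f - g))^2 = (norm f)^2 + (norm g)^2 - 2 * inner f g"
      by (simp add: power2_norm_eq_inner inner_diff_left inner_diff_right inner_commute)
    have "Re (\<phi> ((1/2) *\<^sub>R (f + g))) = (Re (\<phi> f) + Re (\<phi> g)) / 2" by (simp add: scaleR add)
    then show ?thesis unfolding J_def n m by (simp add: field_simps)
  qed
  have "Cauchy F"
  proof (rule CauchyI)
    fix e :: real assume e: "0 < e"
    obtain n0 where n0: "4 / e^2 < real n0" using reals_Archimedean2 by blast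
    have "norm (F m - F n) < e" if "n0 \<le> m" "n0 \<le> n" for m n
    proof (rule power2_less_imp_less)
      have inv: "1 / real (Suc k) < e^2 / 4" if "n0 \<le> k" for k
      proof -
        have "4 / e^2 < real (Suc k)" using n0 that by linarith
        then show ?thesis using e by (simp add: field_simps)
      qed
      have "(norm (F m - F n))^2 \<le> 2 * J (F m) + 2 * J (F n) - 4 * I" unfolding par using I by simp
      also have "\<dots> < e^2" using F[of m] F[of n] inv[OF that(1)] inv[OF that(2)] by linarith
      finally show "(norm (F m - F n))^2 < e^2" .
    qed (use e in simp)
    then show "\<exists>M. \<forall>m\<ge>M. \<forall>n\<ge>M. norm (F m - F n) < e" by blast
  qed
  then obtain h where h: "F \<longlonglongrightarrow> h" using L2_complete convergent_def by blast
  have "(\<lambda>n. J (F n)) \<longlonglongrightarrow> J h" unfolding J_def by (intro tendsto_intros h tendsto)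
  moreover have "(\<lambda>n. I + 1 / real (Suc n)) \<longlonglongrightarrow> I + 0"
    by (intro tendsto_intros LIMSEQ_Suc[OF lim_1_over_n])
  ultimately have "J h \<le> I + 0" by (rule LIMSEQ_le) (use F in \<open>auto intro: less_imp_le\<close>)
  then have min: "J h \<le> J f" for f using I[of f] by simp
  have real: "inner f h = Re (\<phi> f)" for f
  proof -
    define d where "d = inner f h - Re (\<phi> f)"
    have q: "0 \<le> t^2 * (norm f)^2 + 2 * t * d" for t
    proof -
      have "J (h + t *\<^sub>R f) - J h = t^2 * (norm f)^2 + 2 * t * d"
      proof -
        have n: "(norm (h + t *\<^sub>R f))^2 = (norm h)^2 + t^2 * (norm f)^2 + 2 * t * inner f h"
          unfolding power2_norm_eq_inner inner_simps by (simp add: inner_commute power2_eq_square algebra_simps)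
        show ?thesis unfolding J_def d_def n by (simp add: add scaleR algebra_simps)
      qed
      then show ?thesis using min[of "h + t *\<^sub>R f"] by simp
    qed
    have "d = 0"
    proof (cases "f = 0")
      case True
      then show ?thesis by (simp add: d_def zero)
    next
      case False
      then have nf: "0 < (norm f)^2" by simp
      \<comment> \<open>\<open>t = - d / (norm f)^2\<close> minimises the quadratic polynomial in
        \<open>q\<close>.\<close>
      have "0 \<le> (- d / (norm f)^2)^2 * (norm f)^2 + 2 * (- d / (norm f)^2) * d" by (rule q)
      also have "\<dots> = - d\<^sup>2 / (norm f)^2" using nf by (simp add: field_simps power2_eq_square)
      finally show ?thesis using nf by (simp add: divide_le_0_iff)
    qed
    then show ?thesis by (simp add: d_def)
  qed
  \<comment> \<open>The imaginary part is read off from the real part at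
    \<open>\<i> *\<^sub>C f\<close>.\<close>
  have "\<phi> f = cinner f h" for f
    using real[of f] real[of "\<i> *\<^sub>C f"] by (simp add: complex_eq_iff Re_cinner[symmetric] cinner_scale_left \<phi>(2))
  then show ?thesis by blast
qed

lemma adjoint_op:
  assumes A: "bounded_clinear A"
  shows "cinner (A f) g = cinner f (adjoint_op A g)"
proof -
  interpret bounded_linear A using A by (simp add: bounded_clinear_def)
  obtain K where K: "\<And>f. norm (A f) \<le> norm f * K" "0 \<le> K" using nonneg_bounded by blast
  have "\<exists>h. \<forall>f. cinner (A f) g = cinner f h" for g
  proof (rule Riesz_representation)
    show "bounded_linear (\<lambda>f. cinner (A f) g)"
    proof (rule bounded_linear_intro)
      show "cinner (A (f + f')) g = cinner (A f) g + cinner (A f') g" for f f' by (simp add: add cinner_add_left)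
      show "cinner (A (r *\<^sub>R f)) g = r *\<^sub>R cinner (A f) g" for r f
        by (simp only: scaleR) (simp add: scaleR_eq_cscale cinner_scale_left scaleR_conv_of_real)
      show "norm (cinner (A f) g) \<le> norm f * (K * norm g)" for f
        using cinner_Cauchy_Schwarz[of "A f" g] mult_right_mono[OF K(1)[of f] norm_ge_zero[of g]] by (simp add: mult_ac)
    qed
    show "cinner (A (c *\<^sub>C f)) g = c * cinner (A f) g" for c f
      using A by (simp add: bounded_clinear_def cinner_scale_left)
  qed
  then obtain B where B: "\<And>f g. cinner (A f) g = cinner f (B g)" by metis
  have "adjoint_op A = B"
    unfolding adjoint_op_def
  proof (rule the_equality)
    fix B' assume B': "\<forall>f g. cinner (A f) g = cinner f (B' g)"
    show "B' = B" by (rule ext, rule cinner_ext) (use B B' in metis)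
  qed (use B in blast)
  then show ?thesis using B by simp
qed

text \<open>The adjoint is Lipschitz with the bound \<open>K\<close> of \<open>A\<close>: for the
  difference \<open>d\<close> of its values at \<open>f\<close> and \<open>g\<close>,
  \<open>(norm d)^2\<close> is \<open>cinner (A d) (f - g)\<close>.\<close>

lemma adjoint_op_tendsto:
  assumes A: "bounded_clinear A" and X: "X \<longlonglongrightarrow> x"
  shows "(\<lambda>n. adjoint_op A (X n)) \<longlonglongrightarrow> adjoint_op A x"
proof -
  interpret bounded_linear A using A by (simp add: bounded_clinear_def)
  obtain K where K: "\<And>f. norm (A f) \<le> norm f * K" "0 \<le> K" using nonneg_bounded by blast
  have "norm (adjoint_op A f - adjoint_op A g) \<le> norm (f - g) * K" for f g
  proof (cases "adjoint_op A f - adjoint_op A g = 0")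
    case True
    then show ?thesis using K(2) by simp
  next
    case False
    let ?d = "adjoint_op A f - adjoint_op A g"
    have "cinner ?d ?d = cinner (A ?d) (f - g)"
      by (subst (2) cinner_diff_right) (simp add: adjoint_op[OF A, symmetric] cinner_diff_right)
    then have "(norm ?d)^2 \<le> cmod (cinner (A ?d) (f - g))" by (simp add: norm_sq_cinner complex_Re_le_cmod)
    also have "\<dots> \<le> norm (A ?d) * norm (f - g)" by (rule cinner_Cauchy_Schwarz)
    also have "\<dots> \<le> norm ?d * K * norm (f - g)" by (intro mult_right_mono K) auto
    finally show ?thesis using False by (simp add: power2_eq_square mult_ac)
  qed
  then have le: "norm (adjoint_op A (X n) - adjoint_op A x) \<le> norm (X n - x) * K" for n .
  have "(\<lambda>n. norm (X n - x) * K) \<longlonglongrightarrow> 0" using X by (intro tendsto_mult_left_zero) (simp add: LIM_zero_iff tendsto_norm_zero)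
  then have "(\<lambda>n. adjoint_op A (X n) - adjoint_op A x) \<longlonglongrightarrow> 0"
    by (rule Lim_null_comparison[rotated]) (use le in auto)
  then show ?thesis by (simp add: LIM_zero_iff)
qed

section \<open>Singular systems of compact operators\<close>

definition orthonormal :: "'a::euclidean_space L2 set \<Rightarrow> bool" where
  "orthonormal B \<longleftrightarrow> (\<forall>b\<in>B. \<forall>b'\<in>B. cinner b b' = (if b = b' then 1 else 0))"

lemma orthonormalD:
  "orthonormal B \<Longrightarrow> b \<in> B \<Longrightarrow> b' \<in> B \<Longrightarrow> cinner b b' = (if b = b' then 1 else 0)"
  by (simp add: orthonormal_def)

lemma norm_eq_1_iff_cinner: "norm b = 1 \<longleftrightarrow> cinner b b = 1"
proof -
  have "cinner b b = 1 \<longleftrightarrow> (norm b)^2 = 1" unfolding cinner_self by (metis of_real_1 of_real_eq_iff)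
  moreover have "norm b \<noteq> - 1" using norm_ge_zero[of b] by linarith
  ultimately show ?thesis by (simp add: power2_eq_1_iff)
qed

definition proj :: "'a::euclidean_space L2 set \<Rightarrow> 'a L2 \<Rightarrow> 'a L2" where
  "proj B f = (\<Sum>b\<in>B. cinner f b *\<^sub>C b)"

lemma cinner_proj:
  assumes "finite B" "orthonormal B" "b \<in> B"
  shows "cinner (proj B f) b = cinner f b"
proof -
  have "cinner (proj B f) b = (\<Sum>b'\<in>B. cinner f b' * cinner b' b)"
    by (simp add: proj_def cinner_sum_left cinner_scale_left)
  also have "\<dots> = (\<Sum>b'\<in>B. if b' = b then cinner f b' else 0)"
    using orthonormalD[OF assms(2) _ assms(3)] by (intro sum.cong) auto
  finally show ?thesis using assms by simp
qed

lemma norm_proj: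
  assumes "finite B" "orthonormal B"
  shows "(norm (proj B f))^2 = (\<Sum>b\<in>B. (cmod (cinner f b))^2)"
proof -
  have "cinner (proj B f) (proj B f) = (\<Sum>b\<in>B. cnj (cinner f b) * cinner (proj B f) b)"
    by (subst (2) proj_def) (simp add: cinner_sum_right cinner_scale_right)
  also have "\<dots> = (\<Sum>b\<in>B. of_real ((cmod (cinner f b))^2))"
    using cinner_proj[OF assms] by (intro sum.cong refl) (simp add: complex_norm_square mult.commute del: of_real_power)
  finally show ?thesis by (simp add: norm_sq_cinner)
qed

lemma orthogonal_proj:
  assumes "finite B" "orthonormal B" "b \<in> B"
  shows "cinner (f - proj B f) b = 0"
  using cinner_proj[OF assms] by (simp add: cinner_diff_left)

lemma Bessel:
  assumes "finite B" "orthonormal B"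
  shows "(norm f)^2 = (norm (f - proj B f))^2 + (\<Sum>b\<in>B. (cmod (cinner f b))^2)"
proof -
  have "cinner (f - proj B f) (proj B f) = (\<Sum>b\<in>B. cnj (cinner f b) * cinner (f - proj B f) b)"
    by (subst (2) proj_def) (simp add: cinner_sum_right cinner_scale_right)
  then have "orthogonal (f - proj B f) (proj B f)"
    by (simp add: orthogonal_def orthogonal_proj[OF assms] flip: Re_cinner)
  from norm_add_Pythagorean[OF this] show ?thesis by (simp add: norm_proj[OF assms])
qed

lemma orthonormal_independent:
  assumes "finite B" "orthonormal B" shows "L2.independent B"
proof (rule L2.independent_if_scalars_zero[OF assms(1)])
  fix c x assume 0: "(\<Sum>b\<in>B. c b *\<^sub>C b) = 0" and x: "x \<in> B"
  have "0 = cinner (\<Sum>b\<in>B. c b *\<^sub>C b) x" by (simp add: 0)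
  also have "\<dots> = (\<Sum>b\<in>B. c b * cinner b x)" by (simp add: cinner_sum_left cinner_scale_left)
  also have "\<dots> = (\<Sum>b\<in>B. if b = x then c b else 0)"
    using orthonormalD[OF assms(2) _ x] by (intro sum.cong) auto
  finally show "c x = 0" using assms(1) x by simp
qed

section \<open>Eigenvectors of \<open>A\<^sup>*A\<close> for compact \<open>A\<close>\<close>

abbreviation gram_eigenspace :: "('a::euclidean_space L2 \<Rightarrow> 'a L2) \<Rightarrow> real \<Rightarrow> 'a L2 set" where
  "gram_eigenspace A s \<equiv> ceigenspace (adjoint_op A \<circ> A) (of_real (s^2))"

context
  fixes A :: "'a::euclidean_space L2 \<Rightarrow> 'a L2"
  assumes A: "compact_operator A"
begin

lemma compact_bounded_clinear: "bounded_clinear A" and compact_bounded_linear: "bounded_linear A"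
  using A by (auto simp: compact_operator_def bounded_clinear_def)

lemma compact_operator_cscale: "A (c *\<^sub>C f) = c *\<^sub>C A f"
  using compact_bounded_clinear by (simp add: bounded_clinear_def)

lemma cinner_gram: "cinner (adjoint_op A (A f)) g = cinner (A f) (A g)"
  using adjoint_op[OF compact_bounded_clinear, of g "A f"] cinner_commute by metis

lemma cinner_gram_right: "cinner g (adjoint_op A (A f)) = cinner (A g) (A f)"
  by (rule adjoint_op[OF compact_bounded_clinear, symmetric])

lemma gram_add: "adjoint_op A (A (f + g)) = adjoint_op A (A f) + adjoint_op A (A g)"
  by (rule cinner_ext, unfold cinner_gram_right cinner_add_right)
    (simp add: linear_add[OF bounded_linear.linear[OF compact_bounded_linear]] cinner_add_right)

lemma gram_cscale: "adjoint_op A (A (c *\<^sub>C f)) = c *\<^sub>C adjoint_op A (A f)"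
  by (rule cinner_ext, unfold cinner_gram_right cinner_scale_right) (simp add: compact_operator_cscale cinner_scale_right)

lemma compact_operator_subseq:
  assumes "\<And>n. norm (F n) \<le> 1"
  obtains r y where "strict_mono (r :: nat \<Rightarrow> nat)" "(\<lambda>n. A (F (r n))) \<longlonglongrightarrow> y"
proof -
  have "compact (closure (A ` cball 0 1))" using A by (simp add: compact_operator_def)
  moreover have "\<forall>n. (A \<circ> F) n \<in> closure (A ` cball 0 1)"
    using assms closure_subset[of "A ` cball 0 1"] by auto
  ultimately obtain l r where "strict_mono r" "((A \<circ> F) \<circ> r) \<longlonglongrightarrow> l"
    unfolding compact_def by metis
  then show ?thesis using that[of r l] by (simp add: o_def)
qed

text \<open>The maximum of the Rayleigh quotient of \<open>A\<^sup>*A\<close> on the complement of finitely many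
  eigenvectors is attained at an eigenvector: along a maximising sequence \<open>F\<close> of unit vectors
  \<open>A\<^sup>*A F - S F\<close> tends to 0, and \<open>A\<^sup>*A F\<close> has a convergent subsequence.\<close>

lemma Rayleigh_max_eigenvector:
  assumes B: "\<And>b. b \<in> B \<Longrightarrow> \<exists>\<mu>. adjoint_op A (A b) = \<mu> *\<^sub>C b"
  defines "V \<equiv> {f. \<forall>b\<in>B. cinner f b = 0}"
  assumes f0: "f0 \<in> V" "A f0 \<noteq> 0"
  obtains f s where "f \<in> V" "norm f = 1" "0 < s" "adjoint_op A (A f) = of_real (s^2) *\<^sub>C f"
    "\<And>g. g \<in> V \<Longrightarrow> (norm (A g))^2 \<le> s^2 * (norm g)^2"
proof -
  interpret bounded_linear A by (rule compact_bounded_linear)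
  obtain K where K: "0 \<le> K" "\<And>f. norm (A f) \<le> norm f * K" using nonneg_bounded by blast
  define T where "T f = adjoint_op A (A f)" for f
  have V_cscale: "c *\<^sub>C f \<in> V" if "f \<in> V" for c f using that by (simp add: V_def cinner_scale_left)
  \<comment> \<open>\<open>T\<close> is symmetric, so the complement of a set of eigenvectors is
    invariant.\<close>
  have TV: "T f \<in> V" if "f \<in> V" for f
    unfolding V_def
  proof safe
    fix b assume "b \<in> B"
    then obtain \<mu> where "adjoint_op A (A b) = \<mu> *\<^sub>C b" using B by blast
    then have "cinner (T f) b = cnj \<mu> * cinner f b"
      unfolding T_def cinner_gram using cinner_gram_right[of f b] by (simp add: cinner_scale_right)
    then show "cinner (T f) b = 0" using that \<open>b \<in> B\<close> by (simp add: V_def)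
  qed
  define Q where "Q = (\<lambda>f. (norm (A f))^2) ` {f \<in> V. norm f = 1}"
  define S where "S = Sup Q"
  have bdd: "bdd_above Q"
  proof (rule bdd_aboveI)
    fix q assume "q \<in> Q"
    then obtain f where "q = (norm (A f))^2" "norm f = 1" by (auto simp: Q_def)
    then show "q \<le> K^2" using K(2)[of f] by (auto intro: power_mono)
  qed
  have normalize: "norm (of_real (1 / norm g) *\<^sub>C g) = 1" if "g \<noteq> 0" for g :: "'a L2"
    using that by (simp add: norm_cscale norm_divide)
  have le: "(norm (A g))^2 \<le> S * (norm g)^2" if g: "g \<in> V" for g
  proof (cases "g = 0")
    case False
    have "(norm (A (of_real (1 / norm g) *\<^sub>C g)))^2 \<le> S"
      unfolding S_def using g False normalize V_cscale by (intro cSup_upper bdd) (auto simp: Q_def)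
    then show ?thesis using False by (simp add: compact_operator_cscale norm_cscale norm_divide power_divide divide_le_eq)
  qed (simp add: zero)
  have f0n: "f0 \<noteq> 0" using f0 zero by auto
  have S: "0 < S"
  proof -
    have "0 < (norm (A f0))^2" using f0 by simp
    also have "\<dots> \<le> S * (norm f0)^2" by (rule le[OF f0(1)])
    finally show ?thesis using f0n by (simp add: zero_less_mult_iff)
  qed
  have Qne: "Q \<noteq> {}" using normalize[OF f0n] V_cscale[OF f0(1)] unfolding Q_def by blast
  have "\<exists>f. f \<in> V \<and> norm f = 1 \<and> S - 1 / real (Suc n) < (norm (A f))^2" for n
    using less_cSupD[OF Qne, of "S - 1 / real (Suc n)"] unfolding S_def[symmetric] by (auto simp: Q_def)
  then obtain F where F: "\<And>n. F n \<in> V" "\<And>n. norm (F n) = 1" "\<And>n. S - 1 / real (Suc n) < (norm (A (F n)))^2"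
    by metis
  obtain r y where r: "strict_mono (r :: nat \<Rightarrow> nat)" and y: "(\<lambda>n. A (F (r n))) \<longlonglongrightarrow> y"
    using compact_operator_subseq[of F] F(2) by (metis order_refl)
  have TF: "(\<lambda>n. T (F (r n))) \<longlonglongrightarrow> adjoint_op A y"
    unfolding T_def by (rule adjoint_op_tendsto[OF compact_bounded_clinear y])
  \<comment> \<open>Cauchy-Schwarz together with \<open>le\<close> at the vector \<open>T f\<close>.
    In \<open>diff\<close> it bounds the defect \<open>T F - S F\<close> by the gap between
    \<open>S\<close> and the Rayleigh quotient of \<open>F\<close>.\<close>
  have Tn: "(norm (T f))^2 \<le> S * (norm (A f))^2" if f: "f \<in> V" for f
  proof (cases "T f = 0")
    case True
    then show ?thesis using S by simp
  next
    case False
    have "cinner (T f) (T f) = cinner (A f) (A (T f))" by (subst T_def) (rule cinner_gram)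
    then have "(norm (T f))^2 \<le> cmod (cinner (A f) (A (T f)))"
      by (simp add: norm_sq_cinner complex_Re_le_cmod)
    also have "\<dots> \<le> norm (A f) * norm (A (T f))" by (rule cinner_Cauchy_Schwarz)
    finally have "((norm (T f))^2)^2 \<le> (norm (A f) * norm (A (T f)))^2" by (intro power_mono) auto
    also have "\<dots> \<le> (norm (A f))^2 * (S * (norm (T f))^2)"
      unfolding power_mult_distrib by (intro mult_left_mono le TV f) auto
    finally show ?thesis using False by (simp add: power2_eq_square mult_ac)
  qed
  have diff: "(norm (T (F n) - of_real S *\<^sub>C F n))^2 \<le> S / real (Suc n)" for n
  proof -
    have c: "cinner (T (F n)) (F n) = of_real ((norm (A (F n)))^2)"
      unfolding T_def cinner_gram cinner_self ..
    then have c': "cinner (F n) (T (F n)) = of_real ((norm (A (F n)))^2)"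
      by (metis cinner_commute complex_cnj_complex_of_real)
    have "(norm (T (F n) - of_real S *\<^sub>C F n))^2 = (norm (T (F n)))^2 - 2 * S * (norm (A (F n)))^2 + S^2"
      unfolding norm_sq_cinner[of "T (F n) - _"] cinner_diff_left cinner_diff_right cinner_scale_left cinner_scale_right c c'
      by (simp add: cinner_self F power2_eq_square algebra_simps)
    also have "\<dots> \<le> S * (S - (norm (A (F n)))^2)" using Tn[OF F(1)[of n]] by (simp add: algebra_simps power2_eq_square)
    also have "\<dots> \<le> S * (1 / real (Suc n))" using F(3)[of n] S by (intro mult_left_mono) auto
    finally show ?thesis by simp
  qed
  have lim0: "(\<lambda>n. T (F (r n)) - of_real S *\<^sub>C F (r n)) \<longlonglongrightarrow> 0"
  proof -
    have "(\<lambda>n. S / real (Suc n)) \<longlonglongrightarrow> 0" using tendsto_mult_right_zero[OF LIMSEQ_Suc[OF lim_1_over_n], of S] by simp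
    then have "(\<lambda>n. (norm (T (F n) - of_real S *\<^sub>C F n))^2) \<longlonglongrightarrow> 0"
      by (rule Lim_null_comparison[rotated]) (use diff in auto)
    then have "(\<lambda>n. sqrt ((norm (T (F n) - of_real S *\<^sub>C F n))^2)) \<longlonglongrightarrow> sqrt 0" by (intro tendsto_real_sqrt)
    then have "(\<lambda>n. norm (T (F n) - of_real S *\<^sub>C F n)) \<longlonglongrightarrow> 0" by simp
    then have "(\<lambda>n. T (F n) - of_real S *\<^sub>C F n) \<longlonglongrightarrow> 0" by (rule tendsto_norm_zero_cancel)
    from LIMSEQ_subseq_LIMSEQ[OF this r] show ?thesis by (simp add: o_def)
  qed
  \<comment> \<open>Because \<open>S F = T F - (T F - S F)\<close>, the maximising sequence itself
    converges along \<open>r\<close>, and this is its limit.\<close>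
  define f where "f = (1 / S) *\<^sub>R adjoint_op A y"
  have Ff: "(\<lambda>n. F (r n)) \<longlonglongrightarrow> f"
  proof -
    have "(\<lambda>n. (1 / S) *\<^sub>R (T (F (r n)) - (T (F (r n)) - of_real S *\<^sub>C F (r n)))) \<longlonglongrightarrow> (1 / S) *\<^sub>R (adjoint_op A y - 0)"
      by (intro tendsto_intros TF lim0)
    moreover have "(1 / S) *\<^sub>R (T (F (r n)) - (T (F (r n)) - of_real S *\<^sub>C F (r n))) = F (r n)" for n
      using S by (simp add: scaleR_eq_cscale)
    ultimately show ?thesis by (simp add: f_def)
  qed
  have fV: "f \<in> V"
    unfolding V_def
  proof safe
    fix b assume b: "b \<in> B"
    have "(\<lambda>n. cinner (F (r n)) b) \<longlonglongrightarrow> cinner f b" by (intro tendsto_intros Ff)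
    moreover have "cinner (F (r n)) b = 0" for n using F(1)[of "r n"] b by (simp add: V_def)
    ultimately show "cinner f b = 0" using LIMSEQ_unique[OF _ tendsto_const] by fastforce
  qed
  have fn: "norm f = 1"
  proof -
    have "(\<lambda>n. norm (F (r n))) \<longlonglongrightarrow> norm f" by (intro tendsto_intros Ff)
    then show ?thesis unfolding F(2) using LIMSEQ_unique tendsto_const by blast
  qed
  have Tf: "T f = of_real ((sqrt S)^2) *\<^sub>C f"
  proof -
    have "(\<lambda>n. T (F (r n))) \<longlonglongrightarrow> T f" unfolding T_def by (intro adjoint_op_tendsto[OF compact_bounded_clinear] tendsto Ff)
    then have "T f = adjoint_op A y" using TF LIMSEQ_unique by blast
    then show ?thesis using S by (simp add: f_def scaleR_eq_cscale)
  qed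
  show ?thesis
    by (rule that[of f "sqrt S"]) (use fV fn S Tf le in \<open>auto simp: T_def\<close>)
qed

lemma gram_eigen_norm:
  assumes "f \<in> gram_eigenspace A s"
  shows "(norm (A f))^2 = s^2 * (norm f)^2"
proof -
  have "cinner (A f) (A f) = of_real (s^2) * cinner f f"
    using assms cinner_gram[of f f] by (simp add: ceigenspace_def cinner_scale_left)
  then show ?thesis by (simp add: norm_sq_cinner Re_complex_of_real del: of_real_power)
qed

lemma ceigenspace_diff_proj:
  assumes "B \<subseteq> ceigenspace (adjoint_op A \<circ> A) \<mu>" "f \<in> ceigenspace (adjoint_op A \<circ> A) \<mu>"
  shows "f - proj B f \<in> ceigenspace (adjoint_op A \<circ> A) \<mu>"
proof -
  have "L2.subspace (ceigenspace (adjoint_op A \<circ> A) \<mu>)"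
    unfolding L2.subspace_def ceigenspace_def
    using gram_add gram_cscale gram_cscale[of 0 0]
    by (auto simp: L2.scale_right_distrib mult.commute)
  then show ?thesis unfolding proj_def
    using assms by (intro L2.subspace_diff L2.subspace_sum L2.subspace_scale) auto
qed

text \<open>A maximal orthonormal subset, from Zorn's lemma. It is finite by compactness: distinct
  members have images at distance \<open>s * sqrt 2\<close>, so an infinite set would give images
  without convergent subsequence. Finiteness lets \<open>card B\<close> agree with the dimension
  used in \<open>singular_mult\<close>.\<close>

lemma eigenspace_basis:
  assumes s: "0 < s"
  obtains B where "finite B" "orthonormal B" "B \<subseteq> gram_eigenspace A s"
    "card B = singular_mult A s"
    "\<And>f. f \<in> gram_eigenspace A s \<Longrightarrow> (\<And>b. b \<in> B \<Longrightarrow> cinner f b = 0) \<Longrightarrow> f = 0"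
proof -
  interpret bounded_linear A by (rule compact_bounded_linear)
  let ?E = "gram_eigenspace A s"
  define \<A> where "\<A> = {B. B \<subseteq> ?E \<and> orthonormal B}"
  have fin: "finite B" if "B \<in> \<A>" for B
  proof (rule ccontr)
    assume "infinite B"
    then obtain b :: "nat \<Rightarrow> 'a L2" where b: "inj b" "range b \<subseteq> B" using infinite_countable_subset by blast
    have bE: "b n \<in> ?E" for n using b that by (auto simp: \<A>_def)
    have on: "cinner (b m) (b n) = (if m = n then 1 else 0)" for m n
    proof -
      have "b m \<in> B" "b n \<in> B" "orthonormal B" using b that by (auto simp: \<A>_def)
      then show ?thesis using orthonormalD[of B "b m" "b n"] inj_eq[OF b(1)] by simp
    qed
    have nb: "norm (b n) = 1" for n using on[of n n] by (simp add: norm_eq_1_iff_cinner)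
    have E_diff: "b m - b n \<in> ?E" for m n
      using bE[of m] bE[of n] gram_add[of "b m" "(-1) *\<^sub>C b n"] gram_cscale[of "-1" "b n"]
      by (simp add: ceigenspace_def L2.scale_right_diff_distrib)
    have far: "(norm (A (b m) - A (b n)))^2 = 2 * s^2" if "m \<noteq> n" for m n
    proof -
      have "(norm (b m - b n))^2 = 2"
        unfolding norm_sq_cinner using that by (simp add: cinner_diff_left cinner_diff_right on)
      then show ?thesis using gram_eigen_norm[OF E_diff, of m n] by (simp add: diff)
    qed
    obtain r y where r: "strict_mono (r :: nat \<Rightarrow> nat)" and y: "(\<lambda>n. A (b (r n))) \<longlonglongrightarrow> y"
      using compact_operator_subseq[of b] nb by (metis order_refl)
    have "Cauchy (\<lambda>n. A (b (r n)))" using y by (rule LIMSEQ_imp_Cauchy)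
    then obtain M where "\<And>m n. M \<le> m \<Longrightarrow> M \<le> n \<Longrightarrow> norm (A (b (r m)) - A (b (r n))) < s"
      using CauchyD s by metis
    then have "norm (A (b (r M)) - A (b (r (Suc M)))) < s" by simp
    then have "(norm (A (b (r M)) - A (b (r (Suc M)))))^2 < s^2" by (intro power_strict_mono) auto
    moreover have "r M \<noteq> r (Suc M)" using r by (metis lessI less_irrefl strict_monoD)
    ultimately show False using far s by (simp add: zero_less_power)
  qed
  have "\<exists>B\<in>\<A>. \<forall>X\<in>\<A>. B \<subseteq> X \<longrightarrow> X = B"
  proof (rule Zorn_Lemma2, rule ballI)
    fix \<C> assume "\<C> \<in> chains \<A>"
    then have C: "\<C> \<subseteq> \<A>" "\<And>X Y. X \<in> \<C> \<Longrightarrow> Y \<in> \<C> \<Longrightarrow> X \<subseteq> Y \<or> Y \<subseteq> X"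
      by (auto simp: chains_def chain_subset_def)
    have "orthonormal (\<Union>\<C>)"
      unfolding orthonormal_def
    proof (intro ballI)
      fix b b' assume "b \<in> \<Union>\<C>" "b' \<in> \<Union>\<C>"
      then obtain X Y where "b \<in> X" "b' \<in> Y" "X \<in> \<C>" "Y \<in> \<C>" by blast
      then obtain Z where "Z \<in> \<C>" "b \<in> Z" "b' \<in> Z" using C(2) by blast
      then show "cinner b b' = (if b = b' then 1 else 0)" using C(1) orthonormalD[of Z] by (auto simp: \<A>_def)
    qed
    then have "\<Union>\<C> \<in> \<A>" using C(1) by (auto simp: \<A>_def)
    then show "\<exists>U\<in>\<A>. \<forall>X\<in>\<C>. X \<subseteq> U" by blast
  qed
  then obtain B where B: "B \<in> \<A>" "\<And>X. X \<in> \<A> \<Longrightarrow> B \<subseteq> X \<Longrightarrow> X = B" by blast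
  have Bf: "finite B" "orthonormal B" "B \<subseteq> ?E" using fin[OF B(1)] B(1) by (auto simp: \<A>_def)
  have max: "f = 0" if f: "f \<in> ?E" "\<And>b. b \<in> B \<Longrightarrow> cinner f b = 0" for f
  proof (rule ccontr)
    assume f0: "f \<noteq> 0"
    define g where "g = of_real (1 / norm f) *\<^sub>C f"
    have ng: "norm g = 1" using f0 by (simp add: g_def norm_cscale norm_divide)
    have g1: "cinner g g = 1" using ng norm_eq_1_iff_cinner by blast
    have gb: "cinner g b = 0" "cinner b g = 0" if "b \<in> B" for b
      using f(2)[OF that] cinner_commute[of b f] by (simp_all add: g_def cinner_scale_left cinner_scale_right)
    have "g \<in> ?E" using f(1) by (simp add: g_def ceigenspace_def gram_cscale mult.commute)
    moreover have "orthonormal (insert g B)"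
      using Bf(2) g1 gb by (auto simp: orthonormal_def)
    ultimately have "insert g B \<in> \<A>" using Bf(3) by (simp add: \<A>_def)
    then have "g \<in> B" using B(2) by blast
    then show False using gb[of g] g1 by simp
  qed
  have span: "?E \<subseteq> L2.span B"
  proof
    fix f assume f: "f \<in> ?E"
    have "f - proj B f = 0"
      by (rule max[OF ceigenspace_diff_proj[OF Bf(3) f]]) (rule orthogonal_proj[OF Bf(1,2)])
    then have "f = proj B f" by simp
    also have "proj B f \<in> L2.span B"
      unfolding proj_def by (intro L2.span_sum L2.span_scale L2.span_base)
    finally show "f \<in> L2.span B" .
  qed
  have "singular_mult A s = card B"
    unfolding singular_mult_def
    by (rule L2.dim_unique[OF Bf(3) span orthonormal_independent[OF Bf(1,2)] refl])
  then show ?thesis using that[OF Bf] max by simp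
qed

end

lemma gram_eigen_cinner:
  assumes A: "compact_operator A" and b: "b \<in> gram_eigenspace A s"
  shows "cinner (A f) (A b) = of_real (s^2) * cinner f b"
  using b cinner_gram_right[OF A, of f b] by (simp add: ceigenspace_def cinner_scale_right)

text \<open>Eigenvectors of \<open>A\<^sup>*A\<close> in \<open>B\<close> are orthogonal for
  \<open>cinner (A f) (A g)\<close> too, and so is the complement of \<open>B\<close> to them; hence
  Pythagoras applies to the images. The function \<open>e\<close> admits different eigenvalues
  within one set \<open>B\<close>.\<close>

lemma norm_gram_decomposition:
  assumes A: "compact_operator A" and B: "finite B" "orthonormal B"
    and e: "\<And>b. b \<in> B \<Longrightarrow> b \<in> gram_eigenspace A (e b)"
  shows "(norm (A f))^2 = (norm (A (f - proj B f)))^2 + (\<Sum>b\<in>B. (e b)^2 * (cmod (cinner f b))^2)"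
proof -
  interpret bounded_linear A by (rule compact_bounded_linear[OF A])
  have Ap: "A (proj B f) = (\<Sum>b\<in>B. cinner f b *\<^sub>C A b)"
    unfolding proj_def by (simp add: sum compact_operator_cscale[OF A])
  have gp: "cinner (A g) (A (proj B f)) = (\<Sum>b\<in>B. cnj (cinner f b) * (of_real ((e b)^2) * cinner g b))" for g
    unfolding Ap cinner_sum_right cinner_scale_right
    by (intro sum.cong refl) (simp only: gram_eigen_cinner[OF A e])
  have "cinner (A (f - proj B f)) (A (proj B f)) = 0"
    unfolding gp by (intro sum.neutral ballI) (simp add: orthogonal_proj[OF B])
  then have o: "orthogonal (A (f - proj B f)) (A (proj B f))" by (simp add: orthogonal_def flip: Re_cinner)
  have "cinner (A (proj B f)) (A (proj B f)) = of_real (\<Sum>b\<in>B. (e b)^2 * (cmod (cinner f b))^2)"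
    unfolding gp of_real_sum of_real_mult complex_norm_square
    by (intro sum.cong refl) (simp add: cinner_proj[OF B])
  then have "(norm (A (proj B f)))^2 = (\<Sum>b\<in>B. (e b)^2 * (cmod (cinner f b))^2)" by (simp add: norm_sq_cinner)
  then show ?thesis using norm_add_Pythagorean[OF o] by (simp add: diff)
qed

text \<open>A singular value decomposition cut at \<open>\<delta>\<close>, which avoids infinite
  expansions. After projecting off the eigenvectors for \<open>s \<ge> \<delta>\<close>, the maximal
  Rayleigh quotient on the complement is attained at an eigenvector whose singular value is below
  \<open>\<delta>\<close>.\<close>

lemma singular_system:
  assumes A: "compact_operator A"
  shows "\<exists>B. (\<forall>s>0. finite (B s) \<and> orthonormal (B s) \<and> card (B s) = singular_mult A s) \<and>
    (\<forall>s\<in>singular_values A. B s \<noteq> {}) \<and>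
    (\<forall>F f. finite F \<longrightarrow> F \<subseteq> singular_values A \<longrightarrow> (\<Sum>s\<in>F. \<Sum>b\<in>B s. (cmod (cinner f b))^2) \<le> (norm f)^2) \<and>
    (\<forall>\<delta> f. 0 < \<delta> \<longrightarrow> finite {s \<in> singular_values A. \<delta> \<le> s} \<longrightarrow>
      (norm (A f))^2 \<le> (\<Sum>s | s \<in> singular_values A \<and> \<delta> \<le> s. s^2 * (\<Sum>b\<in>B s. (cmod (cinner f b))^2)) + \<delta>^2 * (norm f)^2)"
proof -
  interpret bounded_linear A by (rule compact_bounded_linear[OF A])
  let ?E = "gram_eigenspace A"
  have "\<exists>B. 0 < s \<longrightarrow> finite B \<and> orthonormal B \<and> B \<subseteq> ?E s \<and> card B = singular_mult A s \<and>
      (\<forall>f\<in>?E s. (\<forall>b\<in>B. cinner f b = 0) \<longrightarrow> f = 0)" for s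
  proof (cases "0 < s")
    case True
    from eigenspace_basis[OF A True] show ?thesis by metis
  qed simp
  then obtain B where B0: "\<And>s. 0 < s \<longrightarrow> finite (B s) \<and> orthonormal (B s) \<and> B s \<subseteq> ?E s \<and>
      card (B s) = singular_mult A s \<and> (\<forall>f\<in>?E s. (\<forall>b\<in>B s. cinner f b = 0) \<longrightarrow> f = 0)"
    using choice[of "\<lambda>s B. 0 < s \<longrightarrow> finite B \<and> orthonormal B \<and> B \<subseteq> ?E s \<and>
      card B = singular_mult A s \<and> (\<forall>f\<in>?E s. (\<forall>b\<in>B. cinner f b = 0) \<longrightarrow> f = 0)"] by blast
  then have B: "\<And>s. 0 < s \<Longrightarrow> finite (B s)" "\<And>s. 0 < s \<Longrightarrow> orthonormal (B s)"
      "\<And>s. 0 < s \<Longrightarrow> B s \<subseteq> ?E s" "\<And>s. 0 < s \<Longrightarrow> card (B s) = singular_mult A s"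
      "\<And>s f. 0 < s \<Longrightarrow> f \<in> ?E s \<Longrightarrow> (\<And>b. b \<in> B s \<Longrightarrow> cinner f b = 0) \<Longrightarrow> f = 0"
    by blast+
  have pos: "0 < s" if "s \<in> singular_values A" for s using that by (simp add: singular_values_def)
  have orth: "cinner b b' = 0" if "0 < s" "0 < s'" "s \<noteq> s'" "b \<in> B s" "b' \<in> B s'" for s s' b b'
  proof -
    have bE: "b \<in> ?E s" and b'E: "b' \<in> ?E s'" using that B(3) by blast+
    have "cinner (A b) (A b') = of_real (s^2) * cinner b b'"
      using gram_eigen_cinner[OF A bE, of b'] cinner_commute[of "A b" "A b'"] cinner_commute[of b b'] by simp
    moreover have "cinner (A b) (A b') = of_real (s'^2) * cinner b b'" by (rule gram_eigen_cinner[OF A b'E])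
    ultimately have "complex_of_real (s^2) * cinner b b' = of_real (s'^2) * cinner b b'" by metis
    then have "complex_of_real (s^2 - s'^2) * cinner b b' = 0" by (simp only: of_real_diff left_diff_distrib) simp
    then have "s^2 - s'^2 = 0 \<or> cinner b b' = 0" unfolding mult_eq_0_iff of_real_eq_0_iff .
    moreover have "s^2 \<noteq> s'^2" using that by simp
    ultimately show ?thesis by simp
  qed
  have disj: "B s \<inter> B s' = {}" if "0 < s" "0 < s'" "s \<noteq> s'" for s s'
    using orth[OF that] orthonormalD[OF B(2)[OF that(1)]] by force
  define U where "U F = (\<Union>s\<in>F. B s)" for F
  have U: "finite (U F)" "orthonormal (U F)" if "finite F" "F \<subseteq> singular_values A" for F
  proof -
    show "finite (U F)" unfolding U_def using that pos B(1) by blast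
    show "orthonormal (U F)"
      unfolding orthonormal_def U_def
    proof (intro ballI, elim UN_E)
      fix b b' s s' assume "s \<in> F" "b \<in> B s" "s' \<in> F" "b' \<in> B s'"
      moreover from this have "0 < s" "0 < s'" using that pos by blast+
      ultimately show "cinner b b' = (if b = b' then 1 else 0)"
        using orth[of s s' b b'] disj[of s s'] orthonormalD[OF B(2), of s b b'] by (cases "s = s'") auto
    qed
  qed
  have sumU: "(\<Sum>b\<in>U F. h b) = (\<Sum>s\<in>F. \<Sum>b\<in>B s. h b)" if "finite F" "F \<subseteq> singular_values A" for F and h :: "'a L2 \<Rightarrow> real"
    unfolding U_def using that pos B(1) disj by (intro sum.UNION_disjoint) blast+
  show ?thesis
  proof (intro exI[of _ B] conjI[of "\<forall>s>0. _ s"] conjI[of "\<forall>s\<in>singular_values A. _ s"] conjI[of "\<forall>F f. _ F f"] allI ballI impI)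
    show "finite (B s) \<and> orthonormal (B s) \<and> card (B s) = singular_mult A s" if "0 < s" for s
      using B that by blast
    show "B s \<noteq> {}" if "s \<in> singular_values A" for s
    proof
      assume "B s = {}"
      then have "\<And>f. f \<in> ?E s \<Longrightarrow> f = 0" using B(5)[OF pos[OF that]] by blast
      moreover have "0 \<in> ?E s" using gram_cscale[OF A, of 0 0] by (simp add: ceigenspace_def)
      ultimately have "?E s = {0}" by blast
      then show False using that by (simp add: singular_values_def)
    qed
    show "(\<Sum>s\<in>F. \<Sum>b\<in>B s. (cmod (cinner f b))^2) \<le> (norm f)^2" if "finite F" "F \<subseteq> singular_values A" for F f
      unfolding sumU[OF that, symmetric] Bessel[OF U[OF that], of f] by simp
    fix \<delta> :: real and f
    assume \<delta>: "0 < \<delta>" and fin: "finite {s \<in> singular_values A. \<delta> \<le> s}"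
    define F where "F = {s \<in> singular_values A. \<delta> \<le> s}"
    have F: "finite F" "F \<subseteq> singular_values A" using fin by (auto simp: F_def)
    \<comment> \<open>Bases of different eigenspaces are disjoint, so the choice is unique for
      \<open>b\<close> in \<open>U F\<close>.\<close>
    define e where "e b = (SOME s. s \<in> F \<and> b \<in> B s)" for b
    have e: "e b = s" if "s \<in> F" "b \<in> B s" for s b
      unfolding e_def using that disj[of s] F(2) pos by (intro some_equality) blast+
    have eE: "b \<in> ?E (e b)" if bU: "b \<in> U F" for b
    proof -
      obtain s where s: "s \<in> F" "b \<in> B s" using bU by (auto simp: U_def)
      then show ?thesis using e[OF s] B(3)[of s] pos F(2) by blast
    qed
    have "(norm (A f))^2 = (norm (A (f - proj (U F) f)))^2 + (\<Sum>b\<in>U F. (e b)^2 * (cmod (cinner f b))^2)"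
      by (rule norm_gram_decomposition[OF A U[OF F] eE])
    also have "(\<Sum>b\<in>U F. (e b)^2 * (cmod (cinner f b))^2) = (\<Sum>s\<in>F. \<Sum>b\<in>B s. s^2 * (cmod (cinner f b))^2)"
      unfolding sumU[OF F] using e by (intro sum.cong refl) simp
    also have "\<dots> = (\<Sum>s\<in>F. s^2 * (\<Sum>b\<in>B s. (cmod (cinner f b))^2))" by (simp add: sum_distrib_left)
    also have "(norm (A (f - proj (U F) f)))^2 \<le> \<delta>^2 * (norm f)^2"
    proof (cases "A (f - proj (U F) f) = 0")
      case True
      then show ?thesis by simp
    next
      case False
      define h where "h = f - proj (U F) f"
      have hV: "h \<in> {f. \<forall>b\<in>U F. cinner f b = 0}" using orthogonal_proj[OF U[OF F]] by (simp add: h_def)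
      have ev: "\<exists>\<mu>. adjoint_op A (A b) = \<mu> *\<^sub>C b" if "b \<in> U F" for b
        using eE[OF that] by (auto simp: ceigenspace_def)
      obtain g s where g: "\<forall>b\<in>U F. cinner g b = 0" "norm g = 1" "0 < s"
          "adjoint_op A (A g) = of_real (s^2) *\<^sub>C g"
        and max: "\<And>k. k \<in> {f. \<forall>b\<in>U F. cinner f b = 0} \<Longrightarrow> (norm (A k))^2 \<le> s^2 * (norm k)^2"
        using Rayleigh_max_eigenvector[OF A ev hV] False unfolding h_def by auto
      have gE: "g \<in> ?E s" using g(4) by (simp add: ceigenspace_def)
      have g0: "g \<noteq> 0" using g(2) by auto
      have s: "s \<in> singular_values A" using gE g0 g(3) by (auto simp: singular_values_def)
      \<comment> \<open>A singular value \<open>s \<ge> \<delta>\<close> has its whole eigenbasis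
        inside \<open>U F\<close>, to which \<open>g\<close> is orthogonal.\<close>
      have "s < \<delta>"
      proof (rule ccontr)
        assume "\<not> s < \<delta>"
        then have "s \<in> F" using s by (simp add: F_def)
        then have "g = 0" using g(1) by (intro B(5)[OF g(3) gE]) (auto simp: U_def)
        then show False using g0 by simp
      qed
      then have "s^2 \<le> \<delta>^2" using g(3) by (intro power_mono) auto
      moreover have "(norm h)^2 \<le> (norm f)^2"
        unfolding Bessel[OF U[OF F], of f] h_def by (simp add: sum_nonneg)
      ultimately have "s^2 * (norm h)^2 \<le> \<delta>^2 * (norm f)^2" by (intro mult_mono) auto
      then show ?thesis using max[OF hV] by (simp add: h_def)
    qed
    finally show "(norm (A f))^2 \<le> (\<Sum>s | s \<in> singular_values A \<and> \<delta> \<le> s. s^2 * (\<Sum>b\<in>B s. (cmod (cinner f b))^2)) + \<delta>^2 * (norm f)^2"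
      by (simp add: F_def)
  qed
qed

lemma summable_on_finite_superlevel:
  fixes a :: "'b \<Rightarrow> real"
  assumes "a summable_on X" "\<And>x. x \<in> X \<Longrightarrow> 0 \<le> a x" "0 < \<epsilon>"
  shows "finite {x \<in> X. \<epsilon> \<le> a x}"
proof (rule ccontr)
  assume inf: "infinite {x \<in> X. \<epsilon> \<le> a x}"
  obtain n :: nat where n: "infsum a X / \<epsilon> < real n" using reals_Archimedean2 by blast
  obtain Y where Y: "Y \<subseteq> {x \<in> X. \<epsilon> \<le> a x}" "finite Y" "card Y = n"
    using infinite_arbitrarily_large[OF inf] by blast
  have "real n * \<epsilon> = (\<Sum>x\<in>Y. \<epsilon>)" using Y by simp
  also have "\<dots> \<le> sum a Y" using Y by (intro sum_mono) auto
  also have "\<dots> \<le> infsum a X"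
    using Y assms by (intro finite_sum_le_infsum) auto
  finally show False using n assms(3) by (simp add: field_simps)
qed

lemma summable_on_small_tail:
  fixes a :: "'b \<Rightarrow> real"
  assumes "a summable_on X" "\<And>x. x \<in> X \<Longrightarrow> 0 \<le> a x" "0 < \<epsilon>"
  obtains F where "finite F" "F \<subseteq> X" "\<And>G. finite G \<Longrightarrow> G \<subseteq> X - F \<Longrightarrow> sum a G \<le> \<epsilon>"
proof -
  obtain F where F: "finite F" "F \<subseteq> X" "dist (sum a F) (infsum a X) \<le> \<epsilon>"
    using infsum_finite_approximation[OF assms(1,3)] by blast
  have "sum a G \<le> \<epsilon>" if "finite G" "G \<subseteq> X - F" for G
  proof -
    have "sum a F + sum a G = sum a (F \<union> G)" using F that by (intro sum.union_disjoint[symmetric]) auto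
    also have "\<dots> \<le> infsum a X" using F that assms by (intro finite_sum_le_infsum) auto
    finally show ?thesis using F(3) by (simp add: dist_real_def)
  qed
  then show ?thesis using that F by blast
qed

section \<open>Strong continuity and Moyal's inequality\<close>

text \<open>An open superset \<open>U\<close> of \<open>A\<close> handles the shifted indicator: a point of \<open>A\<close> that leaves \<open>A\<close>
  either stays in \<open>U - A\<close>, which is small, or leaves the open set \<open>U\<close>, which happens for no
  fixed point as the shift tends to 0.\<close>

lemma indicator_shift_tendsto:
  fixes A :: "'a::euclidean_space set"
  assumes A: "A \<in> sets borel" "emeasure lborel A < \<infinity>" and X: "X \<longlonglongrightarrow> 0"
  shows "(\<lambda>n. LBINT t. indicator A t * (1 - indicator A (t + X n) :: real)) \<longlonglongrightarrow> 0"
proof (rule LIMSEQ_I)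
  fix \<epsilon> :: real assume \<epsilon>: "0 < \<epsilon>"
  have [measurable]: "A \<in> sets borel" by (rule A)
  have iA: "integrable lborel (indicator A :: 'a \<Rightarrow> real)" using A by simp
  obtain U where U: "open U" "A \<subseteq> U" "emeasure lborel (U - A) < ennreal (\<epsilon> / 2)"
    using outer_regular_lborel[OF A(1), of "\<epsilon> / 2"] \<epsilon> by auto
  have [measurable]: "U \<in> sets borel" using U(1) by simp
  have fUA: "emeasure lborel (U - A) < \<infinity>" using U(3) by (rule order.strict_trans) simp
  have iUA: "integrable lborel (indicator (U - A) :: 'a \<Rightarrow> real)"
    using fUA by simp
  have mUA: "measure lborel (U - A) < \<epsilon> / 2"
  proof -
    have "emeasure lborel (U - A) = ennreal (measure lborel (U - A))"
      using fUA by (intro emeasure_eq_ennreal_measure) auto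
    then show ?thesis using U(3) by (simp add: ennreal_less_iff)
  qed
  have "(\<lambda>n. LBINT t. indicator A t * (1 - indicator U (t + X n) :: real)) \<longlonglongrightarrow> (LINT t|(lborel::'a measure). 0)"
  proof (rule integral_dominated_convergence[where w = "indicator A"])
    show "AE t in lborel. (\<lambda>n. indicator A t * (1 - indicator U (t + X n) :: real)) \<longlonglongrightarrow> 0"
    proof (rule AE_I2)
      fix t :: 'a
      show "(\<lambda>n. indicator A t * (1 - indicator U (t + X n) :: real)) \<longlonglongrightarrow> 0"
      proof (cases "t \<in> A")
        case True
        have "(\<lambda>n. t + X n) \<longlonglongrightarrow> t + 0" by (intro tendsto_intros X)
        then have "\<forall>\<^sub>F n in sequentially. t + X n \<in> U"
          using topological_tendstoD[OF _ U(1)] True U(2) by fastforce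
        then have "\<forall>\<^sub>F n in sequentially. indicator A t * (1 - indicator U (t + X n) :: real) = 0"
          by eventually_elim simp
        then show ?thesis by (rule tendsto_eventually)
      qed simp
    qed
  qed (use iA in \<open>auto simp: indicator_def\<close>)
  then have "(\<lambda>n. LBINT t. indicator A t * (1 - indicator U (t + X n) :: real)) \<longlonglongrightarrow> 0" by simp
  from LIMSEQ_D[OF this, of "\<epsilon> / 2"] \<epsilon>
  obtain n0 where n0: "\<And>n. n0 \<le> n \<Longrightarrow> (LBINT t. indicator A t * (1 - indicator U (t + X n) :: real)) < \<epsilon> / 2"
    by (auto simp: abs_less_iff)
  have "norm ((LBINT t. indicator A t * (1 - indicator A (t + X n) :: real)) - 0) < \<epsilon>" if "n0 \<le> n" for n
  proof -
    have i1: "integrable lborel (\<lambda>t. indicator A t * (1 - indicator V (t + X n) :: real))" if [measurable]: "V \<in> sets borel" for V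
      by (rule Bochner_Integration.integrable_bound[OF iA]) (auto simp: indicator_def)
    have i2: "integrable lborel (\<lambda>t. indicator (U - A) (t + X n) :: real)" by (rule lborel_integrable_shift[OF iUA])
    have "(LBINT t. indicator A t * (1 - indicator A (t + X n) :: real))
        \<le> (LBINT t. indicator A t * (1 - indicator U (t + X n)) + indicator (U - A) (t + X n))"
      by (rule integral_mono[OF i1 Bochner_Integration.integrable_add[OF i1 i2]]) (auto simp: indicator_def)
    also have "\<dots> = (LBINT t. indicator A t * (1 - indicator U (t + X n))) + (LBINT t. indicator (U - A) (t + X n))"
      by (rule Bochner_Integration.integral_add[OF i1 i2]) simp
    also have "(LBINT t. indicator (U - A) (t + X n) :: real) = measure lborel (U - A)"
      by (subst lborel_integral_shift) auto
    also have "(LBINT t. indicator A t * (1 - indicator U (t + X n))) + measure lborel (U - A) < \<epsilon>"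
      using n0[OF that] mUA by linarith
    finally have "(LBINT t. indicator A t * (1 - indicator A (t + X n) :: real)) < \<epsilon>" .
    moreover have "0 \<le> (LBINT t. indicator A t * (1 - indicator A (t + X n) :: real))"
      by (intro integral_nonneg_AE) (auto simp: indicator_def)
    ultimately show ?thesis by simp
  qed
  then show "\<exists>n0. \<forall>n\<ge>n0. norm ((LBINT t. indicator A t * (1 - indicator A (t + X n) :: real)) - 0) < \<epsilon>" by blast
qed

text \<open>Induction along simple functions. For an indicator the symmetric difference has two
  halves, each handled by \<open>indicator_shift_tendsto\<close>; the limit step is an argument with
  three times \<open>\<epsilon> / 3\<close>.\<close>

lemma L1_shift_tendsto:
  fixes f :: "'a::euclidean_space \<Rightarrow> complex"
  assumes "integrable lborel f" "X \<longlonglongrightarrow> 0"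
  shows "(\<lambda>n. LBINT t. norm (f (t + X n) - f t)) \<longlonglongrightarrow> 0"
  using assms(1)
proof (induction rule: integrable_induct)
  case (base A c)
  have A: "A \<in> sets borel" "emeasure lborel A < \<infinity>" using base by auto
  have [measurable]: "A \<in> sets borel" by (rule A)
  have iA: "integrable lborel (indicator A :: 'a \<Rightarrow> real)" using A by simp
  define D where "D x = (LBINT t. indicator A t * (1 - indicator A (t + x) :: real))" for x
  have i1: "integrable lborel (\<lambda>t. indicator A t * (1 - indicator A (t + x) :: real))" for x
    by (rule Bochner_Integration.integrable_bound[OF iA]) (auto simp: indicator_def)
  \<comment> \<open>Substituting \<open>t + x\<close> for \<open>t\<close> turns the second half of
    the symmetric difference into the first half for the opposite shift.\<close>
  have D': "D (- x) = (LBINT t. indicator A (t + x) * (1 - indicator A t :: real))" for x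
    unfolding D_def
    using lborel_integral_shift[of "\<lambda>t. indicator A t * (1 - indicator A (t + - x) :: real)" x] by simp
  have i2: "integrable lborel (\<lambda>t. indicator A (t + x) * (1 - indicator A t :: real))" for x
    using lborel_integrable_shift[OF i1[of "-x"], of x] by simp
  have eq: "(LBINT t. norm (indicator A (t + x) *\<^sub>R c - indicator A t *\<^sub>R c)) = (D x + D (- x)) * norm c" for x
  proof -
    have "(LBINT t. norm (indicator A (t + x) *\<^sub>R c - indicator A t *\<^sub>R c))
      = (LBINT t. (indicator A t * (1 - indicator A (t + x)) + indicator A (t + x) * (1 - indicator A t)) * norm c)"
      by (intro Bochner_Integration.integral_cong refl) (auto simp: indicator_def)
    then show ?thesis unfolding D' unfolding D_def using i1 i2 by simp
  qed
  have "(\<lambda>n. D (X n)) \<longlonglongrightarrow> 0" unfolding D_def by (rule indicator_shift_tendsto[OF A assms(2)])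
  moreover have "(\<lambda>n. - X n) \<longlonglongrightarrow> 0" using tendsto_minus[OF assms(2)] by simp
  then have "(\<lambda>n. D (- X n)) \<longlonglongrightarrow> 0" unfolding D_def by (rule indicator_shift_tendsto[OF A])
  ultimately have "(\<lambda>n. (D (X n) + D (- X n)) * norm c) \<longlonglongrightarrow> (0 + 0) * norm c" by (intro tendsto_intros)
  then show ?case unfolding eq by simp
next
  case (add f g)
  note sh = lborel_integrable_shift[OF add.hyps(1)] lborel_integrable_shift[OF add.hyps(2)]
  show ?case
  proof (rule real_tendsto_sandwich[OF _ _ tendsto_const])
    let ?N = "\<lambda>f n. LBINT t. norm (f (t + X n) - f t)"
    show "\<forall>\<^sub>F n in sequentially. 0 \<le> ?N (\<lambda>t. f t + g t) n" by simp
    have "?N (\<lambda>t. f t + g t) n \<le> ?N f n + ?N g n" for n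
    proof -
      have "?N (\<lambda>t. f t + g t) n \<le> (LBINT t. norm (f (t + X n) - f t) + norm (g (t + X n) - g t))"
      proof (rule integral_mono)
        fix t
        have "f (t + X n) + g (t + X n) - (f t + g t) = (f (t + X n) - f t) + (g (t + X n) - g t)" by simp
        then show "norm (f (t + X n) + g (t + X n) - (f t + g t)) \<le> norm (f (t + X n) - f t) + norm (g (t + X n) - g t)"
          by (metis norm_triangle_ineq)
      qed (use sh add.hyps in auto)
      also have "\<dots> = ?N f n + ?N g n"
        using sh add.hyps by (intro Bochner_Integration.integral_add) auto
      finally show ?thesis .
    qed
    then show "\<forall>\<^sub>F n in sequentially. ?N (\<lambda>t. f t + g t) n \<le> ?N f n + ?N g n" by (rule always_eventually[OF allI])
    show "(\<lambda>n. (LBINT t. norm (f (t + X n) - f t)) + (LBINT t. norm (g (t + X n) - g t))) \<longlonglongrightarrow> 0"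
      using tendsto_add[OF add.IH] by simp
  qed
next
  case (lim f s)
  have [measurable]: "f \<in> borel_measurable borel" "\<And>i. s i \<in> borel_measurable borel"
    using borel_measurable_integrable[OF lim.hyps(4)] borel_measurable_integrable[OF lim.hyps(1)] by simp_all
  have "(\<lambda>i. LBINT t. norm (s i t - f t)) \<longlonglongrightarrow> (LINT t|(lborel::'a measure). 0)"
  proof (rule integral_dominated_convergence[where w = "\<lambda>t. 3 * norm (f t)"])
    show "AE t in lborel. (\<lambda>i. norm (s i t - f t)) \<longlonglongrightarrow> 0"
      using lim.hyps(2) by (auto intro!: tendsto_norm_zero simp: LIM_zero_iff)
    show "AE t in lborel. norm (norm (s i t - f t)) \<le> 3 * norm (f t)" for i
    proof (rule AE_I2)
      fix t
      show "norm (norm (s i t - f t)) \<le> 3 * norm (f t)"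
        using lim.hyps(3)[of t i] norm_triangle_ineq4[of "s i t" "f t"] by simp
    qed
  qed (use lim.hyps(4) in auto)
  then have d: "(\<lambda>i. LBINT t. norm (s i t - f t)) \<longlonglongrightarrow> 0" by simp
  show ?case
  proof (rule LIMSEQ_I)
    fix \<epsilon> :: real assume \<epsilon>: "0 < \<epsilon>"
    obtain i where i: "(LBINT t. norm (s i t - f t)) < \<epsilon> / 3"
      using LIMSEQ_D[OF d, of "\<epsilon> / 3"] \<epsilon> by (auto simp: abs_less_iff)
    obtain n0 where n0: "\<And>n. n0 \<le> n \<Longrightarrow> (LBINT t. norm (s i (t + X n) - s i t)) < \<epsilon> / 3"
      using LIMSEQ_D[OF lim.IH[of i], of "\<epsilon> / 3"] \<epsilon> by (auto simp: abs_less_iff)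
    have "(LBINT t. norm (f (t + X n) - f t)) < \<epsilon>" if n: "n0 \<le> n" for n
    proof -
      note sh = lborel_integrable_shift[OF lim.hyps(4), of "X n"] lborel_integrable_shift[OF lim.hyps(1), of i "X n"] lim.hyps(4) lim.hyps(1)[of i]
      have "(LBINT t. norm (f (t + X n) - f t))
        \<le> (LBINT t. norm (s i (t + X n) - f (t + X n)) + norm (s i (t + X n) - s i t) + norm (s i t - f t))"
      proof (rule integral_mono)
        fix t
        have "f (t + X n) - f t = (s i (t + X n) - s i t) - (s i (t + X n) - f (t + X n)) + (s i t - f t)" by simp
        also have "norm \<dots> \<le> norm (s i (t + X n) - s i t) + norm (s i (t + X n) - f (t + X n)) + norm (s i t - f t)"
          by (meson add_right_mono norm_triangle_ineq norm_triangle_ineq4 order_trans)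
        finally show "norm (f (t + X n) - f t) \<le> norm (s i (t + X n) - f (t + X n)) + norm (s i (t + X n) - s i t) + norm (s i t - f t)"
          by simp
      qed (use sh in auto)
      also have "\<dots> = (LBINT t. norm (s i (t + X n) - f (t + X n))) + (LBINT t. norm (s i (t + X n) - s i t))
          + (LBINT t. norm (s i t - f t))"
        using sh by (simp add: Bochner_Integration.integral_add)
      also have "(LBINT t. norm (s i (t + X n) - f (t + X n))) = (LBINT t. norm (s i t - f t))"
        by (rule lborel_integral_shift[of "\<lambda>t. norm (s i t - f t)"]) measurable
      finally show ?thesis using i n0[OF n] by linarith
    qed
    then show "\<exists>n0. \<forall>n\<ge>n0. norm ((LBINT t. norm (f (t + X n) - f t)) - 0) < \<epsilon>" by auto
  qed
qed

text \<open>By this inequality continuity of translation of \<open>f\<close> in the quadratic mean follows from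
  continuity of translation of \<open>|f| f\<close> in the mean.\<close>

lemma norm_diff_square_le:
  fixes a b :: "'a::real_inner"
  shows "(norm (a - b))^2 \<le> 2 * norm (norm a *\<^sub>R a - norm b *\<^sub>R b)"
proof (cases "a = b")
  case False
  define s where "s = norm a + norm b"
  let ?d = "norm a *\<^sub>R a - norm b *\<^sub>R b"
  have 1: "inner ?d (a - b) = norm a * (norm a)^2 + norm b * (norm b)^2 - s * inner a b"
    unfolding s_def by (simp add: inner_diff_left inner_diff_right dot_square_norm inner_commute[of b a] algebra_simps)
  have 2: "(norm (a - b))^2 = (norm a)^2 + (norm b)^2 - 2 * inner a b"
    unfolding power2_norm_eq_inner by (simp add: inner_diff_left inner_diff_right inner_commute[of b a])
  \<comment> \<open>The defect is a nonnegative multiple of a square; afterwards \<open>s\<close> is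
    eliminated by \<open>norm (a - b) \<le> s\<close>.\<close>
  have "inner ?d (a - b) - s / 2 * (norm (a - b))^2 = s / 2 * (norm a - norm b)^2"
    unfolding 1 2 unfolding s_def by (simp add: field_simps power2_eq_square)
  moreover have "0 \<le> s / 2 * (norm a - norm b)^2" by (simp add: s_def)
  ultimately have "s / 2 * (norm (a - b))^2 \<le> inner ?d (a - b)" by linarith
  also have "\<dots> \<le> norm ?d * norm (a - b)" by (rule norm_cauchy_schwarz)
  finally have "s / 2 * norm (a - b) \<le> norm ?d" using False by (simp add: power2_eq_square)
  moreover have "norm (a - b) * norm (a - b) \<le> s * norm (a - b)"
    unfolding s_def by (intro mult_right_mono norm_triangle_ineq4) auto
  ultimately show ?thesis by (simp add: power2_eq_square)
qed simp

lemma L2_shift_tendsto: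
  fixes f :: "'a::euclidean_space \<Rightarrow> complex"
  assumes f: "square_integrable f" and X: "X \<longlonglongrightarrow> 0"
  shows "(\<lambda>n. LBINT t. (cmod (f (t + X n) - f t))^2) \<longlonglongrightarrow> 0"
proof -
  have [measurable]: "f \<in> borel_measurable borel" using f by (simp add: square_integrable_def)
  define F where "F t = cmod (f t) *\<^sub>R f t" for t
  have F: "integrable lborel F"
  proof (rule Bochner_Integration.integrable_bound)
    show "integrable lborel (\<lambda>t. (cmod (f t))^2)" using f by (simp add: square_integrable_def)
    show "F \<in> borel_measurable lborel" unfolding F_def by measurable
  qed (simp add: F_def power2_eq_square)
  have lim: "(\<lambda>n. 2 * (LBINT t. norm (F (t + X n) - F t))) \<longlonglongrightarrow> 0"
    using tendsto_mult_right_zero[OF L1_shift_tendsto[OF F X]] .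
  show ?thesis
  proof (rule real_tendsto_sandwich[OF _ _ tendsto_const lim])
    show "\<forall>\<^sub>F n in sequentially. (LBINT t. (cmod (f (t + X n) - f t))^2) \<le> 2 * (LBINT t. norm (F (t + X n) - F t))"
    proof (rule always_eventually, rule allI)
      fix n
      have "(LBINT t. (cmod (f (t + X n) - f t))^2) \<le> (LBINT t. 2 * norm (F (t + X n) - F t))"
      proof (rule integral_mono)
        show "integrable lborel (\<lambda>t. (cmod (f (t + X n) - f t))^2)"
          using square_integrable_diff[OF square_integrable_translate[OF f] f] by (simp add: square_integrable_def)
        show "integrable lborel (\<lambda>t. 2 * norm (F (t + X n) - F t))"
          using lborel_integrable_shift[OF F] F by auto
        show "(cmod (f (t + X n) - f t))^2 \<le> 2 * norm (F (t + X n) - F t)" for t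
          unfolding F_def by (rule norm_diff_square_le)
      qed
      then show "(LBINT t. (cmod (f (t + X n) - f t))^2) \<le> 2 * (LBINT t. norm (F (t + X n) - F t))" by simp
    qed
  qed simp
qed

section \<open>Unitarity and strong continuity of the Schroedinger representation\<close>

lemma rho_abs_L2:
  assumes "square_integrable \<phi>"
  shows "square_integrable (\<lambda>t. exp (\<i> * of_real (pi * (x \<bullet> y + 2 * (y \<bullet> t)))) * \<phi> (t + x))"
    and "rho x y 1 (abs_L2 \<phi>) = abs_L2 (\<lambda>t. exp (\<i> * of_real (pi * (x \<bullet> y + 2 * (y \<bullet> t)))) * \<phi> (t + x))"
proof -
  show "square_integrable (\<lambda>t. exp (\<i> * of_real (pi * (x \<bullet> y + 2 * (y \<bullet> t)))) * \<phi> (t + x))"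
    using square_integrable_phase[OF square_integrable_translate[OF assms], of "\<lambda>t. pi * (x \<bullet> y + 2 * (y \<bullet> t))" 1 x]
    by simp
  show "rho x y 1 (abs_L2 \<phi>) = abs_L2 (\<lambda>t. exp (\<i> * of_real (pi * (x \<bullet> y + 2 * (y \<bullet> t)))) * \<phi> (t + x))"
    using rho.abs_eq[OF ae_eq_sq_refl[OF assms], of x y 1] by simp
qed

lemma cinner_rho:
  "cinner (rho x y 1 f) (rho x y 1 g) = cinner f g"
proof -
  obtain \<phi> where \<phi>: "square_integrable \<phi>" "f = abs_L2 \<phi>" by (rule L2_exhaust)
  obtain \<psi> where \<psi>: "square_integrable \<psi>" "g = abs_L2 \<psi>" by (rule L2_exhaust)
  have [measurable]: "\<phi> \<in> borel_measurable borel" "\<psi> \<in> borel_measurable borel"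
    using \<phi> \<psi> by (simp_all add: square_integrable_def)
  have e: "exp (\<i> * of_real r) * a * cnj (exp (\<i> * of_real r) * b) = a * cnj b" for r :: real and a b
  proof -
    have "exp (\<i> * of_real r) * cnj (exp (\<i> * of_real r)) = 1"
      unfolding complex_norm_square[symmetric] by (simp add: norm_exp_i_times)
    then show ?thesis by (simp add: mult_ac)
  qed
  have "cinner (rho x y 1 f) (rho x y 1 g) = (LBINT t. \<phi> (t + x) * cnj (\<psi> (t + x)))"
    unfolding \<phi>(2) \<psi>(2) rho_abs_L2(2)[OF \<phi>(1)] rho_abs_L2(2)[OF \<psi>(1)]
    by (subst cinner_abs_L2) (use rho_abs_L2(1)[OF \<phi>(1)] rho_abs_L2(1)[OF \<psi>(1)] in \<open>auto simp only: e\<close>)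
  also have "\<dots> = cinner f g"
    unfolding \<phi>(2) \<psi>(2) cinner_abs_L2[OF \<phi>(1) \<psi>(1)]
    by (rule lborel_integral_shift[of "\<lambda>t. \<phi> t * cnj (\<psi> t)"]) measurable
  finally show ?thesis .
qed

lemma rho_norm_eq: "norm (rho x y 1 f) = norm f"
  using cinner_rho[of x y f f] unfolding cinner_self of_real_eq_iff by (simp add: power2_eq_iff_nonneg)

text \<open>The difference splits into the new phase times a difference of translates, and a
  difference of phases times a fixed translate. The first tends to 0 by
  \<open>L2_shift_tendsto\<close>, the second by dominated convergence with the factor
  \<open>4 = 2^2\<close>.\<close>

lemma rho_tendsto:
  assumes x: "X \<longlonglongrightarrow> x" and y: "Y \<longlonglongrightarrow> y"
  shows "(\<lambda>n. rho (X n) (Y n) 1 f) \<longlonglongrightarrow> rho x y 1 f"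
proof -
  obtain \<phi> where \<phi>: "square_integrable \<phi>" "f = abs_L2 \<phi>" by (rule L2_exhaust)
  have [measurable]: "\<phi> \<in> borel_measurable borel" using \<phi> by (simp add: square_integrable_def)
  define e where "e x y t = exp (\<i> * of_real (pi * (x \<bullet> y + 2 * (y \<bullet> t))))" for x y t :: 'a
  have em [measurable]: "e x y \<in> borel_measurable borel" for x y unfolding e_def by measurable
  have e1: "cmod (e x y t) = 1" for x y t unfolding e_def by (rule norm_exp_i_times)
  define a where "a n t = (cmod (\<phi> (t + X n) - \<phi> (t + x)))^2" for n t
  define b where "b n t = (cmod (e (X n) (Y n) t - e x y t))^2 * (cmod (\<phi> (t + x)))^2" for n t
  have ia: "integrable lborel (a n)" for n
    using square_integrable_diff[OF square_integrable_translate[OF \<phi>(1)] square_integrable_translate[OF \<phi>(1)]]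
    by (simp add: square_integrable_def a_def[abs_def])
  have i\<phi>: "integrable lborel (\<lambda>t. 4 * (cmod (\<phi> (t + x)))^2)"
    using square_integrable_translate[OF \<phi>(1)] by (simp add: square_integrable_def)
  have bm: "b n \<in> borel_measurable lborel" for n unfolding b_def by measurable
  have ble: "b n t \<le> 4 * (cmod (\<phi> (t + x)))^2" for n t
  proof -
    have "cmod (e (X n) (Y n) t - e x y t) \<le> 2"
      using norm_triangle_ineq4[of "e (X n) (Y n) t" "e x y t"] by (simp add: e1)
    then have "(cmod (e (X n) (Y n) t - e x y t))^2 \<le> 2^2" by (intro power_mono) auto
    then show ?thesis unfolding b_def by (intro mult_right_mono) auto
  qed
  have b0: "0 \<le> b n t" for n t by (simp add: b_def)
  have ib: "integrable lborel (b n)" for n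
    by (rule Bochner_Integration.integrable_bound[OF i\<phi> bm]) (use ble b0 in auto)
  have "(\<lambda>n. X n - x) \<longlonglongrightarrow> 0" using x by (simp add: LIM_zero_iff)
  from L2_shift_tendsto[OF \<phi>(1) this]
  have "(\<lambda>n. LBINT t. (cmod (\<phi> (t + (X n - x)) - \<phi> t))^2) \<longlonglongrightarrow> 0" .
  moreover have "(LBINT t. (cmod (\<phi> (t + (X n - x)) - \<phi> t))^2) = (LBINT t. a n t)" for n
    using lborel_integral_shift[of "\<lambda>t. (cmod (\<phi> (t + (X n - x)) - \<phi> t))^2" x]
    by (simp add: a_def add.assoc)
  ultimately have la: "(\<lambda>n. LBINT t. a n t) \<longlonglongrightarrow> 0" by simp
  have "(\<lambda>n. LBINT t. b n t) \<longlonglongrightarrow> (LINT t|(lborel::'a measure). 0)"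
  proof (rule integral_dominated_convergence[OF _ bm i\<phi>])
    show "AE t in lborel. (\<lambda>n. b n t) \<longlonglongrightarrow> 0"
    proof (rule AE_I2)
      fix t
      have "(\<lambda>n. b n t) \<longlonglongrightarrow> (cmod (e x y t - e x y t))^2 * (cmod (\<phi> (t + x)))^2"
        unfolding b_def e_def by (intro tendsto_intros x y)
      then show "(\<lambda>n. b n t) \<longlonglongrightarrow> 0" by simp
    qed
  qed (use ble b0 in auto)
  then have lb: "(\<lambda>n. LBINT t. b n t) \<longlonglongrightarrow> 0" by simp
  have le: "(norm (rho (X n) (Y n) 1 f - rho x y 1 f))^2 \<le> 2 * (LBINT t. a n t) + 2 * (LBINT t. b n t)" for n
  proof -
    have sq: "square_integrable (\<lambda>t. e (X n) (Y n) t * \<phi> (t + X n) - e x y t * \<phi> (t + x))"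
      unfolding e_def by (intro square_integrable_diff rho_abs_L2(1) \<phi>(1))
    have "rho (X n) (Y n) 1 f - rho x y 1 f = abs_L2 (\<lambda>t. e (X n) (Y n) t * \<phi> (t + X n) - e x y t * \<phi> (t + x))"
      unfolding \<phi>(2) rho_abs_L2(2)[OF \<phi>(1)] e_def by (rule abs_L2_diff) (rule rho_abs_L2(1)[OF \<phi>(1)])+
    then have "(norm (rho (X n) (Y n) 1 f - rho x y 1 f))^2
        = (LBINT t. (cmod (e (X n) (Y n) t * \<phi> (t + X n) - e x y t * \<phi> (t + x)))^2)"
      using norm_abs_L2[OF sq] by simp
    also have "\<dots> \<le> (LBINT t. 2 * a n t + 2 * b n t)"
    proof (rule integral_mono)
      show "integrable lborel (\<lambda>t. (cmod (e (X n) (Y n) t * \<phi> (t + X n) - e x y t * \<phi> (t + x)))^2)"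
        using sq by (simp add: square_integrable_def)
      show "integrable lborel (\<lambda>t. 2 * a n t + 2 * b n t)" using ia ib by simp
      fix t
      define p where "p = e (X n) (Y n) t * (\<phi> (t + X n) - \<phi> (t + x))"
      define q where "q = (e (X n) (Y n) t - e x y t) * \<phi> (t + x)"
      have "(cmod (p + q))^2 \<le> (cmod p + cmod q)^2" by (intro power_mono norm_triangle_ineq) auto
      also have "\<dots> \<le> 2 * (cmod p)^2 + 2 * (cmod q)^2"
        using sum_squares_bound[of "cmod p" "cmod q"] by (simp add: power2_sum)
      also have "p + q = e (X n) (Y n) t * \<phi> (t + X n) - e x y t * \<phi> (t + x)"
        unfolding p_def q_def by (simp add: algebra_simps)
      finally show "(cmod (e (X n) (Y n) t * \<phi> (t + X n) - e x y t * \<phi> (t + x)))^2 \<le> 2 * a n t + 2 * b n t"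
        unfolding p_def q_def a_def b_def by (simp add: norm_mult e1 power_mult_distrib)
    qed
    also have "\<dots> = 2 * (LBINT t. a n t) + 2 * (LBINT t. b n t)" using ia ib by simp
    finally show ?thesis .
  qed
  have "(\<lambda>n. 2 * (LBINT t. a n t) + 2 * (LBINT t. b n t)) \<longlonglongrightarrow> 2 * 0 + 2 * 0"
    by (intro tendsto_intros la lb)
  then have lab: "(\<lambda>n. 2 * (LBINT t. a n t) + 2 * (LBINT t. b n t)) \<longlonglongrightarrow> 0" by simp
  have "(\<lambda>n. (norm (rho (X n) (Y n) 1 f - rho x y 1 f))^2) \<longlonglongrightarrow> 0"
    by (rule Lim_null_comparison[OF _ lab]) (use le in simp)
  from tendsto_real_sqrt[OF this] have "(\<lambda>n. norm (rho (X n) (Y n) 1 f - rho x y 1 f)) \<longlonglongrightarrow> 0" by simp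
  then show ?thesis by (simp add: tendsto_norm_zero_iff LIM_zero_iff)
qed

abbreviation schroedinger :: "'a::euclidean_space \<times> 'a \<Rightarrow> 'a L2 \<Rightarrow> 'a L2" where
  "schroedinger v \<equiv> rho (fst v) (snd v) 1"

lemma continuous_on_rho: "continuous_on UNIV (\<lambda>v. schroedinger v f)"
  unfolding continuous_on_sequentially
proof (intro ballI allI impI)
  fix X :: "nat \<Rightarrow> 'a \<times> 'a" and v assume "(\<forall>n. X n \<in> UNIV) \<and> X \<longlonglongrightarrow> v"
  then have "X \<longlonglongrightarrow> v" by blast
  then show "((\<lambda>v. schroedinger v f) \<circ> X) \<longlonglongrightarrow> schroedinger v f"
    unfolding o_def by (intro rho_tendsto tendsto_fst tendsto_snd)
qed

text \<open>Regularising with Gaussians of width \<open>\<sigma>\<close> gives Plancherel's inequality without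
  Fourier inversion.\<close>

definition wave :: "'a::euclidean_space \<Rightarrow> 'a \<Rightarrow> complex" where
  "wave y t = exp (\<i> * of_real (2 * pi * (y \<bullet> t)))"

definition gauss :: "real \<Rightarrow> 'a::euclidean_space \<Rightarrow> real" where
  "gauss \<sigma> y = (\<Prod>b\<in>Basis. exp (- (y \<bullet> b)\<^sup>2 / (2 * \<sigma>^2)))"

text \<open>The Fourier transform of \<open>gauss \<sigma>\<close> for the kernel
  \<open>wave\<close>: a centred probability density of standard deviation
  \<open>1 / (2 * pi * \<sigma>)\<close> in each coordinate.\<close>

definition gauss_hat :: "real \<Rightarrow> 'a::euclidean_space \<Rightarrow> real" where
  "gauss_hat \<sigma> s = (\<Prod>b\<in>Basis. normal_density 0 (1 / (2 * pi * \<sigma>)) (s \<bullet> b))"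

lemma norm_wave [simp]: "cmod (wave y t) = 1"
  unfolding wave_def by (rule norm_exp_i_times)

lemma wave_measurable [measurable]:
  "f \<in> borel_measurable M \<Longrightarrow> g \<in> borel_measurable M \<Longrightarrow> (\<lambda>x. wave (f x) (g x)) \<in> borel_measurable M"
  unfolding wave_def by measurable

lemma wave_pair_measurable:
  "(\<lambda>p. wave (fst p) (snd p :: 'a::euclidean_space)) \<in> borel_measurable (lborel \<Otimes>\<^sub>M lborel)"
  "(\<lambda>p. cnj (wave (fst p) (snd p :: 'a::euclidean_space))) \<in> borel_measurable (lborel \<Otimes>\<^sub>M lborel)"
  unfolding lborel_prod wave_def
  by (auto intro!: borel_measurable_continuous_onI continuous_intros simp del: exp_cnj)

lemma gauss_measurable [measurable]: "gauss \<sigma> \<in> borel_measurable borel"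
  unfolding gauss_def by measurable

lemma gauss_hat_measurable [measurable]: "gauss_hat \<sigma> \<in> borel_measurable borel"
  unfolding gauss_hat_def by measurable

lemma gauss_bounds: "0 \<le> gauss \<sigma> y" "gauss \<sigma> y \<le> 1"
  unfolding gauss_def by (auto intro!: prod_nonneg prod_le_1)

lemma gauss_hat_nonneg: "0 \<le> gauss_hat \<sigma> s"
  unfolding gauss_hat_def by (intro prod_nonneg) auto

lemma gauss_hat_minus: "gauss_hat \<sigma> (- s) = gauss_hat \<sigma> s"
  unfolding gauss_hat_def normal_density_def by simp

lemma nn_integral_gauss_hat:
  assumes "0 < \<sigma>" shows "(\<integral>\<^sup>+s. ennreal (gauss_hat \<sigma> (s :: 'a::euclidean_space)) \<partial>lborel) = 1"
proof -
  have 1: "(\<integral>\<^sup>+x. ennreal (normal_density 0 (1 / (2 * pi * \<sigma>)) x) \<partial>lborel) = 1"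
    using assms by (subst nn_integral_eq_integral) auto
  have "(\<integral>\<^sup>+s. ennreal (gauss_hat \<sigma> (s :: 'a)) \<partial>lborel)
      = (\<integral>\<^sup>+s. (\<Prod>b\<in>Basis. ennreal (normal_density 0 (1 / (2 * pi * \<sigma>)) (s \<bullet> b))) \<partial>(lborel :: 'a measure))"
    unfolding gauss_hat_def by (intro nn_integral_cong) (simp add: prod_ennreal)
  also have "\<dots> = 1" by (subst nn_integral_lborel_prod) (auto simp: 1)
  finally show ?thesis .
qed

lemma lborel_integral_prod:
  fixes f :: "'a::euclidean_space \<Rightarrow> real \<Rightarrow> complex"
  assumes "\<And>b. b \<in> Basis \<Longrightarrow> integrable lborel (f b)"
  shows "integrable lborel (\<lambda>x. \<Prod>b\<in>Basis. f b (x \<bullet> b))"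
    and "(LBINT x. (\<Prod>b\<in>Basis. f b (x \<bullet> b))) = (\<Prod>b\<in>Basis. (LBINT t. f b t))"
proof -
  interpret product_sigma_finite "\<lambda>_::'a. lborel :: real measure" by standard
  have [measurable]: "b \<in> Basis \<Longrightarrow> f b \<in> borel_measurable borel" for b
    using borel_measurable_integrable[OF assms] by simp
  have m: "(\<lambda>x. \<Prod>b\<in>Basis. f b (x \<bullet> b)) \<in> borel_measurable borel" by measurable
  have t: "(\<lambda>g. \<Sum>b\<in>Basis. g b *\<^sub>R b) \<in> measurable (\<Pi>\<^sub>M b\<in>(Basis::'a set). (lborel::real measure)) borel" by measurable
  have eq: "(\<Prod>b\<in>Basis. f b ((\<Sum>b'\<in>Basis. g b' *\<^sub>R b') \<bullet> b)) = (\<Prod>b\<in>Basis. f b (g b))" for g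
    by (intro prod.cong refl) simp
  show "integrable lborel (\<lambda>x. \<Prod>b\<in>Basis. f b (x \<bullet> b))"
    unfolding lborel_eq[where 'a='a] by (subst integrable_distr_eq[OF t m], unfold eq)
      (intro product_integrable_prod finite_Basis assms)
  show "(LBINT x. (\<Prod>b\<in>Basis. f b (x \<bullet> b))) = (\<Prod>b\<in>Basis. (LBINT t. f b t))"
    by (subst lborel_eq[where 'a='a], subst integral_distr[OF t m], unfold eq)
      (intro product_integral_prod finite_Basis assms)
qed

text \<open>The substitution \<open>y = \<sigma> * x\<close> reduces the integral to the
  characteristic function of the standard normal distribution at
  \<open>2 * pi * \<sigma> * s\<close>.\<close>

lemma gauss_fourier_1d:
  assumes \<sigma>: "0 < \<sigma>"
  defines "h \<equiv> \<lambda>s y. exp (\<i> * of_real (2 * pi * (y * s))) * complex_of_real (exp (- y\<^sup>2 / (2 * \<sigma>^2)))"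
  shows "integrable lborel (h s)" "(LBINT y. h s y) = of_real (normal_density 0 (1 / (2 * pi * \<sigma>)) s)"
proof -
  have nd: "exp (- y\<^sup>2 / (2 * \<sigma>^2)) = sqrt (2 * pi * \<sigma>^2) * normal_density 0 \<sigma> y" for y
    using \<sigma> by (simp add: normal_density_def)
  have ir: "integrable lborel (\<lambda>y. exp (- y\<^sup>2 / (2 * \<sigma>^2)))" unfolding nd using \<sigma> by simp
  show "integrable lborel (h s)"
    by (rule Bochner_Integration.integrable_bound[OF ir]) (auto simp: h_def norm_mult norm_exp_i_times)
  have "complex_of_real (exp (- ((2 * pi * \<sigma> * s)^2) / 2)) = char std_normal_distribution (2 * pi * \<sigma> * s)"
    by (simp add: char_std_normal_distribution)
  also have "\<dots> = (LBINT x. std_normal_density x *\<^sub>R exp (\<i> * of_real (2 * pi * \<sigma> * s * x)))"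
    unfolding char_def by (subst integral_density) auto
  finally have c: "(LBINT x. std_normal_density x *\<^sub>R exp (\<i> * of_real (2 * pi * \<sigma> * s * x)))
      = complex_of_real (exp (- ((2 * pi * \<sigma> * s)^2) / 2))" ..
  have "(LBINT y. h s y) = \<bar>\<sigma>\<bar> *\<^sub>R (LBINT x. h s (0 + \<sigma> * x))"
    using \<sigma> by (intro lborel_integral_real_affine) auto
  also have "(\<lambda>x. h s (0 + \<sigma> * x)) = (\<lambda>x. of_real (sqrt (2 * pi)) * (std_normal_density x *\<^sub>R exp (\<i> * of_real (2 * pi * \<sigma> * s * x))))"
  proof
    fix x
    have "(\<sigma> * x)^2 / (2 * \<sigma>^2) = x^2 / 2" using \<sigma> by (simp add: power_mult_distrib)
    then show "h s (0 + \<sigma> * x) = of_real (sqrt (2 * pi)) * (std_normal_density x *\<^sub>R exp (\<i> * of_real (2 * pi * \<sigma> * s * x)))"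
      unfolding h_def std_normal_density_def by (simp add: scaleR_conv_of_real mult_ac)
  qed
  also have "\<bar>\<sigma>\<bar> *\<^sub>R (LBINT x. of_real (sqrt (2 * pi)) * (std_normal_density x *\<^sub>R exp (\<i> * of_real (2 * pi * \<sigma> * s * x))))
      = complex_of_real (\<sigma> * sqrt (2 * pi) * exp (- ((2 * pi * \<sigma> * s)^2) / 2))"
    using \<sigma> by (simp only: integral_mult_right_zero c) (simp add: scaleR_conv_of_real)
  also have "\<sigma> * sqrt (2 * pi) * exp (- ((2 * pi * \<sigma> * s)^2) / 2) = normal_density 0 (1 / (2 * pi * \<sigma>)) s"
  proof -
    have "2 * pi * (1 / (2 * pi * \<sigma>))^2 = 1 / (\<sigma>^2 * (2 * pi))" using \<sigma> by (simp add: field_simps power2_eq_square)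
    then have "1 / sqrt (2 * pi * (1 / (2 * pi * \<sigma>))^2) = \<sigma> * sqrt (2 * pi)"
      using \<sigma> by (simp add: real_sqrt_divide real_sqrt_mult)
    moreover have "- (s - 0)\<^sup>2 / (2 * (1 / (2 * pi * \<sigma>))^2) = - ((2 * pi * \<sigma> * s)^2) / 2"
      using \<sigma> by (simp add: field_simps power2_eq_square)
    ultimately show ?thesis unfolding normal_density_def by simp
  qed
  finally show "(LBINT y. h s y) = of_real (normal_density 0 (1 / (2 * pi * \<sigma>)) s)" .
qed

lemma gauss_fourier:
  assumes \<sigma>: "0 < \<sigma>"
  shows "integrable lborel (\<lambda>y. of_real (gauss \<sigma> y) * wave y s)"
    and "(LBINT y. of_real (gauss \<sigma> y) * wave y s) = of_real (gauss_hat \<sigma> s)"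
proof -
  have eq: "of_real (gauss \<sigma> y) * wave y s =
      (\<Prod>b\<in>Basis. exp (\<i> * of_real (2 * pi * ((y \<bullet> b) * (s \<bullet> b)))) * complex_of_real (exp (- (y \<bullet> b)\<^sup>2 / (2 * \<sigma>^2))))" for y
  proof -
    have "wave y s = exp (\<Sum>b\<in>Basis. \<i> * of_real (2 * pi * ((y \<bullet> b) * (s \<bullet> b))))"
      unfolding wave_def by (subst euclidean_inner) (simp add: sum_distrib_left)
    also have "\<dots> = (\<Prod>b\<in>Basis. exp (\<i> * of_real (2 * pi * ((y \<bullet> b) * (s \<bullet> b)))))" by (simp add: exp_sum)
    finally show ?thesis unfolding gauss_def of_real_prod prod.distrib by simp
  qed
  note g = gauss_fourier_1d[OF \<sigma>]
  show "integrable lborel (\<lambda>y. of_real (gauss \<sigma> y) * wave y s)"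
    unfolding eq by (rule lborel_integral_prod(1)) (rule g(1))
  show "(LBINT y. of_real (gauss \<sigma> y) * wave y s) = of_real (gauss_hat \<sigma> s)"
    unfolding eq
    using lborel_integral_prod(2)[of "\<lambda>b y. exp (\<i> * of_real (2 * pi * (y * (s \<bullet> b)))) * complex_of_real (exp (- y\<^sup>2 / (2 * \<sigma>^2)))"] g
    unfolding gauss_hat_def of_real_prod by simp
qed

section \<open>Plancherel's and Moyal's inequalities\<close>

lemma Fubini_unimodular_kernel:
  fixes w h :: "'a::euclidean_space \<Rightarrow> complex"
  assumes w: "integrable lborel w" and h: "integrable lborel h"
    and K: "(\<lambda>p. K (fst p) (snd p)) \<in> borel_measurable (lborel \<Otimes>\<^sub>M lborel)" "\<And>y s. cmod (K y s) = 1"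
  shows "(LBINT y. w y * (LBINT s. K y s * h s)) = (LBINT s. h s * (LBINT y. w y * K y s))"
proof -
  have [measurable]: "w \<in> borel_measurable lborel" "h \<in> borel_measurable lborel" using w h by auto
  note K(1)[measurable]
  have "integrable (lborel \<Otimes>\<^sub>M lborel) (case_prod (\<lambda>y s. w y * (K y s * h s)))"
  proof (rule lborel_pair.Fubini_integrable)
    show "case_prod (\<lambda>y s. w y * (K y s * h s)) \<in> borel_measurable (lborel \<Otimes>\<^sub>M lborel)"
      unfolding case_prod_unfold by measurable
    have "integrable lborel (\<lambda>y. cmod (w y) * (LBINT s. cmod (h s)))" using w by simp
    then show "integrable lborel (\<lambda>y. LBINT s. norm (case (y, s) of (y, s) \<Rightarrow> w y * (K y s * h s)))"
      by (simp add: norm_mult K(2))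
    have Km: "(\<lambda>s. K y s) \<in> borel_measurable lborel" for y
      using measurable_compose[OF measurable_Pair1' K(1), of y] by simp
    have "integrable lborel (\<lambda>s. K y s * h s)" for y
      by (rule Bochner_Integration.integrable_bound[OF h]) (use Km in \<open>auto simp: norm_mult K(2)\<close>)
    then show "AE y in lborel. integrable lborel (\<lambda>s. case (y, s) of (y, s) \<Rightarrow> w y * (K y s * h s))" by simp
  qed
  from lborel_pair.Fubini_integral[OF this]
  have "(LBINT s. LBINT y. w y * (K y s * h s)) = (LBINT y. LBINT s. w y * (K y s * h s))" .
  moreover have "(LBINT y. w y * (K y s * h s)) = h s * (LBINT y. w y * K y s)" for s
  proof -
    have "(\<lambda>y. w y * (K y s * h s)) = (\<lambda>y. h s * (w y * K y s))" by (simp add: mult_ac)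
    then show ?thesis by simp
  qed
  ultimately show ?thesis by simp
qed

text \<open>No integrability is assumed: for a function that is not integrable the left side is 0 by
  the default value of the integral.\<close>

lemma ennreal_norm_integral_le:
  fixes f :: "'a \<Rightarrow> complex"
  shows "ennreal (norm (LINT x|M. f x)) \<le> (\<integral>\<^sup>+x. ennreal (norm (f x)) \<partial>M)"
proof (cases "integrable M f")
  case True
  then show ?thesis by (rule integral_norm_bound_ennreal)
qed (simp add: not_integrable_integral_eq)

text \<open>With the weight \<open>gauss \<sigma>\<close> the left side becomes the double integral
  of \<open>cnj (h t) * h s * gauss_hat \<sigma> (s - t)\<close>. A kernel of total mass 1 in each
  variable has norm at most 1 on square-integrable functions, a bound free of
  \<open>\<sigma>\<close>. The right side may be infinite.\<close>

lemma Plancherel_inequality: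
  fixes h :: "'a::euclidean_space \<Rightarrow> complex"
  assumes h: "integrable lborel h"
  defines "H \<equiv> \<lambda>y. LBINT t. wave y t * h t"
  shows "(\<integral>\<^sup>+y. ennreal ((cmod (H y))^2) \<partial>lborel) \<le> (\<integral>\<^sup>+t. ennreal ((cmod (h t))^2) \<partial>lborel)"
proof -
  have hm [measurable]: "h \<in> borel_measurable borel" using borel_measurable_integrable[OF h] by simp
  have Hm [measurable]: "H \<in> borel_measurable borel" unfolding H_def by measurable
  define C where "C = (LBINT t. cmod (h t))"
  have HC: "cmod (H y) \<le> C" for y
  proof -
    have "cmod (H y) \<le> (LBINT t. cmod (wave y t * h t))" unfolding H_def by (rule integral_norm_bound)
    then show ?thesis by (simp add: norm_mult C_def)
  qed
  have reg: "(\<integral>\<^sup>+y. ennreal (gauss \<sigma> y * (cmod (H y))^2) \<partial>lborel) \<le> (\<integral>\<^sup>+t. ennreal ((cmod (h t))^2) \<partial>lborel)"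
    if \<sigma>: "0 < \<sigma>" for \<sigma>
  proof -
    have ig: "integrable lborel (\<lambda>y::'a. gauss \<sigma> y)"
      using integrable_norm[OF gauss_fourier(1)[OF \<sigma>, of 0]] by (simp add: norm_mult gauss_bounds)
    have igH: "integrable lborel (\<lambda>y. complex_of_real (gauss \<sigma> y) * H y)"
    proof (rule Bochner_Integration.integrable_bound)
      show "integrable lborel (\<lambda>y::'a. C * gauss \<sigma> y)" using ig by simp
      show "AE y in lborel. norm (complex_of_real (gauss \<sigma> y) * H y) \<le> norm (C * gauss \<sigma> y)"
        using HC order_trans[OF norm_ge_zero HC]
        by (auto simp: norm_mult abs_mult gauss_bounds mult.commute[of _ "cmod _"] intro!: mult_right_mono)
    qed measurable
    have igHH: "integrable lborel (\<lambda>y. gauss \<sigma> y * (cmod (H y))^2)"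
    proof (rule Bochner_Integration.integrable_bound)
      show "integrable lborel (\<lambda>y::'a. C^2 * gauss \<sigma> y)" using ig by simp
      show "AE y in lborel. norm (gauss \<sigma> y * (cmod (H y))^2) \<le> norm (C^2 * gauss \<sigma> y)"
        using power_mono[OF HC norm_ge_zero, of _ 2]
        by (auto simp: abs_mult gauss_bounds mult.commute[of "gauss _ _"] intro!: mult_right_mono)
    qed measurable
    have cH: "cnj (H y) = (LBINT t. cnj (wave y t) * cnj (h t))" for y
      unfolding H_def by (simp only: Bochner_Integration.integral_cnj[symmetric] complex_cnj_mult)
    have ww: "cnj (wave y t) * wave y s = wave y (s - t)" for y s t :: 'a
      unfolding wave_def by (simp add: exp_cnj inner_diff_right algebra_simps flip: exp_add)
    \<comment> \<open>The integrable weight \<open>gauss \<sigma>\<close> justifies Fubini, and the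
      product of two waves is a wave at \<open>s - t\<close>.\<close>
    have inner: "(LBINT y. (of_real (gauss \<sigma> y) * H y) * cnj (wave y t)) = (LBINT s. h s * of_real (gauss_hat \<sigma> (s - t)))" for t
    proof -
      have "integrable lborel (\<lambda>y. of_real (gauss \<sigma> y) * cnj (wave y t))"
        using Bochner_Integration.integrable_cnj[OF gauss_fourier(1)[OF \<sigma>, of t]] by simp
      then have F: "(LBINT y. (of_real (gauss \<sigma> y) * cnj (wave y t)) * H y)
        = (LBINT s. h s * (LBINT y. (of_real (gauss \<sigma> y) * cnj (wave y t)) * wave y s))"
        unfolding H_def by (rule Fubini_unimodular_kernel[OF _ h wave_pair_measurable(1) norm_wave])
      have a: "(of_real (gauss \<sigma> y) * H y) * cnj (wave y t) = (of_real (gauss \<sigma> y) * cnj (wave y t)) * H y" for y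
        by (simp add: mult_ac)
      have b: "(of_real (gauss \<sigma> y) * cnj (wave y t)) * wave y s = of_real (gauss \<sigma> y) * wave y (s - t)" for y s
        by (simp add: mult.assoc ww)
      show ?thesis unfolding a F b gauss_fourier(2)[OF \<sigma>] ..
    qed
    define I where "I = (LBINT y. gauss \<sigma> y * (cmod (H y))^2)"
    have hc: "integrable lborel (\<lambda>t. cnj (h t))" using h by simp
    have "complex_of_real I = (LBINT y. (of_real (gauss \<sigma> y) * H y) * cnj (H y))"
      unfolding I_def integral_complex_of_real[symmetric]
      by (intro Bochner_Integration.integral_cong refl) (simp only: of_real_mult complex_norm_square mult.assoc)
    also have "\<dots> = (LBINT t. cnj (h t) * (LBINT y. (of_real (gauss \<sigma> y) * H y) * cnj (wave y t)))"
      unfolding cH by (rule Fubini_unimodular_kernel[OF igH hc wave_pair_measurable(2)]) simp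
    also have "\<dots> = (LBINT t. cnj (h t) * (LBINT s. h s * of_real (gauss_hat \<sigma> (s - t))))"
      unfolding inner ..
    finally have eq: "complex_of_real I
        = (LBINT t. cnj (h t) * (LBINT s. h s * of_real (gauss_hat \<sigma> (s - t))))" .
    have G1: "(\<integral>\<^sup>+s. ennreal (gauss_hat \<sigma> (s - t)) \<partial>lborel) = 1" for t :: 'a
      using lborel_nn_integral_shift[of "\<lambda>s. ennreal (gauss_hat \<sigma> s)" "- t"] nn_integral_gauss_hat[OF \<sigma>] by simp
    have G2: "(\<integral>\<^sup>+t. ennreal (gauss_hat \<sigma> (s - t)) \<partial>lborel) = 1" for s :: 'a
      using G1[of s] gauss_hat_minus[of \<sigma> "s - _"] by simp
    \<comment> \<open>The product \<open>cmod (h t) * cmod (h s)\<close> is at most the sum of two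
      half squares; each leaves one variable free, in which \<open>gauss_hat\<close> integrates to
      1.\<close>
    let ?P = "\<lambda>t s. ennreal ((cmod (h t))^2 / 2) * ennreal (gauss_hat \<sigma> (s - t))"
    let ?Q = "\<lambda>t s. ennreal ((cmod (h s))^2 / 2) * ennreal (gauss_hat \<sigma> (s - t))"
    have "(\<integral>\<^sup>+y. ennreal (gauss \<sigma> y * (cmod (H y))^2) \<partial>lborel) = ennreal I"
      unfolding I_def using igHH by (intro nn_integral_eq_integral) (auto simp: gauss_bounds)
    also have "\<dots> \<le> ennreal (cmod (complex_of_real I))"
      by (intro ennreal_leI) simp
    also have "\<dots> \<le> (\<integral>\<^sup>+t. ennreal (cmod (cnj (h t) * (LBINT s. h s * of_real (gauss_hat \<sigma> (s - t))))) \<partial>lborel)"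
      unfolding eq by (rule ennreal_norm_integral_le)
    also have "\<dots> \<le> (\<integral>\<^sup>+t. \<integral>\<^sup>+s. ?P t s + ?Q t s \<partial>lborel \<partial>lborel)"
    proof (rule nn_integral_mono)
      fix t :: 'a
      have "ennreal (cmod (cnj (h t) * (LBINT s. h s * of_real (gauss_hat \<sigma> (s - t)))))
         = ennreal (cmod (LBINT s. cnj (h t) * (h s * of_real (gauss_hat \<sigma> (s - t)))))" by simp
      also have "\<dots> \<le> (\<integral>\<^sup>+s. ennreal (cmod (cnj (h t) * (h s * of_real (gauss_hat \<sigma> (s - t))))) \<partial>lborel)"
        by (rule ennreal_norm_integral_le)
      also have "\<dots> \<le> (\<integral>\<^sup>+s. ?P t s + ?Q t s \<partial>lborel)"
      proof (rule nn_integral_mono)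
        fix s :: 'a
        have "cmod (h t) * cmod (h s) \<le> (cmod (h t))^2 / 2 + (cmod (h s))^2 / 2"
          using sum_squares_bound[of "cmod (h t)" "cmod (h s)"] by simp
        then have "cmod (h t) * cmod (h s) * gauss_hat \<sigma> (s - t) \<le> ((cmod (h t))^2 / 2 + (cmod (h s))^2 / 2) * gauss_hat \<sigma> (s - t)"
          by (intro mult_right_mono gauss_hat_nonneg)
        then show "ennreal (cmod (cnj (h t) * (h s * of_real (gauss_hat \<sigma> (s - t))))) \<le> ?P t s + ?Q t s"
          by (simp add: norm_mult gauss_hat_nonneg ennreal_leI distrib_right flip: ennreal_mult ennreal_plus)
      qed
      finally show "ennreal (cmod (cnj (h t) * (LBINT s. h s * of_real (gauss_hat \<sigma> (s - t))))) \<le> (\<integral>\<^sup>+s. ?P t s + ?Q t s \<partial>lborel)" .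
    qed
    also have "\<dots> = (\<integral>\<^sup>+t. \<integral>\<^sup>+s. ?P t s \<partial>lborel \<partial>lborel) + (\<integral>\<^sup>+t. \<integral>\<^sup>+s. ?Q t s \<partial>lborel \<partial>lborel)"
      by (subst nn_integral_add, measurable, subst nn_integral_add, measurable)
    also have "(\<integral>\<^sup>+t. \<integral>\<^sup>+s. ?P t s \<partial>lborel \<partial>lborel) = (\<integral>\<^sup>+t. ennreal ((cmod (h t))^2 / 2) \<partial>lborel)"
      by (subst nn_integral_cmult, measurable) (simp add: G1)
    also have "(\<integral>\<^sup>+t. \<integral>\<^sup>+s. ?Q t s \<partial>lborel \<partial>lborel) = (\<integral>\<^sup>+s. \<integral>\<^sup>+t. ?Q t s \<partial>lborel \<partial>lborel)"
      by (rule lborel_pair.Fubini'[symmetric]) measurable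
    also have "\<dots> = (\<integral>\<^sup>+s. ennreal ((cmod (h s))^2 / 2) \<partial>lborel)"
      by (subst nn_integral_cmult, measurable) (simp add: G2)
    also have "(\<integral>\<^sup>+t. ennreal ((cmod (h t))^2 / 2) \<partial>lborel) + (\<integral>\<^sup>+s. ennreal ((cmod (h s))^2 / 2) \<partial>lborel) = (\<integral>\<^sup>+t. ennreal ((cmod (h t))^2) \<partial>lborel)"
      by (subst nn_integral_add[symmetric]) (auto simp flip: ennreal_plus)
    finally show ?thesis .
  qed
  \<comment> \<open>As the width grows the weight tends to 1 everywhere, and Fatou's lemma removes
    it.\<close>
  have lim: "(\<lambda>n. ennreal (gauss (real (Suc n)) y * (cmod (H y))^2)) \<longlonglongrightarrow> ennreal ((cmod (H y))^2)" for y
  proof -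
    have "(\<lambda>n. 1 / real (Suc n)) \<longlonglongrightarrow> 0" using LIMSEQ_Suc[OF lim_1_over_n] by simp
    then have "(\<lambda>n. (\<Prod>b\<in>Basis. exp (- (y \<bullet> b)\<^sup>2 / 2 * (1 / real (Suc n))^2)) * (cmod (H y))^2)
        \<longlonglongrightarrow> (\<Prod>b\<in>(Basis::'a set). exp (- (y \<bullet> b)\<^sup>2 / 2 * 0^2)) * (cmod (H y))^2"
      by (intro tendsto_intros)
    then have "(\<lambda>n. gauss (real (Suc n)) y * (cmod (H y))^2) \<longlonglongrightarrow> (cmod (H y))^2"
      unfolding gauss_def by (simp add: power_divide)
    then show ?thesis by (intro tendsto_intros)
  qed
  have "(\<integral>\<^sup>+y. ennreal ((cmod (H y))^2) \<partial>lborel) = (\<integral>\<^sup>+y. liminf (\<lambda>n. ennreal (gauss (real (Suc n)) y * (cmod (H y))^2)) \<partial>lborel)"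
    by (intro nn_integral_cong) (simp only: lim_imp_Liminf[OF sequentially_bot lim])
  also have "\<dots> \<le> liminf (\<lambda>n. \<integral>\<^sup>+y. ennreal (gauss (real (Suc n)) y * (cmod (H y))^2) \<partial>lborel)"
    by (rule nn_integral_liminf) measurable
  also have "\<dots> \<le> liminf (\<lambda>n::nat. \<integral>\<^sup>+t. ennreal ((cmod (h t))^2) \<partial>lborel)"
    by (intro Liminf_mono always_eventually allI reg) simp
  also have "\<dots> = (\<integral>\<^sup>+t. ennreal ((cmod (h t))^2) \<partial>lborel)" by (simp add: Liminf_const)
  finally show ?thesis .
qed

lemma continuous_on_coefficient: "continuous_on UNIV (\<lambda>v. (cmod (cinner (schroedinger v g) b))^2)"
proof (intro continuous_intros)
  show "continuous_on UNIV (\<lambda>v. cinner (schroedinger v g) b)"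
    using continuous_on_rho[of g] by (auto simp: continuous_on_def intro!: tendsto_intros)
qed

text \<open>For fixed \<open>x\<close> the coefficient is, up to a phase, the Fourier transform in
  \<open>y\<close> of the integrable function \<open>\<phi> (t + x) * cnj (\<beta> t)\<close>.
  Plancherel's inequality in \<open>y\<close> leaves a double integral that factors when
  \<open>x\<close> is integrated first.\<close>

lemma Moyal_inequality:
  "(\<integral>\<^sup>+v. ennreal ((cmod (cinner (schroedinger v g) b))^2) \<partial>lborel) \<le> ennreal ((norm g)^2 * (norm b)^2)"
proof -
  obtain \<phi> where \<phi>: "square_integrable \<phi>" "g = abs_L2 \<phi>" by (rule L2_exhaust)
  obtain \<beta> where \<beta>: "square_integrable \<beta>" "b = abs_L2 \<beta>" by (rule L2_exhaust)
  have [measurable]: "\<phi> \<in> borel_measurable borel" "\<beta> \<in> borel_measurable borel"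
    using \<phi> \<beta> by (simp_all add: square_integrable_def)
  define h where "h x t = \<phi> (t + x) * cnj (\<beta> t)" for x t
  have ih: "integrable lborel (h x)" for x
    unfolding h_def by (rule square_integrable_mult_cnj[OF square_integrable_translate[OF \<phi>(1)] \<beta>(1)])
  have eq: "cmod (cinner (rho x y 1 g) b) = cmod (LBINT t. wave y t * h x t)" for x y
  proof -
    have "cinner (rho x y 1 g) b = (LBINT t. exp (\<i> * of_real (pi * (x \<bullet> y + 2 * (y \<bullet> t)))) * \<phi> (t + x) * cnj (\<beta> t))"
      unfolding \<phi>(2) \<beta>(2) rho_abs_L2(2)[OF \<phi>(1)] by (rule cinner_abs_L2[OF rho_abs_L2(1)[OF \<phi>(1)] \<beta>(1)])
    also have "\<dots> = (LBINT t. exp (\<i> * of_real (pi * (x \<bullet> y))) * (wave y t * h x t))"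
    proof (intro Bochner_Integration.integral_cong refl)
      fix t
      have "exp (\<i> * of_real (pi * (x \<bullet> y + 2 * (y \<bullet> t)))) = exp (\<i> * of_real (pi * (x \<bullet> y))) * wave y t"
        unfolding wave_def by (simp add: algebra_simps flip: exp_add)
      then show "exp (\<i> * of_real (pi * (x \<bullet> y + 2 * (y \<bullet> t)))) * \<phi> (t + x) * cnj (\<beta> t)
        = exp (\<i> * of_real (pi * (x \<bullet> y))) * (wave y t * h x t)" by (simp add: h_def mult_ac)
    qed
    also have "cmod \<dots> = cmod (LBINT t. wave y t * h x t)"
      by (simp only: integral_mult_right_zero norm_mult norm_exp_i_times mult_1_left)
    finally show ?thesis .
  qed
  have [measurable]: "(\<lambda>v. (cmod (cinner (schroedinger v g) b))^2) \<in> borel_measurable borel"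
    by (rule borel_measurable_continuous_onI[OF continuous_on_coefficient])
  have "(\<integral>\<^sup>+v. ennreal ((cmod (cinner (schroedinger v g) b))^2) \<partial>lborel)
      = (\<integral>\<^sup>+v. ennreal ((cmod (cinner (schroedinger v g) b))^2) \<partial>(lborel \<Otimes>\<^sub>M lborel))"
    by (simp add: lborel_prod)
  also have "\<dots> = (\<integral>\<^sup>+x. \<integral>\<^sup>+y. ennreal ((cmod (cinner (rho x y 1 g) b))^2) \<partial>lborel \<partial>lborel)"
    by (subst lborel.nn_integral_fst[symmetric]) (simp_all add: lborel_prod)
  also have "\<dots> \<le> (\<integral>\<^sup>+x. \<integral>\<^sup>+t. ennreal ((cmod (h x t))^2) \<partial>lborel \<partial>lborel)"
    unfolding eq by (intro nn_integral_mono Plancherel_inequality ih)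
  also have "\<dots> = (\<integral>\<^sup>+x. \<integral>\<^sup>+t. ennreal ((cmod (\<beta> t))^2) * ennreal ((cmod (\<phi> (t + x)))^2) \<partial>lborel \<partial>lborel)"
    unfolding h_def by (simp add: norm_mult power_mult_distrib ennreal_mult mult.commute)
  also have "\<dots> = (\<integral>\<^sup>+t. \<integral>\<^sup>+x. ennreal ((cmod (\<beta> t))^2) * ennreal ((cmod (\<phi> (t + x)))^2) \<partial>lborel \<partial>lborel)"
    by (rule lborel_pair.Fubini'[symmetric]) measurable
  also have "\<dots> = (\<integral>\<^sup>+t. ennreal ((cmod (\<beta> t))^2) * ennreal ((norm g)^2) \<partial>lborel)"
  proof (intro nn_integral_cong)
    fix t
    have "(\<integral>\<^sup>+x. ennreal ((cmod (\<phi> (t + x)))^2) \<partial>lborel) = ennreal ((norm g)^2)"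
      using lborel_nn_integral_shift[of "\<lambda>x. ennreal ((cmod (\<phi> x))^2)" t] nn_norm_abs_L2[OF \<phi>(1)]
      by (simp add: add.commute \<phi>(2))
    then show "(\<integral>\<^sup>+x. ennreal ((cmod (\<beta> t))^2) * ennreal ((cmod (\<phi> (t + x)))^2) \<partial>lborel) = ennreal ((cmod (\<beta> t))^2) * ennreal ((norm g)^2)"
      by (subst nn_integral_cmult) simp_all
  qed
  also have "\<dots> = ennreal ((norm b)^2) * ennreal ((norm g)^2)"
    by (subst nn_integral_multc) (simp_all add: nn_norm_abs_L2[OF \<beta>(1)] \<beta>(2))
  also have "\<dots> = ennreal ((norm g)^2 * (norm b)^2)" by (simp add: ennreal_mult mult.commute)
  finally show ?thesis .
qed

section \<open>Schatten class operators\<close>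

lemma ball_int_const: "0 \<le> R \<Longrightarrow> ball_int (\<lambda>_::'a::euclidean_space. c) R = c * (unit_ball_vol (real DIM('a)) * R ^ DIM('a))"
  unfolding ball_int_def by (simp add: content_cball mult.commute)

lemma ball_int_coefficient:
  "ball_int (\<lambda>v. (cmod (cinner (schroedinger v g) b))^2) R \<le> (norm g)^2 * (norm b)^2"
proof -
  define w where "w v = (cmod (cinner (schroedinger v g) b))^2" for v
  have w: "continuous_on UNIV w" unfolding w_def by (rule continuous_on_coefficient)
  have "ennreal (ball_int w R) = (\<integral>\<^sup>+v. ennreal (indicator (cball 0 R) v * w v) \<partial>lborel)"
    unfolding ball_int_def
    by (rule nn_integral_eq_integral[OF integrable_ball[OF w], symmetric]) (simp add: w_def)
  also have "\<dots> \<le> (\<integral>\<^sup>+v. ennreal (w v) \<partial>lborel)"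
    by (intro nn_integral_mono ennreal_leI) (simp add: w_def indicator_def)
  also have "\<dots> \<le> ennreal ((norm g)^2 * (norm b)^2)" unfolding w_def by (rule Moyal_inequality)
  finally have "ball_int w R \<le> (norm g)^2 * (norm b)^2" by (subst (asm) ennreal_le_iff) auto
  then show ?thesis unfolding w_def .
qed

text \<open>Only here does the upper bound on \<open>p\<close> enter. For \<open>t\<close> proportional to \<open>R\<close> the first summand integrates to
  a multiple of \<open>R\<close> over the ball of radius \<open>R\<close> in dimension \<open>d\<close>.\<close>

lemma square_le_power_plus_powr:
  fixes s t p :: real and d :: nat
  assumes s: "0 < s" "s \<le> 1" and t: "0 < t" and d: "2 \<le> d" and p: "p \<le> 2 * real d / (real d - 1)"
  shows "s^2 \<le> (1 / t) ^ (d - 1) + t * s powr p"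
\<comment> \<open>The split is at the \<open>s\<close> where \<open>s^2\<close> equals both
  \<open>(1 / t) ^ (d - 1)\<close> and \<open>t * s powr (2 * d / (d - 1))\<close>. Above it the
  latter wins, and \<open>s \<le> 1\<close> lowers the exponent to \<open>p\<close>; below it the
  former wins.\<close>
proof (cases "1 \<le> t * s powr (2 / (real d - 1))")
  case True
  have "2 * real d / (real d - 1) = 2 + 2 / (real d - 1)" using d by (simp add: field_simps)
  then have "s powr 2 * s powr (2 / (real d - 1)) = s powr (2 * real d / (real d - 1))" by (simp add: powr_add)
  also have "\<dots> \<le> s powr p" using p s by (intro powr_mono') auto
  finally have le: "s powr 2 * s powr (2 / (real d - 1)) \<le> s powr p" .
  have "s^2 = s powr 2 * 1" using s by (simp add: powr_numeral)
  also have "\<dots> \<le> s powr 2 * (t * s powr (2 / (real d - 1)))" using True by (intro mult_left_mono) auto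
  also have "\<dots> \<le> t * s powr p" using le t by (simp add: mult.left_commute mult_left_mono)
  finally show ?thesis using t by (simp add: add_increasing)
next
  case False
  then have le: "s powr (2 / (real d - 1)) \<le> 1 / t" using t by (simp add: field_simps)
  have e: "2 / (real d - 1) * real (d - 1) = 2" using d by (simp add: of_nat_diff field_simps)
  have "s^2 = s powr (2 / (real d - 1) * real (d - 1))" unfolding e using s by (simp add: powr_numeral)
  also have "\<dots> = (s powr (2 / (real d - 1))) powr real (d - 1)" by (simp only: powr_powr)
  also have "\<dots> = (s powr (2 / (real d - 1))) ^ (d - 1)" using s by (intro powr_realpow) simp
  also have "\<dots> \<le> (1 / t) ^ (d - 1)" using le by (intro power_mono) auto
  finally show ?thesis using t by (simp add: add_increasing2)
qed

text \<open>\<open>K\<close> may depend on \<open>\<theta>\<close> but not on \<open>R\<close>, so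
  it disappears after division by \<open>R\<close>; \<open>C\<close> is independent of
  \<open>\<theta>\<close>, which is then sent to 0.\<close>

lemma growth_criterion:
  fixes m :: "real \<Rightarrow> real"
  assumes m: "\<And>R. 0 \<le> m R" and C: "0 \<le> C"
    and bound: "\<And>\<theta>. 0 < \<theta> \<Longrightarrow> \<theta> \<le> 1 \<Longrightarrow> \<exists>K. \<forall>R\<ge>1. m R \<le> K + \<theta> * C * R"
  shows "((\<lambda>R. m R / R) \<longlongrightarrow> 0) at_top"
proof (rule tendstoI)
  fix e :: real assume e: "0 < e"
  define \<theta> where "\<theta> = min 1 (e / (2 * (C + 1)))"
  have \<theta>: "0 < \<theta>" "\<theta> \<le> 1" "\<theta> * C \<le> e / 2"
  proof -
    show "0 < \<theta>" "\<theta> \<le> 1" using e C by (auto simp: \<theta>_def)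
    have "\<theta> * C \<le> e / (2 * (C + 1)) * C" using C by (intro mult_right_mono) (auto simp: \<theta>_def)
    also have "\<dots> \<le> e / 2" using C e by (simp add: field_simps)
    finally show "\<theta> * C \<le> e / 2" .
  qed
  obtain K where K: "\<And>R. 1 \<le> R \<Longrightarrow> m R \<le> K + \<theta> * C * R" using bound[OF \<theta>(1,2)] by blast
  show "\<forall>\<^sub>F R in at_top. dist (m R / R) 0 < e"
    using eventually_ge_at_top[of 1] eventually_gt_at_top[of "2 * K / e"]
  proof eventually_elim
    case (elim R)
    have "m R \<le> K + \<theta> * C * R" by (rule K[OF elim(1)])
    also have "\<theta> * C * R \<le> e / 2 * R" using \<theta>(3) elim(1) by (intro mult_right_mono) auto
    also have "K + e / 2 * R < e * R" using elim e by (simp add: field_simps)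
    finally have "m R < e * R" by simp
    then show ?case using elim(1) m[of R] by (simp add: field_simps)
  qed
qed

text \<open>Three ranges of singular values. The finitely many \<open>s \<ge> \<delta>0\<close>
  contribute a bounded amount by Moyal's inequality. Those in \<open>[\<delta>, \<delta>0)\<close>
  are split by \<open>square_le_power_plus_powr\<close>: its first term is summed pointwise by
  Bessel and multiplied by the volume, its second by Moyal and the small tail of the Schatten sum.
  Those below \<open>\<delta>\<close> are beaten by \<open>\<delta>^2\<close> against the
  volume.\<close>

lemma schatten_growth:
  fixes A :: "'a::euclidean_space L2 \<Rightarrow> 'a L2"
  assumes A: "A \<in> schatten_class p" and p1: "1 \<le> p" and p: "p \<le> 2 * real DIM('a \<times> 'a) / (real DIM('a \<times> 'a) - 1)"
  shows "((\<lambda>R. ball_int (\<lambda>v. (norm (A (schroedinger v g)))^2) R / R) \<longlongrightarrow> 0) at_top"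
proof -
  have cA: "compact_operator A" and sum: "(\<lambda>s. real (singular_mult A s) * s powr p) summable_on singular_values A"
    using A by (auto simp: schatten_class_def)
  define a where "a s = real (singular_mult A s) * s powr p" for s
  have a0: "0 \<le> a s" for s by (simp add: a_def)
  note sum_a = sum[folded a_def]
  define SV where "SV = singular_values A"
  have pos: "0 < s" if "s \<in> SV" for s using that by (simp add: SV_def singular_values_def)
  obtain B where B0: "\<forall>s>0. finite (B s) \<and> orthonormal (B s) \<and> card (B s) = singular_mult A s"
    "\<forall>s\<in>SV. B s \<noteq> {}"
    "\<forall>F f. finite F \<longrightarrow> F \<subseteq> SV \<longrightarrow> (\<Sum>s\<in>F. \<Sum>b\<in>B s. (cmod (cinner f b))^2) \<le> (norm f)^2"
    "\<forall>\<delta> f. 0 < \<delta> \<longrightarrow> finite {s \<in> SV. \<delta> \<le> s} \<longrightarrow>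
      (norm (A f))^2 \<le> (\<Sum>s | s \<in> SV \<and> \<delta> \<le> s. s^2 * (\<Sum>b\<in>B s. (cmod (cinner f b))^2)) + \<delta>^2 * (norm f)^2"
    using singular_system[OF cA, folded SV_def] by (elim exE conjE)
  note B = B0[rule_format]
  define d where "d = DIM('a \<times> 'a)"
  have d: "2 \<le> d" 
  proof -
    have "0 < DIM('a)" by simp
    then show ?thesis unfolding d_def DIM_prod by linarith
  qed
  define c where "c = unit_ball_vol (real d)"
  have c0: "0 \<le> c" by (simp add: c_def)
  define G where "G = (norm g)^2"
  have G0: "0 \<le> G" by (simp add: G_def)
  define \<rho> where "\<rho> v = schroedinger v g" for v
  have \<rho>n: "(norm (\<rho> v))^2 = G" for v by (simp add: \<rho>_def G_def rho_norm_eq)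
  define w where "w s v = (\<Sum>b\<in>B s. (cmod (cinner (\<rho> v) b))^2)" for s v
  have w: "continuous_on UNIV (w s)" for s
    unfolding w_def \<rho>_def by (intro continuous_on_sum continuous_on_coefficient)
  have w0: "0 \<le> w s v" for s v unfolding w_def by (intro sum_nonneg) auto
  have wG: "(\<Sum>s\<in>F. w s v) \<le> G" if "finite F" "F \<subseteq> SV" for F v
    unfolding w_def using B(3)[OF that, of "\<rho> v"] by (simp add: \<rho>n)
  have w_int: "ball_int (w s) R \<le> real (singular_mult A s) * G" if "s \<in> SV" for s R
  proof -
    note Bs = B(1)[OF pos[OF that]]
    have nb: "norm b = 1" if "b \<in> B s" for b
      unfolding norm_eq_1_iff_cinner using Bs orthonormalD[of "B s" b b] that by simp
    have "ball_int (w s) R = (\<Sum>b\<in>B s. ball_int (\<lambda>v. (cmod (cinner (\<rho> v) b))^2) R)"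
      unfolding w_def \<rho>_def by (intro ball_int_sum continuous_on_coefficient)
    also have "\<dots> \<le> (\<Sum>b\<in>B s. G)"
    proof (rule sum_mono)
      fix b assume "b \<in> B s"
      then show "ball_int (\<lambda>v. (cmod (cinner (\<rho> v) b))^2) R \<le> G"
        using ball_int_coefficient[of g b R] nb by (simp add: \<rho>_def G_def)
    qed
    finally show ?thesis using Bs by simp
  qed
  have fin: "finite {s \<in> SV. \<delta> \<le> s}" if \<delta>: "0 < \<delta>" for \<delta>
  proof -
    have "{s \<in> SV. \<delta> \<le> s} \<subseteq> {s \<in> SV. \<delta> powr p \<le> a s}"
    proof safe
      fix s assume s: "s \<in> SV" "\<delta> \<le> s"
      \<comment> \<open>Multiplicity at least 1 turns a lower bound on \<open>s\<close> into one on
        the summand \<open>a s\<close>.\<close>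
      have "singular_mult A s \<noteq> 0" using B(1)[OF pos[OF s(1)]] B(2)[OF s(1)] by (metis card_0_eq)
      then have "1 * \<delta> powr p \<le> real (singular_mult A s) * s powr p"
        using s(2) \<delta> p1 by (intro mult_mono powr_mono2) auto
      then show "\<delta> powr p \<le> a s" by (simp add: a_def)
    qed
    moreover have "finite {s \<in> SV. \<delta> powr p \<le> a s}"
      unfolding SV_def using \<delta> by (intro summable_on_finite_superlevel[OF sum_a]) (auto simp: a0)
    ultimately show ?thesis by (rule finite_subset)
  qed
  show ?thesis
  proof (rule growth_criterion[of _ "(c + 1) * G"])
    show "0 \<le> ball_int (\<lambda>v. (norm (A (schroedinger v g)))^2) R" for R by (rule ball_int_nonneg) simp
    show "0 \<le> (c + 1) * G" using c0 G0 by simp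
    fix \<theta> :: real assume \<theta>: "0 < \<theta>" "\<theta> \<le> 1"
    \<comment> \<open>The tail is \<open>\<theta>^2\<close> because Moyal's part carries the factor
      \<open>t = R / \<theta>\<close>, and the product is \<open>\<theta> * R\<close>.\<close>
    obtain F0 where F0: "finite F0" "F0 \<subseteq> SV" "\<And>H. finite H \<Longrightarrow> H \<subseteq> SV - F0 \<Longrightarrow> sum a H \<le> \<theta>^2"
      using summable_on_small_tail[OF sum_a, of "\<theta>^2"] a0 \<theta> unfolding SV_def by (metis zero_less_power)
    define \<delta>0 where "\<delta>0 = Min (insert 1 F0)"
    have \<delta>0: "0 < \<delta>0" "\<delta>0 \<le> 1" "\<And>s. s \<in> F0 \<Longrightarrow> \<delta>0 \<le> s"
      unfolding \<delta>0_def using F0(1,2) pos by (auto simp: Min_gr_iff)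
    define K where "K = (\<Sum>s | s \<in> SV \<and> \<delta>0 \<le> s. s^2 * (real (singular_mult A s) * G)) + c * G"
    have "ball_int (\<lambda>v. (norm (A (\<rho> v)))^2) R \<le> K + \<theta> * ((c + 1) * G) * R" if R: "1 \<le> R" for R
    proof -
      \<comment> \<open>Depends on \<open>R\<close>: as \<open>\<delta> \<le> 1\<close>,
        \<open>\<delta>^2 \<le> 1 / R ^ d\<close> cancels the volume growth, leaving the
        \<open>c * G\<close> in \<open>K\<close>.\<close>
      define \<delta> where "\<delta> = min \<delta>0 (1 / R ^ d)"
      have Rd: "1 \<le> R ^ d" using R by (simp add: one_le_power)
      have \<delta>: "0 < \<delta>" "\<delta> \<le> \<delta>0" "\<delta>^2 \<le> 1 / R ^ d"
      proof -
        show "0 < \<delta>" "\<delta> \<le> \<delta>0" using \<delta>0(1) R by (auto simp: \<delta>_def)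
        have "\<delta>^2 \<le> \<delta>" using \<open>0 < \<delta>\<close> \<open>\<delta> \<le> \<delta>0\<close> \<delta>0(2) by (simp add: power2_eq_square mult_left_le)
        then show "\<delta>^2 \<le> 1 / R ^ d" by (simp add: \<delta>_def)
      qed
      \<comment> \<open>With this \<open>t\<close> the pointwise term
        \<open>(1 / t) ^ (d - 1)\<close> times the volume \<open>c * R ^ d\<close> is
        \<open>\<theta> ^ (d - 1) * c * R\<close>, linear in \<open>R\<close>;
        \<open>d \<ge> 2\<close> bounds the power by \<open>\<theta>\<close>.\<close>
      define t where "t = R / \<theta>"
      have t: "0 < t" using R \<theta> by (simp add: t_def)
      define F where "F = {s \<in> SV. \<delta>0 \<le> s}"
      define H where "H = {s \<in> SV. \<delta> \<le> s \<and> s < \<delta>0}"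
      have F: "finite F" unfolding F_def by (rule fin[OF \<delta>0(1)])
      have H: "finite H" unfolding H_def by (rule finite_subset[OF _ fin[OF \<delta>(1)]]) auto
      have FH: "{s. s \<in> SV \<and> \<delta> \<le> s} = F \<union> H" "F \<inter> H = {}" using \<delta>(2) by (auto simp: F_def H_def)
      have HSV: "H \<subseteq> SV" "F \<subseteq> SV" by (auto simp: H_def F_def)
      have tail: "sum a H \<le> \<theta>^2" using H \<delta>0(3) by (intro F0(3)) (force simp: H_def)+
      define E where "E = (1 / t) ^ (d - 1) * G + 1 / R ^ d * G"
      define V where "V v = (\<Sum>s\<in>F. s^2 * w s v) + (\<Sum>s\<in>H. t * s powr p * w s v) + E" for v
      have le: "(norm (A (\<rho> v)))^2 \<le> V v" for v
      proof -
        have "(norm (A (\<rho> v)))^2 \<le> (\<Sum>s | s \<in> SV \<and> \<delta> \<le> s. s^2 * w s v) + \<delta>^2 * G"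
          using B(4)[OF \<delta>(1) fin[OF \<delta>(1)], of "\<rho> v"] unfolding w_def \<rho>n .
        also have "(\<Sum>s | s \<in> SV \<and> \<delta> \<le> s. s^2 * w s v) = (\<Sum>s\<in>F. s^2 * w s v) + (\<Sum>s\<in>H. s^2 * w s v)"
          unfolding FH(1) by (rule sum.union_disjoint[OF F H FH(2)])
        also have "(\<Sum>s\<in>H. s^2 * w s v) \<le> (\<Sum>s\<in>H. (1 / t) ^ (d - 1) * w s v + t * s powr p * w s v)"
        proof (rule sum_mono)
          fix s assume s: "s \<in> H"
          have "s^2 \<le> (1 / t) ^ (d - 1) + t * s powr p"
            using s pos \<delta>0(2) p by (intro square_le_power_plus_powr t d) (auto simp: H_def d_def)
          then have "s^2 * w s v \<le> ((1 / t) ^ (d - 1) + t * s powr p) * w s v" using w0 by (rule mult_right_mono)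
          then show "s^2 * w s v \<le> (1 / t) ^ (d - 1) * w s v + t * s powr p * w s v" by (simp only: distrib_right)
        qed
        also have "\<dots> = (1 / t) ^ (d - 1) * (\<Sum>s\<in>H. w s v) + (\<Sum>s\<in>H. t * s powr p * w s v)"
          by (simp only: sum.distrib sum_distrib_left)
        also have "(1 / t) ^ (d - 1) * (\<Sum>s\<in>H. w s v) \<le> (1 / t) ^ (d - 1) * G"
          using t by (intro mult_left_mono wG[OF H HSV(1)]) auto
        finally have "(norm (A (\<rho> v)))^2 \<le> (\<Sum>s\<in>F. s^2 * w s v) + ((1 / t) ^ (d - 1) * G + (\<Sum>s\<in>H. t * s powr p * w s v)) + \<delta>^2 * G"
          by simp
        moreover have "\<delta>^2 * G \<le> 1 / R ^ d * G" using \<delta>(3) G0 by (rule mult_right_mono)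
        ultimately show ?thesis unfolding V_def E_def by linarith
      qed
      have cA': "continuous_on UNIV (\<lambda>v. (norm (A (\<rho> v)))^2)"
        unfolding \<rho>_def by (intro continuous_intros bounded_linear.continuous_on[OF compact_bounded_linear[OF cA]] continuous_on_rho)
      have cF: "continuous_on UNIV (\<lambda>v. \<Sum>s\<in>F. s^2 * w s v)" and cH: "continuous_on UNIV (\<lambda>v. \<Sum>s\<in>H. t * s powr p * w s v)"
        by (intro continuous_on_sum continuous_on_mult continuous_on_const w)+
      have "ball_int (\<lambda>v. (norm (A (\<rho> v)))^2) R \<le> ball_int V R"
        unfolding V_def by (intro ball_int_mono[OF cA'] continuous_on_add cF cH continuous_on_const) (use le in \<open>simp add: V_def\<close>)
      also have "\<dots> = (\<Sum>s\<in>F. s^2 * ball_int (w s) R) + (\<Sum>s\<in>H. t * s powr p * ball_int (w s) R) + E * (c * R ^ d)"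
      proof -
        have "ball_int V R = ball_int (\<lambda>v. \<Sum>s\<in>F. s^2 * w s v) R + ball_int (\<lambda>v. \<Sum>s\<in>H. t * s powr p * w s v) R + ball_int (\<lambda>_::'a\<times>'a. E) R"
          unfolding V_def by (simp only: ball_int_add continuous_on_add cF cH continuous_on_const)
        also have "ball_int (\<lambda>v. \<Sum>s\<in>F. s^2 * w s v) R = (\<Sum>s\<in>F. s^2 * ball_int (w s) R)"
          by (subst ball_int_sum) (intro continuous_on_mult continuous_on_const w, simp only: ball_int_cmult)
        also have "ball_int (\<lambda>v. \<Sum>s\<in>H. t * s powr p * w s v) R = (\<Sum>s\<in>H. t * s powr p * ball_int (w s) R)"
          by (subst ball_int_sum) (intro continuous_on_mult continuous_on_const w, simp only: ball_int_cmult)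
        also have "ball_int (\<lambda>_::'a\<times>'a. E) R = E * (c * R ^ d)"
          using R unfolding c_def d_def by (intro ball_int_const) simp
        finally show ?thesis .
      qed
      also have "(\<Sum>s\<in>F. s^2 * ball_int (w s) R) \<le> (\<Sum>s\<in>F. s^2 * (real (singular_mult A s) * G))"
        using HSV by (intro sum_mono mult_left_mono w_int) auto
      also have "(\<Sum>s\<in>H. t * s powr p * ball_int (w s) R) \<le> (\<Sum>s\<in>H. t * s powr p * (real (singular_mult A s) * G))"
        using HSV t by (intro sum_mono mult_left_mono w_int) auto
      also have "(\<Sum>s\<in>H. t * s powr p * (real (singular_mult A s) * G)) = t * G * sum a H"
        unfolding a_def sum_distrib_left by (intro sum.cong refl) (simp only: mult_ac)
      also have "t * G * sum a H \<le> t * G * \<theta>^2" using tail t G0 by (intro mult_left_mono) auto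
      also have "t * G * \<theta>^2 = \<theta> * G * R" using \<theta> by (simp add: t_def power2_eq_square)
      also have "E * (c * R ^ d) = \<theta> ^ (d - 1) * (c * G) * R + c * G"
      proof -
        have "R ^ d = R ^ (d - 1) * R" using d by (metis Suc_diff_1 less_le_trans pos2 power_Suc2)
        then have "(1 / t) ^ (d - 1) * R ^ d = \<theta> ^ (d - 1) * R" using R by (simp add: t_def power_divide)
        then have "(1 / t) ^ (d - 1) * G * (c * R ^ d) = \<theta> ^ (d - 1) * (c * G) * R" by (metis mult.assoc mult.commute)
        moreover have "1 / R ^ d * G * (c * R ^ d) = c * G" using R by simp
        ultimately show ?thesis unfolding E_def by (simp only: distrib_right)
      qed
      also have "\<theta> ^ (d - 1) * (c * G) * R \<le> \<theta> * (c * G) * R"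
      proof -
        have "\<theta> ^ (d - 1) \<le> \<theta> ^ 1" using \<theta> d by (intro power_decreasing) auto
        then show ?thesis using c0 G0 R by (intro mult_right_mono) auto
      qed
      finally show ?thesis unfolding K_def F_def by (simp add: algebra_simps)
    qed
    then show "\<exists>K. \<forall>R\<ge>1. ball_int (\<lambda>v. (norm (A (schroedinger v g)))^2) R \<le> K + \<theta> * ((c + 1) * G) * R"
      unfolding \<rho>_def by blast
  qed
qed

section \<open>From matrix coefficients to translates of operators\<close>

lemma rho_phase: "rho x y z f = z *\<^sub>C rho x y 1 f"
proof -
  obtain \<phi> where \<phi>: "square_integrable \<phi>" "f = abs_L2 \<phi>" by (rule L2_exhaust)
  have "rho x y z f = abs_L2 (\<lambda>t. z * (exp (\<i> * of_real (pi * (x \<bullet> y + 2 * (y \<bullet> t)))) * \<phi> (t + x)))"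
    unfolding \<phi>(2) rho.abs_eq[OF ae_eq_sq_refl[OF \<phi>(1)]] by (simp only: mult.assoc)
  also have "\<dots> = z *\<^sub>C abs_L2 (\<lambda>t. exp (\<i> * of_real (pi * (x \<bullet> y + 2 * (y \<bullet> t)))) * \<phi> (t + x))"
    by (rule cscale.abs_eq[symmetric]) (rule ae_eq_sq_refl[OF rho_abs_L2(1)[OF \<phi>(1)]])
  finally show ?thesis unfolding \<phi>(2) rho_abs_L2(2)[OF \<phi>(1)] .
qed

text \<open>Unitarity moves \<open>rho x y 1\<close> to the second argument. By the group law both
  arguments then carry the same phase \<open>z\<close>, once through the linear \<open>A\<close> and
  once conjugated, so it cancels.\<close>

lemma cinner_quantum_translate:
  assumes A: "bounded_clinear A"
  shows "cinner (quantum_translate x y A (rho x' y' 1 f)) (rho x' y' 1 g)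
    = cinner (A (rho (x' - x) (y' - y) 1 f)) (rho (x' - x) (y' - y) 1 g)"
proof -
  define z where "z = exp (\<i> * of_real (pi * ((- x) \<bullet> y' - (- y) \<bullet> x')))"
  have z: "z * cnj z = 1" unfolding complex_norm_square[symmetric] by (simp add: z_def norm_exp_i_times del: of_real_mult of_real_diff)
  have r: "rho (- x) (- y) 1 (rho x' y' 1 h) = z *\<^sub>C rho (x' - x) (y' - y) 1 h" for h
    unfolding rho_mult by (subst rho_phase) (simp add: z_def)
  have "rho x' y' 1 g = rho x y 1 (rho (- x) (- y) 1 (rho x' y' 1 g))"
    using surj_f_inv_f[OF bij_is_surj[OF bij_rho], of x y "rho x' y' 1 g"] by (simp add: rho_inverse)
  then have "cinner (quantum_translate x y A (rho x' y' 1 f)) (rho x' y' 1 g)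
      = cinner (A (rho (- x) (- y) 1 (rho x' y' 1 f))) (rho (- x) (- y) 1 (rho x' y' 1 g))"
    unfolding quantum_translate_def o_def rho_inverse by (metis cinner_rho)
  also have "\<dots> = (z * cnj z) * cinner (A (rho (x' - x) (y' - y) 1 f)) (rho (x' - x) (y' - y) 1 g)"
    using A unfolding r by (simp add: bounded_clinear_def cinner_scale_left cinner_scale_right)
  finally show ?thesis by (simp add: z)
qed

theorem theorem1p1:
  fixes A :: "(real ^ 'n) L2 \<Rightarrow> (real ^ 'n) L2"
    and x y :: "nat \<Rightarrow> real ^ 'n"
    and k :: nat and p :: real
  assumes "1 \<le> p" and "p \<le> 4 * real CARD('n) / (2 * real CARD('n) - 1)"
    and "A \<in> schatten_class p" and "A \<noteq> (\<lambda>_. 0)"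
    and "inj_on (\<lambda>j. (x j, y j)) {1..k}"
  shows "\<forall>c :: nat \<Rightarrow> complex.
    (\<forall>f. (\<Sum>j=1..k. c j *\<^sub>C quantum_translate (x j) (y j) A f) = 0) \<longrightarrow> (\<forall>j\<in>{1..k}. c j = 0)"
proof (intro allI impI, rule ccontr)
  fix c :: "nat \<Rightarrow> complex"
  assume rel: "\<forall>f. (\<Sum>j=1..k. c j *\<^sub>C quantum_translate (x j) (y j) A f) = 0"
    and "\<not> (\<forall>j\<in>{1..k}. c j = 0)"
  then have c: "\<exists>j\<in>{1..k}. c j \<noteq> 0" by blast
  have cA: "compact_operator A" using assms(3) by (simp add: schatten_class_def)
  note bA = compact_bounded_clinear[OF cA] compact_bounded_linear[OF cA]
  \<comment> \<open>The phase space has dimension \<open>d = 2n\<close>, for which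
    \<open>2 * d / (d - 1)\<close> is the stated bound.\<close>
  have p: "p \<le> 2 * real DIM((real ^ 'n) \<times> (real ^ 'n)) / (real DIM((real ^ 'n) \<times> (real ^ 'n)) - 1)"
    using assms(2) by simp
  \<comment> \<open>The coefficient function \<open>u\<close> vanishes everywhere if the relation is
    nontrivial; its value at the origin is the matrix coefficient of \<open>A\<close>
    itself.\<close>
  have orth: "cinner (A g) h = 0" for g h
  proof -
    define u where "u v = cinner (A (schroedinger v g)) (schroedinger v h)" for v
    have cAg: "continuous_on UNIV (\<lambda>v. A (schroedinger v g))"
      by (intro bounded_linear.continuous_on[OF bA(2)] continuous_on_rho)
    have u: "continuous_on UNIV u"
      unfolding u_def using cAg continuous_on_rho[of h] by (auto simp: continuous_on_def intro!: tendsto_intros)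
    have "u v = 0" for v
    proof (rule translates_independent[OF u _ _ _ c])
      show "((\<lambda>R. ball_int (\<lambda>v. (cmod (u v))^2) R / R) \<longlongrightarrow> 0) at_top"
      proof (rule real_tendsto_sandwich[OF _ _ tendsto_const])
        let ?m = "\<lambda>R. ball_int (\<lambda>v. (norm (A (schroedinger v g)))^2) R"
        show "\<forall>\<^sub>F R in at_top. 0 \<le> ball_int (\<lambda>v. (cmod (u v))^2) R / R"
          using eventually_gt_at_top[of 0] by eventually_elim (auto intro!: divide_nonneg_pos ball_int_nonneg)
        show "\<forall>\<^sub>F R in at_top. ball_int (\<lambda>v. (cmod (u v))^2) R / R \<le> (norm h)^2 * (?m R / R)"
          using eventually_gt_at_top[of 0]
        proof eventually_elim
          fix R :: real assume R: "0 < R"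
          have "ball_int (\<lambda>v. (cmod (u v))^2) R \<le> ball_int (\<lambda>v. (norm h)^2 * (norm (A (schroedinger v g)))^2) R"
          proof (intro ball_int_mono continuous_intros u cAg)
            fix v
            have "(cmod (u v))^2 \<le> (norm (A (schroedinger v g)) * norm (schroedinger v h))^2"
              unfolding u_def by (intro power_mono cinner_Cauchy_Schwarz) simp
            then show "(cmod (u v))^2 \<le> (norm h)^2 * (norm (A (schroedinger v g)))^2"
              by (simp add: rho_norm_eq power_mult_distrib mult.commute)
          qed
          then have "ball_int (\<lambda>v. (cmod (u v))^2) R \<le> (norm h)^2 * ?m R" by (simp only: ball_int_cmult)
          then show "ball_int (\<lambda>v. (cmod (u v))^2) R / R \<le> (norm h)^2 * (?m R / R)"
            using R by (simp add: divide_right_mono)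
        qed
        show "((\<lambda>R. (norm h)^2 * (?m R / R)) \<longlongrightarrow> 0) at_top"
          by (rule tendsto_mult_right_zero[OF schatten_growth[OF assms(3) assms(1) p]])
      qed
      \<comment> \<open>A translate of \<open>A\<close> by \<open>(x j, y j)\<close> shifts the
        argument of \<open>u\<close> by the negative vector.\<close>
      show "inj_on (\<lambda>j. - (x j, y j)) {1..k}"
        by (rule inj_onI) (use assms(5) in \<open>simp only: neg_equal_iff_equal inj_on_def\<close>)
      fix v
      have "0 = cinner (\<Sum>j=1..k. c j *\<^sub>C quantum_translate (x j) (y j) A (schroedinger v g)) (schroedinger v h)"
        using rel by simp
      also have "\<dots> = (\<Sum>j=1..k. c j * u (v + - (x j, y j)))"
        by (simp add: cinner_sum_left cinner_scale_left cinner_quantum_translate[OF bA(1)] u_def)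
      finally show "(\<Sum>j=1..k. c j * u (v + - (x j, y j))) = 0" ..
    qed simp
    from this[of 0] show ?thesis by (simp add: u_def rho_one)
  qed
  \<comment> \<open>The choice \<open>h = A g\<close> makes the coefficient the squared
    norm.\<close>
  have "A g = 0" for g using orth[of g "A g"] by (simp add: cinner_self)
  then show False using assms(4) by blast
qed

end
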